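(* Let $(\Omega,\mathcal F,(\mathcal F_t)_{t\ge 0},P)$ be a filtered probability space and let $Y$ be a $d$-dimensional process of the form $$Y_t=Y_0+\int_0^t a_u\,\mathrm du+\int_0^t\sigma_{u-}\,\mathrm dW_u ,\qquad t\ge 0,$$ where $W$ is a $d'$-dimensional standard Brownian motion, $a$ is a $d$-dimensional predictable process with locally bounded sample paths, and $\sigma$ is an adapted $d\times d'$-matrix valued process with càdlàg sample paths. Let $g$ and $h$ be functions on $\mathbb R^d$ with values in the real $d_1\times d_2$ and $d_2\times d_3$ matrices respectively, all of whose entries are continuous with at most polynomial growth. Put $$Y^n(g,h)_t=\frac1n\sum_{i=1}^{\lfloor nt\rfloor} g\big(\sqrt n\,\Delta_i^nY\big)\,h\big(\sqrt n\,\Delta_{i+1}^nY\big),\qquad t\ge 0,\ n\ge 1 .$$ Then, as $n\to\infty$, $$Y^n(g,h)_t\ \longrightarrow\ Y(g,h)_t:=\int_0^t\rho_{\sigma_u}(g)\,\rho_{\sigma_u}(h)\,\mathrm du ,$$ where the convergence is in probability, locally uniformly in time (that is, $\sup_{0\le s\le t}\|Y^n(g,h)_s-Y(g,h)_s\|\to 0$ in probability for every $t\ge 0$).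
   Context: $\Delta_i^nY=Y_{i/n}-Y_{(i-1)/n}$ for integers $i,n\ge 1$; $\lfloor x\rfloor$ is the largest integer $\le x$. A (matrix valued) function $f$ on $\mathbb R^d$ has at most polynomial growth if there are constants $C>0$ and $p\ge 2$ with $\|f(x)\|\le C(1+\|x\|^p)$ for all $x\in\mathbb R^d$. For a $d\times d'$ matrix $\sigma$ and a (matrix valued) function $f$ on $\mathbb R^d$ of at most polynomial growth, $\rho_\sigma(f)=\mathrm E\{f(X)\}$ (entrywise) where $X\sim N(0,\sigma\sigma')$, with $\sigma'$ the transpose of $\sigma$. The Brownian motion $W$ is a Brownian motion with respect to $(\mathcal F_t)$. *)

theory Defs
  imports "HOL-Probability.Probability"
begin

section \<open>Centred normal laws\<close>

definition std_normal_vec :: "(real ^ 'n) measure" where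
  "std_normal_vec =
     distr (Pi\<^sub>M UNIV (\<lambda>_::'n. std_normal_distribution)) borel (\<lambda>z. \<chi> i. z i)"

text \<open>The law \<open>N(0, \<sigma>\<sigma>')\<close> on \<open>\<real>\<^sup>d\<close>, realised as the law of \<open>\<sigma> Z\<close> with \<open>Z\<close> standard normal,
  so that a singular \<open>\<sigma>\<sigma>'\<close> is allowed. Lemma \<open>char_normal_law\<close> below confirms that every linear
  functional has the characteristic function prescribed by the covariance matrix \<open>\<sigma>\<sigma>'\<close>.\<close>

definition normal_law :: "real ^ 'e ^ 'd \<Rightarrow> (real ^ 'd) measure" where
  "normal_law \<sigma> = distr std_normal_vec borel (\<lambda>z. \<sigma> *v z)"

definition rho :: "real ^ 'e ^ 'd \<Rightarrow> (real ^ 'd \<Rightarrow> real ^ 'c ^ 'r) \<Rightarrow> real ^ 'c ^ 'r" where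
  "rho \<sigma> f = (\<chi> i j. \<integral>x. f x $ i $ j \<partial>normal_law \<sigma>)"

lemma borel_measurable_matrix_vector [measurable]:
  fixes \<sigma> :: "real ^ 'e ^ 'd"
  shows "(\<lambda>z. \<sigma> *v z) \<in> borel_measurable borel"
  by (intro borel_measurable_continuous_onI linear_continuous_on
      linear_conv_bounded_linear[THEN iffD1]) simp

lemma borel_measurable_vec_of_PiM [measurable]:
  "(\<lambda>z. \<chi> i. z i) \<in> borel_measurable (Pi\<^sub>M UNIV (\<lambda>_::'n::finite. std_normal_distribution))"
proof (subst borel_measurable_euclidean_space, intro ballI)
  fix b :: "real ^ 'n" assume "b \<in> Basis"
  then obtain k where k: "b = axis k 1" by (auto simp: Basis_vec_def)
  have "(\<lambda>z. z k) \<in> borel_measurable (Pi\<^sub>M UNIV (\<lambda>_::'n. std_normal_distribution))"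
    by measurable
  then show "(\<lambda>z. (\<chi> i. z i) \<bullet> b) \<in>
      borel_measurable (Pi\<^sub>M UNIV (\<lambda>_::'n. std_normal_distribution))"
    by (simp add: k inner_axis)
qed

lemma char_normal_law:
  fixes \<sigma> :: "real ^ 'e ^ 'd" and u :: "real ^ 'd"
  shows "char (distr (normal_law \<sigma>) borel (\<lambda>x. u \<bullet> x)) t
           = exp (- (t\<^sup>2 * (u \<bullet> ((\<sigma> ** transpose \<sigma>) *v u))) / 2)"
proof -
  let ?P = "Pi\<^sub>M UNIV (\<lambda>_::'e. std_normal_distribution)"
  define c where "c = transpose \<sigma> *v u"
  interpret product_sigma_finite "\<lambda>_::'e. std_normal_distribution"
    unfolding product_sigma_finite_def
    using real_dist_normal_dist prob_space_imp_sigma_finite real_distribution.axioms(1) by blast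
  interpret real_distribution std_normal_distribution
    by (rule real_dist_normal_dist)
  have lin: "u \<bullet> (\<sigma> *v z) = c \<bullet> z" for z
    by (simp add: c_def dot_lmul_matrix)
  have "char (distr (normal_law \<sigma>) borel (\<lambda>x. u \<bullet> x)) t
      = (CLINT z|?P. iexp (t * (c \<bullet> (\<chi> i. z i))))"
    unfolding char_def normal_law_def std_normal_vec_def
    by (simp add: integral_distr distr_distr lin o_def)
  also have "\<dots> = (CLINT z|?P. (\<Prod>j\<in>UNIV. iexp (t * c $ j * z j)))"
    by (simp add: inner_vec_def sum_distrib_left mult.assoc flip: exp_sum)
  also have "\<dots> = (\<Prod>j\<in>UNIV. CLINT x|std_normal_distribution. iexp (t * c $ j * x))"
    by (intro product_integral_prod) (auto intro: integrable_iexp)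
  also have "\<dots> = (\<Prod>j\<in>UNIV. char std_normal_distribution (t * c $ j))"
    by (simp add: char_def)
  also have "\<dots> = complex_of_real (exp (- (t\<^sup>2 * (c \<bullet> c)) / 2))"
    by (simp add: char_std_normal_distribution exp_sum[symmetric] inner_vec_def
        sum_distrib_left sum_negf sum_divide_distrib power_mult_distrib power2_eq_square
        mult_ac flip: exp_of_real)
  also have "c \<bullet> c = u \<bullet> ((\<sigma> ** transpose \<sigma>) *v u)"
    using lin[of c] unfolding c_def by (metis matrix_vector_mul_assoc)
  finally show ?thesis by simp
qed

section \<open>Processes on a filtered probability space\<close>

text \<open>Time is \<open>real\<close>; every condition only concerns nonnegative times. The usual conditions
  (completeness, right-continuity) are not imposed on the filtration.\<close>

definition filtered_prob_space :: "'w measure \<Rightarrow> (real \<Rightarrow> 'w measure) \<Rightarrow> bool" where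
  "filtered_prob_space M F \<longleftrightarrow>
     prob_space M \<and> (\<forall>t\<ge>0. subalgebra M (F t)) \<and>
     (\<forall>s t. 0 \<le> s \<longrightarrow> s \<le> t \<longrightarrow> sets (F s) \<subseteq> sets (F t))"

definition adapted :: "(real \<Rightarrow> 'w measure) \<Rightarrow> (real \<Rightarrow> 'w \<Rightarrow> 'b::topological_space) \<Rightarrow> bool" where
  "adapted F X \<longleftrightarrow> (\<forall>t\<ge>0. X t \<in> borel_measurable (F t))"

definition predictable_sigma :: "'w measure \<Rightarrow> (real \<Rightarrow> 'w measure) \<Rightarrow> (real \<times> 'w) measure" where
  "predictable_sigma M F = sigma ({0..} \<times> space M)
     ({{0} \<times> A | A. A \<in> sets (F 0)} \<union>
      {{s<..t} \<times> A | s t A. 0 \<le> s \<and> s < t \<and> A \<in> sets (F s)})"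

definition predictable ::
    "'w measure \<Rightarrow> (real \<Rightarrow> 'w measure) \<Rightarrow> (real \<Rightarrow> 'w \<Rightarrow> 'b::topological_space) \<Rightarrow> bool" where
  "predictable M F X \<longleftrightarrow> (\<lambda>(t, \<omega>). X t \<omega>) \<in> borel_measurable (predictable_sigma M F)"

definition cadlag :: "(real \<Rightarrow> 'b::topological_space) \<Rightarrow> bool" where
  "cadlag x \<longleftrightarrow>
     (\<forall>t\<ge>0. (x \<longlongrightarrow> x t) (at_right t)) \<and> (\<forall>t>0. \<exists>l. (x \<longlongrightarrow> l) (at_left t))"

text \<open>The path \<open>u \<mapsto> x\<^bsub>u-\<^esub>\<close>, with the convention \<open>x\<^bsub>0-\<^esub> = x\<^bsub>0\<^esub>\<close>.\<close>

definition left_limit :: "(real \<Rightarrow> 'b::t2_space) \<Rightarrow> real \<Rightarrow> 'b" where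
  "left_limit x t = (if t \<le> 0 then x 0 else Lim (at_left t) x)"

definition locally_bounded_path :: "(real \<Rightarrow> 'b::metric_space) \<Rightarrow> bool" where
  "locally_bounded_path x \<longleftrightarrow> (\<forall>t\<ge>0. bounded (x ` {0..t}))"

text \<open>The increment law \<open>normal_law (mat (sqrt (t - s)))\<close> is \<open>N(0, (t - s) I)\<close>.\<close>

definition brownian_motion ::
    "'w measure \<Rightarrow> (real \<Rightarrow> 'w measure) \<Rightarrow> (real \<Rightarrow> 'w \<Rightarrow> real ^ 'e) \<Rightarrow> bool" where
  "brownian_motion M F W \<longleftrightarrow>
     adapted F W \<and>
     (AE \<omega> in M. W 0 \<omega> = 0) \<and>
     (\<forall>\<omega>\<in>space M. continuous_on {0..} (\<lambda>t. W t \<omega>)) \<and>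
     (\<forall>s t. 0 \<le> s \<longrightarrow> s < t \<longrightarrow>
        prob_space.indep_set M (sets (F s))
          {(\<lambda>\<omega>. W t \<omega> - W s \<omega>) -` B \<inter> space M | B. B \<in> sets borel} \<and>
        distr M borel (\<lambda>\<omega>. W t \<omega> - W s \<omega>) = normal_law (mat (sqrt (t - s))))"

section \<open>Convergence in probability\<close>

text \<open>Measurability is part of the notion, because \<open>measure\<close> is \<open>0\<close> on nonmeasurable sets.
  Values in \<open>ennreal\<close> make suprema of unbounded paths and divergent integrals equal to
  \<open>\<infinity>\<close>.\<close>

definition tends_to_zero_in_prob :: "'w measure \<Rightarrow> (nat \<Rightarrow> 'w \<Rightarrow> ennreal) \<Rightarrow> bool" where
  "tends_to_zero_in_prob M Z \<longleftrightarrow>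
     (\<forall>n. Z n \<in> borel_measurable M) \<and>
     (\<forall>\<epsilon>>0. (\<lambda>n. measure M {\<omega>\<in>space M. Z n \<omega> > ennreal \<epsilon>}) \<longlonglongrightarrow> 0)"

definition ucp_tendsto ::
    "'w measure \<Rightarrow> (nat \<Rightarrow> real \<Rightarrow> 'w \<Rightarrow> 'b::real_normed_vector) \<Rightarrow> (real \<Rightarrow> 'w \<Rightarrow> 'b) \<Rightarrow> bool"
where
  "ucp_tendsto M X L \<longleftrightarrow>
     (\<forall>t\<ge>0. tends_to_zero_in_prob M
        (\<lambda>n \<omega>. SUP s\<in>{0..t}. ennreal (norm (X n s \<omega> - L s \<omega>))))"

section \<open>The Ito integral\<close>

text \<open>A simple process \<open>\<Sum>i<N. \<xi>\<^sub>i 1\<^bsub>(\<tau>\<^sub>i, \<tau>\<^sub>i\<^sub>+\<^sub>1]\<^esub>\<close> is given by \<open>N\<close>, deterministic times \<open>\<tau>\<close> and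
  bounded coefficients \<open>\<xi>\<close>, the \<open>i\<close>-th one known at time \<open>\<tau>\<^sub>i\<close>.\<close>

definition simple_integrand ::
    "'w measure \<Rightarrow> (real \<Rightarrow> 'w measure) \<Rightarrow> nat \<Rightarrow> (nat \<Rightarrow> real) \<Rightarrow>
     (nat \<Rightarrow> 'w \<Rightarrow> real ^ 'e ^ 'd) \<Rightarrow> bool" where
  "simple_integrand M F N \<tau> \<xi> \<longleftrightarrow>
     0 \<le> \<tau> 0 \<and> (\<forall>i<N. \<tau> i < \<tau> (Suc i)) \<and>
     (\<forall>i<N. \<xi> i \<in> borel_measurable (F (\<tau> i)) \<and> bounded (\<xi> i ` space M))"

definition simple_process ::
    "nat \<Rightarrow> (nat \<Rightarrow> real) \<Rightarrow> (nat \<Rightarrow> 'w \<Rightarrow> real ^ 'e ^ 'd) \<Rightarrow> real \<Rightarrow> 'w \<Rightarrow> real ^ 'e ^ 'd" where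
  "simple_process N \<tau> \<xi> u \<omega> = (\<Sum>i<N. indicator {\<tau> i<..\<tau> (Suc i)} u *\<^sub>R \<xi> i \<omega>)"

definition simple_integral ::
    "(real \<Rightarrow> 'w \<Rightarrow> real ^ 'e) \<Rightarrow> nat \<Rightarrow> (nat \<Rightarrow> real) \<Rightarrow> (nat \<Rightarrow> 'w \<Rightarrow> real ^ 'e ^ 'd) \<Rightarrow>
     real \<Rightarrow> 'w \<Rightarrow> real ^ 'd" where
  "simple_integral W N \<tau> \<xi> t \<omega> =
     (\<Sum>i<N. \<xi> i \<omega> *v (W (min t (\<tau> (Suc i))) \<omega> - W (min t (\<tau> i)) \<omega>))"

text \<open>\<open>I\<close> is a continuous version of \<open>t \<mapsto> \<integral>\<^sub>0\<^sup>t H\<^sub>u dW\<^sub>u\<close>, for predictable \<open>H\<close> with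
  \<open>\<integral>\<^sub>0\<^sup>t \<parallel>H\<^sub>u\<parallel>\<^sup>2 du < \<infinity>\<close> almost surely: simple processes approximate \<open>H\<close> in \<open>L\<^sup>2([0,t])\<close>, in
  probability, and their elementary integrals converge to \<open>I\<close>. The limit is unique up to
  indistinguishability and does not depend on the approximating sequence. It is only required to
  be measurable with respect to \<open>M\<close>, because the filtration need not contain the null sets.\<close>

definition is_ito_integral ::
    "'w measure \<Rightarrow> (real \<Rightarrow> 'w measure) \<Rightarrow> (real \<Rightarrow> 'w \<Rightarrow> real ^ 'e) \<Rightarrow>
     (real \<Rightarrow> 'w \<Rightarrow> real ^ 'e ^ 'd) \<Rightarrow> (real \<Rightarrow> 'w \<Rightarrow> real ^ 'd) \<Rightarrow> bool" where
  "is_ito_integral M F W H I \<longleftrightarrow>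
     predictable M F H \<and>
     (\<forall>t\<ge>0. AE \<omega> in M. (\<integral>\<^sup>+u\<in>{0..t}. ennreal ((norm (H u \<omega>))\<^sup>2) \<partial>lborel) < \<infinity>) \<and>
     (\<forall>t\<ge>0. I t \<in> borel_measurable M) \<and>
     (\<forall>\<omega>\<in>space M. continuous_on {0..} (\<lambda>t. I t \<omega>)) \<and>
     (\<exists>N \<tau> \<xi>.
        (\<forall>k. simple_integrand M F (N k) (\<tau> k) (\<xi> k)) \<and>
        (\<forall>t\<ge>0. tends_to_zero_in_prob M
           (\<lambda>k \<omega>. \<integral>\<^sup>+u\<in>{0..t}.
              ennreal ((norm (simple_process (N k) (\<tau> k) (\<xi> k) u \<omega> - H u \<omega>))\<^sup>2) \<partial>lborel)) \<and>
        ucp_tendsto M (\<lambda>k. simple_integral W (N k) (\<tau> k) (\<xi> k)) I)"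

section \<open>The functionals\<close>

definition poly_growth :: "('a::real_normed_vector \<Rightarrow> 'b::real_normed_vector) \<Rightarrow> bool" where
  "poly_growth f \<longleftrightarrow> (\<exists>C>0. \<exists>p\<ge>2. \<forall>x. norm (f x) \<le> C * (1 + norm x powr p))"

definition incr :: "nat \<Rightarrow> nat \<Rightarrow> (real \<Rightarrow> 'w \<Rightarrow> real ^ 'd) \<Rightarrow> 'w \<Rightarrow> real ^ 'd" where
  "incr n i Y \<omega> = Y (real i / real n) \<omega> - Y ((real i - 1) / real n) \<omega>"

definition realised ::
    "(real ^ 'd \<Rightarrow> real ^ 'b ^ 'a) \<Rightarrow> (real ^ 'd \<Rightarrow> real ^ 'c ^ 'b) \<Rightarrow> (real \<Rightarrow> 'w \<Rightarrow> real ^ 'd) \<Rightarrow>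
     nat \<Rightarrow> real \<Rightarrow> 'w \<Rightarrow> real ^ 'c ^ 'a" where
  "realised g h Y n t \<omega> =
     (1 / real n) *\<^sub>R (\<Sum>i = 1..nat \<lfloor>real n * t\<rfloor>.
        g (sqrt (real n) *\<^sub>R incr n i Y \<omega>) ** h (sqrt (real n) *\<^sub>R incr n (i + 1) Y \<omega>))"

definition realised_limit ::
    "(real ^ 'd \<Rightarrow> real ^ 'b ^ 'a) \<Rightarrow> (real ^ 'd \<Rightarrow> real ^ 'c ^ 'b) \<Rightarrow>
     (real \<Rightarrow> 'w \<Rightarrow> real ^ 'e ^ 'd) \<Rightarrow> real \<Rightarrow> 'w \<Rightarrow> real ^ 'c ^ 'a" where
  "realised_limit g h \<sigma> t \<omega> =
     (LINT u:{0..t}|lborel. rho (\<sigma> u \<omega>) g ** rho (\<sigma> u \<omega>) h)"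

end

theory Submission
  imports Defs
begin

text \<open>The increments \<open>\<surd>n \<Delta>\<^sub>iY\<close> are compared with \<open>\<surd>n \<sigma> \<Delta>\<^sub>iW\<close>, where \<open>\<sigma>\<close> is frozen at the left end of
  the interval and truncated at a level \<open>K\<close> that is not reached with high probability. No stopping
  times are needed: for each \<open>n\<close> the integral is replaced by the elementary integral of a truncated
  simple process that is extremely close to it at the grid points (a discrete form of Lenglart's
  inequality), on the event where \<open>\<sigma>\<close> stays below \<open>K\<close>. Elementary integrals of processes bounded by \<open>K\<close>
  are sub-Gaussian, and this controls functions of polynomial growth, while the isometry controls the
  distance to \<open>\<surd>n \<sigma> \<Delta>\<^sub>iW\<close>. The frozen terms, centred by \<open>\<rho>\<^sub>\<sigma>(g) \<rho>\<^sub>\<sigma>(h)\<close>, are orthogonal at lag two or more,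
  so their partial sums are negligible; what is left are Riemann sums of \<open>\<rho>\<^sub>\<sigma>(g) \<rho>\<^sub>\<sigma>(h)\<close>.\<close>

section \<open>Events of high probability\<close>

text \<open>The obstacle is that \<open>I\<close> is known only as a limit of elementary integrals
  and is measurable only with respect to \<open>M\<close>: it cannot be stopped inside the
  filtration, and it comes without moment bounds. Every estimate is therefore proved for finite sums
  with adapted coefficients, where an increment of \<open>W\<close> is integrated out for a frozen
  past by Fubini's theorem; conditional expectations and martingales do not occur. The accuracy of
  the approximation has to improve with \<open>n\<close>, since its error is multiplied by
  \<open>sqrt n\<close> and must be small at all grid points at once. The functions \<open>g\<close>
  and \<open>h\<close> are not uniformly continuous. The substitute is the inequality |f x - f y|
  \<le> \<epsilon> (1 + G x + G y) + C |x - y|^2 for the product f of \<open>g\<close> and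
  \<open>h\<close>, viewed on pairs, with an exponential weight G: the first part only has to be
  bounded in mean, the second is what an estimate in mean square delivers. Both factors of a product
  are compared with the same frozen value of \<sigma> although the second factor belongs to the next
  cell. This makes the centring exact, and it is the reason for the lags 0 and 1 in the
  approximation.\<close>

text \<open>The exceptional sets make the notion monotone in \<open>P\<close> although the events \<open>P n\<close> need not be measurable.\<close>

definition whp :: "'w measure \<Rightarrow> (nat \<Rightarrow> 'w \<Rightarrow> bool) \<Rightarrow> bool" where
  "whp M P \<longleftrightarrow> (\<forall>\<delta>>0. \<forall>\<^sub>F n in sequentially.
     \<exists>A\<in>sets M. measure M A \<le> \<delta> \<and> (\<forall>\<omega>\<in>space M - A. P n \<omega>))"

lemma whp_mono:
  assumes "whp M P" "\<And>n \<omega>. n \<ge> m \<Longrightarrow> \<omega> \<in> space M \<Longrightarrow> P n \<omega> \<Longrightarrow> Q n \<omega>"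
  shows "whp M Q"
  unfolding whp_def
proof (intro allI impI)
  fix \<delta> :: real assume "\<delta> > 0"
  then have "\<forall>\<^sub>F n in sequentially. \<exists>A\<in>sets M. measure M A \<le> \<delta> \<and> (\<forall>\<omega>\<in>space M - A. P n \<omega>)"
    using assms(1) unfolding whp_def by blast
  then show "\<forall>\<^sub>F n in sequentially. \<exists>A\<in>sets M. measure M A \<le> \<delta> \<and> (\<forall>\<omega>\<in>space M - A. Q n \<omega>)"
    using eventually_ge_at_top[of m] by eventually_elim (use assms(2) in blast)
qed

lemma whp_I_AE:
  assumes "AE \<omega> in M. \<forall>n. P n \<omega>"
  shows "whp M P"
proof -
  obtain N where N: "{\<omega>\<in>space M. \<not> (\<forall>n. P n \<omega>)} \<subseteq> N" "emeasure M N = 0" "N \<in> sets M"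
    using AE_E[OF assms] by metis
  show ?thesis
    unfolding whp_def
    by (intro allI impI always_eventually bexI[of _ N] conjI) (use N in \<open>auto simp: measure_def\<close>)
qed

context prob_space
begin

lemma whp_conj:
  assumes "whp M P" "whp M Q"
  shows "whp M (\<lambda>n \<omega>. P n \<omega> \<and> Q n \<omega>)"
  unfolding whp_def
proof (intro allI impI)
  fix \<delta> :: real assume "\<delta> > 0"
  then have "\<delta>/2 > 0" by simp
  with assms have "\<forall>\<^sub>F n in sequentially. \<exists>A\<in>sets M. measure M A \<le> \<delta>/2 \<and> (\<forall>\<omega>\<in>space M - A. P n \<omega>)"
    "\<forall>\<^sub>F n in sequentially. \<exists>A\<in>sets M. measure M A \<le> \<delta>/2 \<and> (\<forall>\<omega>\<in>space M - A. Q n \<omega>)"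
    unfolding whp_def by blast+
  then show "\<forall>\<^sub>F n in sequentially. \<exists>A\<in>sets M. measure M A \<le> \<delta> \<and> (\<forall>\<omega>\<in>space M - A. P n \<omega> \<and> Q n \<omega>)"
  proof eventually_elim
    case (elim n)
    then obtain A B where "A \<in> sets M" "measure M A \<le> \<delta>/2" "\<forall>\<omega>\<in>space M - A. P n \<omega>"
      "B \<in> sets M" "measure M B \<le> \<delta>/2" "\<forall>\<omega>\<in>space M - B. Q n \<omega>" by blast
    moreover from this have "measure M (A \<union> B) \<le> \<delta>"
      using measure_Un_le[of A M B] by simp
    ultimately show ?case by (intro bexI[of _ "A \<union> B"]) auto
  qed
qed

lemma whp_ball_finite:
  assumes "finite J" "\<And>j. j \<in> J \<Longrightarrow> whp M (P j)"
  shows "whp M (\<lambda>n \<omega>. \<forall>j\<in>J. P j n \<omega>)"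
  using assms
proof (induction J rule: finite_induct)
  case empty
  show ?case by (rule whp_I_AE) simp
next
  case (insert j J)
  from whp_conj[of "P j" "\<lambda>n \<omega>. \<forall>j\<in>J. P j n \<omega>"] insert show ?case by simp
qed

text \<open>The localisation step: \<open>B\<close> does not depend on \<open>n\<close>. It carries
  the paths on which \<sigma> exceeds a level, costs half of \<delta> once and for all, and leaves
  the other half to the event at stage \<open>n\<close>.\<close>

lemma whp_local:
  assumes "\<And>\<delta>. \<delta> > 0 \<Longrightarrow> \<exists>B\<in>sets M. measure M B \<le> \<delta> \<and> whp M (\<lambda>n \<omega>. \<omega> \<notin> B \<longrightarrow> P n \<omega>)"
  shows "whp M P"
  unfolding whp_def
proof (intro allI impI)
  fix \<delta> :: real assume "\<delta> > 0"
  then have d: "\<delta>/2 > 0" by simp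
  from assms[OF d] obtain B where B: "B \<in> sets M" "measure M B \<le> \<delta>/2"
      "whp M (\<lambda>n \<omega>. \<omega> \<notin> B \<longrightarrow> P n \<omega>)" by blast
  from B(3) d have "\<forall>\<^sub>F n in sequentially. \<exists>A\<in>sets M. measure M A \<le> \<delta>/2 \<and>
      (\<forall>\<omega>\<in>space M - A. \<omega> \<notin> B \<longrightarrow> P n \<omega>)"
    unfolding whp_def by blast
  then show "\<forall>\<^sub>F n in sequentially. \<exists>A\<in>sets M. measure M A \<le> \<delta> \<and> (\<forall>\<omega>\<in>space M - A. P n \<omega>)"
  proof eventually_elim
    case (elim n)
    then obtain A where A: "A \<in> sets M" "measure M A \<le> \<delta>/2" "\<forall>\<omega>\<in>space M - A. \<omega> \<notin> B \<longrightarrow> P n \<omega>"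
      by blast
    moreover have "measure M (A \<union> B) \<le> \<delta>"
      using measure_Un_le[of A M B] A B by simp
    ultimately show ?case using B by (intro bexI[of _ "A \<union> B"]) auto
  qed
qed

section \<open>Markov bounds and convergence in probability\<close>

lemma markov:
  assumes [measurable]: "Q \<in> borel_measurable M" and "(\<integral>\<^sup>+\<omega>. Q \<omega> \<partial>M) \<le> ennreal C" "c > 0" "0 \<le> C"
  shows "measure M {\<omega>\<in>space M. Q \<omega> \<ge> ennreal c} \<le> C / c"
proof -
  have "emeasure M {\<omega>\<in>space M. 1 \<le> ennreal (1/c) * Q \<omega>} \<le> ennreal (1/c) * (\<integral>\<^sup>+\<omega>. Q \<omega> * indicator (space M) \<omega> \<partial>M)"
    by (rule nn_integral_Markov_inequality) auto
  also have "(\<integral>\<^sup>+\<omega>. Q \<omega> * indicator (space M) \<omega> \<partial>M) = (\<integral>\<^sup>+\<omega>. Q \<omega> \<partial>M)"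
    by (intro nn_integral_cong) simp
  also have "ennreal (1/c) * \<dots> \<le> ennreal (1/c) * ennreal C"
    by (intro mult_left_mono assms) simp
  also have "\<dots> = ennreal (C/c)" using assms by (simp flip: ennreal_mult)
  finally have 1: "emeasure M {\<omega>\<in>space M. 1 \<le> ennreal (1/c) * Q \<omega>} \<le> ennreal (C/c)" .
  have "1 \<le> ennreal (1/c) * Q \<omega>" if "Q \<omega> \<ge> ennreal c" for \<omega>
  proof -
    have "1 = ennreal (1/c) * ennreal c" using \<open>c > 0\<close> by (simp flip: ennreal_mult)
    also have "\<dots> \<le> ennreal (1/c) * Q \<omega>" by (intro mult_left_mono that) simp
    finally show ?thesis .
  qed
  then have "emeasure M {\<omega>\<in>space M. Q \<omega> \<ge> ennreal c} \<le> emeasure M {\<omega>\<in>space M. 1 \<le> ennreal (1/c) * Q \<omega>}"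
    by (intro emeasure_mono) auto
  with 1 have "emeasure M {\<omega>\<in>space M. Q \<omega> \<ge> ennreal c} \<le> ennreal (C/c)" by simp
  then show ?thesis using assms by (simp add: emeasure_eq_measure)
qed

lemma whp_Markov:
  assumes [measurable]: "\<And>n. Q n \<in> borel_measurable M" and lim: "(\<lambda>n. \<integral>\<^sup>+\<omega>. Q n \<omega> \<partial>M) \<longlonglongrightarrow> 0"
    and e: "\<epsilon> > 0"
  shows "whp M (\<lambda>n \<omega>. Q n \<omega> \<le> ennreal \<epsilon>)"
  unfolding whp_def
proof (intro allI impI)
  fix \<delta> :: real assume d: "\<delta> > 0"
  have "\<forall>\<^sub>F n in sequentially. (\<integral>\<^sup>+\<omega>. Q n \<omega> \<partial>M) < ennreal (\<epsilon> * \<delta>)"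
    using lim e d by (intro order_tendstoD(2)[OF lim]) simp
  then show "\<forall>\<^sub>F n in sequentially. \<exists>A\<in>sets M. measure M A \<le> \<delta> \<and> (\<forall>\<omega>\<in>space M - A. Q n \<omega> \<le> ennreal \<epsilon>)"
  proof eventually_elim
    case (elim n)
    have "measure M {\<omega>\<in>space M. Q n \<omega> \<ge> ennreal \<epsilon>} \<le> (\<epsilon> * \<delta>) / \<epsilon>"
      by (rule markov[OF assms(1)]) (use elim e d in auto)
    with e show ?case
      by (intro bexI[of _ "{\<omega>\<in>space M. Q n \<omega> \<ge> ennreal \<epsilon>}"]) auto
  qed
qed

lemma whp_LIMSEQ:
  fixes X :: "nat \<Rightarrow> 'a \<Rightarrow> real"
  assumes [measurable]: "\<And>n. X n \<in> borel_measurable M" and "AE \<omega> in M. (\<lambda>n. X n \<omega>) \<longlonglongrightarrow> 0" and e: "\<epsilon> > 0"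
  shows "whp M (\<lambda>n \<omega>. X n \<omega> \<le> \<epsilon>)"
proof -
  \<comment> \<open>Capping at 1 supplies the integrable majorant for dominated convergence.\<close>
  define Q where "Q n \<omega> = ennreal (min \<bar>X n \<omega>\<bar> 1)" for n \<omega>
  have [measurable]: "Q n \<in> borel_measurable M" for n unfolding Q_def by measurable
  have "(\<lambda>n. \<integral>\<^sup>+\<omega>. Q n \<omega> \<partial>M) \<longlonglongrightarrow> (\<integral>\<^sup>+\<omega>. 0 \<partial>M)"
  proof (rule nn_integral_dominated_convergence[where w = "\<lambda>_. 1"])
    show "AE \<omega> in M. (\<lambda>n. Q n \<omega>) \<longlonglongrightarrow> 0"
      using assms(2)
    proof eventually_elim
      case (elim \<omega>)
      then have "(\<lambda>n. ennreal (min \<bar>X n \<omega>\<bar> 1)) \<longlonglongrightarrow> ennreal (min \<bar>0\<bar> 1)"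
        by (intro tendsto_intros)
      then show ?case by (simp add: Q_def)
    qed
  qed (auto simp: Q_def emeasure_space_1)
  then have "(\<lambda>n. \<integral>\<^sup>+\<omega>. Q n \<omega> \<partial>M) \<longlonglongrightarrow> 0" by simp
  \<comment> \<open>A level below 1 keeps the cap inactive: a capped value below it is the value
    itself.\<close>
  from whp_Markov[OF _ this, of "min \<epsilon> (1/2)"] e have "whp M (\<lambda>n \<omega>. Q n \<omega> \<le> ennreal (min \<epsilon> (1/2)))" by simp
  then show ?thesis
  proof (rule whp_mono[where m = 0])
    fix n \<omega> assume "Q n \<omega> \<le> ennreal (min \<epsilon> (1/2))"
    then have "min \<bar>X n \<omega>\<bar> 1 \<le> min \<epsilon> (1/2)" using e unfolding Q_def
      by (subst (asm) ennreal_le_iff) auto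
    then show "X n \<omega> \<le> \<epsilon>" by linarith
  qed
qed

text \<open>The term \<open>G\<close> is only bounded in mean, but enters with an arbitrarily small factor.\<close>

lemma whp_combine:
  fixes X G S :: "nat \<Rightarrow> 'a \<Rightarrow> real"
  assumes *: "\<And>\<epsilon>. \<epsilon> > 0 \<Longrightarrow> \<exists>C. whp M (\<lambda>n \<omega>. X n \<omega> \<le> \<epsilon> * G n \<omega> + C * S n \<omega>)"
    and [measurable]: "\<And>n. G n \<in> borel_measurable M"
    and G: "\<And>n. (\<integral>\<^sup>+\<omega>. ennreal (G n \<omega>) \<partial>M) \<le> ennreal C0"
    and S: "\<And>\<epsilon>. \<epsilon> > 0 \<Longrightarrow> whp M (\<lambda>n \<omega>. S n \<omega> \<le> \<epsilon>)"
    and S0: "\<And>n \<omega>. \<omega> \<in> space M \<Longrightarrow> 0 \<le> S n \<omega>"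
    and e: "\<eta> > 0"
  shows "whp M (\<lambda>n \<omega>. X n \<omega> \<le> \<eta>)"
  unfolding whp_def
proof (intro allI impI)
  fix \<delta> :: real assume d: "\<delta> > 0"
  \<comment> \<open>By Markov's inequality \<open>G n\<close> reaches this level with probability at
    most \<open>\<delta>/2\<close>; the summand 1 keeps the level positive. The factor in front of
    \<open>G\<close> is chosen after \<open>L\<close>, and only then comes \<open>C\<close>, against
    which \<open>S\<close> is made small.\<close>
  define L where "L = (\<bar>C0\<bar> + 1) * 2 / \<delta>"
  have L: "L > 0" using d by (simp add: L_def)
  obtain C where C: "whp M (\<lambda>n \<omega>. X n \<omega> \<le> (\<eta> / (2 * L)) * G n \<omega> + C * S n \<omega>)"
    using *[of "\<eta> / (2 * L)"] e L by auto
  have "\<eta> / (2 * (\<bar>C\<bar> + 1)) > 0" using e by simp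
  from whp_conj[OF C S[OF this]] have W: "whp M (\<lambda>n \<omega>. X n \<omega> \<le> (\<eta> / (2 * L)) * G n \<omega> + C * S n \<omega>
      \<and> S n \<omega> \<le> \<eta> / (2 * (\<bar>C\<bar> + 1)))" .
  have "whp M (\<lambda>n \<omega>. G n \<omega> \<le> L \<longrightarrow> X n \<omega> \<le> \<eta>)"
  proof (rule whp_mono[OF W, where m = 0], safe)
    fix n \<omega> assume \<omega>: "\<omega> \<in> space M" and 1: "X n \<omega> \<le> (\<eta> / (2 * L)) * G n \<omega> + C * S n \<omega>"
      and 2: "S n \<omega> \<le> \<eta> / (2 * (\<bar>C\<bar> + 1))" and 3: "G n \<omega> \<le> L"
    have "(\<eta> / (2 * L)) * G n \<omega> \<le> (\<eta> / (2 * L)) * L"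
      using 3 e L by (intro mult_left_mono) auto
    moreover have "C * S n \<omega> \<le> (\<bar>C\<bar> + 1) * (\<eta> / (2 * (\<bar>C\<bar> + 1)))"
      using S0[OF \<omega>, of n] 2 by (intro mult_mono) auto
    moreover have "(\<eta> / (2 * L)) * L = \<eta> / 2" "(\<bar>C\<bar> + 1) * (\<eta> / (2 * (\<bar>C\<bar> + 1))) = \<eta> / 2"
      using L by (simp_all add: field_simps)
    ultimately show "X n \<omega> \<le> \<eta>" using 1 by linarith
  qed
  then have "\<forall>\<^sub>F n in sequentially. \<exists>A\<in>sets M. measure M A \<le> \<delta>/2 \<and> (\<forall>\<omega>\<in>space M - A. G n \<omega> \<le> L \<longrightarrow> X n \<omega> \<le> \<eta>)"
    unfolding whp_def using half_gt_zero[OF d] by blast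
  then show "\<forall>\<^sub>F n in sequentially. \<exists>A\<in>sets M. measure M A \<le> \<delta> \<and> (\<forall>\<omega>\<in>space M - A. X n \<omega> \<le> \<eta>)"
  proof eventually_elim
    case (elim n)
    then obtain A where A: "A \<in> sets M" "measure M A \<le> \<delta>/2" "\<forall>\<omega>\<in>space M - A. G n \<omega> \<le> L \<longrightarrow> X n \<omega> \<le> \<eta>"
      by blast
    have G': "(\<integral>\<^sup>+\<omega>. ennreal (G n \<omega>) \<partial>M) \<le> ennreal (\<bar>C0\<bar> + 1)"
      by (rule order_trans[OF G ennreal_leI]) simp
    let ?B = "{\<omega>\<in>space M. ennreal (G n \<omega>) \<ge> ennreal L}"
    have "measure M ?B \<le> (\<bar>C0\<bar> + 1) / L"
      by (rule markov) (use L G' in auto)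
    also have "\<dots> = \<delta>/2" using d by (simp add: L_def field_simps)
    finally have "measure M (A \<union> ?B) \<le> \<delta>"
      using measure_Un_le[of A M ?B] A by simp
    moreover have "X n \<omega> \<le> \<eta>" if "\<omega> \<in> space M - (A \<union> ?B)" for \<omega>
    proof -
      have "G n \<omega> \<le> L" using that ennreal_leI[of L "G n \<omega>"] by force
      then show ?thesis using A that by auto
    qed
    ultimately show ?case using A by (intro bexI[of _ "A \<union> ?B"]) auto
  qed
qed

text \<open>The way back from exceptional sets to the definition: the event that \<open>Z n\<close>
  exceeds \<epsilon> lies inside the exceptional set.\<close>

lemma tends_to_zero_in_probI:
  assumes "\<And>n. Z n \<in> borel_measurable M"
    and w: "\<And>\<epsilon>. \<epsilon> > 0 \<Longrightarrow> whp M (\<lambda>n \<omega>. Z n \<omega> \<le> ennreal \<epsilon>)"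
  shows "tends_to_zero_in_prob M Z"
  unfolding tends_to_zero_in_prob_def
proof (intro conjI allI impI assms(1))
  fix \<epsilon> :: real assume e: "\<epsilon> > 0"
  have [measurable]: "Z n \<in> borel_measurable M" for n by fact
  show "(\<lambda>n. measure M {\<omega> \<in> space M. ennreal \<epsilon> < Z n \<omega>}) \<longlonglongrightarrow> 0"
  proof (rule LIMSEQ_I)
    fix r :: real assume "r > 0"
    then have "\<forall>\<^sub>F n in sequentially. \<exists>A\<in>sets M. measure M A \<le> r/2 \<and> (\<forall>\<omega>\<in>space M - A. Z n \<omega> \<le> ennreal \<epsilon>)"
      using w[OF e] half_gt_zero[of r] unfolding whp_def by blast
    then have "\<forall>\<^sub>F n in sequentially. norm (measure M {\<omega> \<in> space M. ennreal \<epsilon> < Z n \<omega>} - 0) < r"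
    proof eventually_elim
      case (elim n)
      then obtain A where A: "A \<in> sets M" "measure M A \<le> r/2" "\<forall>\<omega>\<in>space M - A. Z n \<omega> \<le> ennreal \<epsilon>"
        by blast
      have "measure M {\<omega> \<in> space M. ennreal \<epsilon> < Z n \<omega>} \<le> measure M A"
        using A by (intro finite_measure_mono) (auto simp: not_le[symmetric])
      with A \<open>r > 0\<close> show ?case by simp
    qed
    then show "\<exists>no. \<forall>n\<ge>no. norm (measure M {\<omega> \<in> space M. ennreal \<epsilon> < Z n \<omega>} - 0) < r"
      by (simp add: eventually_sequentially)
  qed
qed

lemma tends_to_zero_in_probD:
  assumes "tends_to_zero_in_prob M Z" "\<epsilon> > 0" "\<delta> > 0"
  shows "\<forall>\<^sub>F n in sequentially. measure M {\<omega> \<in> space M. Z n \<omega> > ennreal \<epsilon>} \<le> \<delta>"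
  using assms order_tendstoD(2)[of "\<lambda>n. measure M {\<omega> \<in> space M. Z n \<omega> > ennreal \<epsilon>}" 0 sequentially \<delta>]
  unfolding tends_to_zero_in_prob_def by (auto elim!: eventually_mono)

end

section \<open>Gaussian vectors\<close>

text \<open>The norm on matrices is the Euclidean norm of all entries, so Cauchy-Schwarz in each row
  is enough.\<close>

lemma norm_matrix_vector_le:
  fixes A :: "real ^ 'e ^ 'd"
  shows "norm (A *v x) \<le> norm A * norm x"
proof -
  have "norm (A *v x) \<le> L2_set (\<lambda>i. norm (A $ i) * norm x) UNIV"
    unfolding norm_vec_def[of "A *v x"]
    by (rule L2_set_mono) (auto simp: matrix_vector_mul_component Cauchy_Schwarz_ineq2)
  also have "\<dots> = norm A * norm x"
    by (simp add: norm_vec_def[of A] L2_set_left_distrib)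
  finally show ?thesis .
qed

lemma inner_matrix_vector:
  fixes A :: "real ^ 'e ^ 'd"
  shows "l \<bullet> (A *v z) = (transpose A *v l) \<bullet> z"
  by (simp add: dot_lmul_matrix)

text \<open>The square of the left side is the inner product of \<open>l\<close> with
  \<open>A *v (transpose A *v l)\<close>. Cauchy-Schwarz and the bound for \<open>A\<close> leave a
  common factor to cancel, which avoids comparing the norms of \<open>A\<close> and of its
  transpose.\<close>

lemma norm_transpose_mult_le:
  fixes A :: "real ^ 'e ^ 'd"
  shows "norm (transpose A *v l) \<le> norm A * norm l"
proof -
  have "(norm (transpose A *v l))\<^sup>2 = l \<bullet> (A *v (transpose A *v l))"
    by (simp add: power2_norm_eq_inner dot_lmul_matrix)
  also have "\<dots> \<le> norm l * (norm A * norm (transpose A *v l))"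
    by (rule order_trans[OF norm_cauchy_schwarz]) (intro mult_left_mono norm_matrix_vector_le, simp)
  finally have "norm (transpose A *v l) * norm (transpose A *v l) \<le> (norm A * norm l) * norm (transpose A *v l)"
    by (simp add: power2_eq_square mult_ac)
  then show ?thesis
    by (cases "norm (transpose A *v l) = 0") (auto simp: mult_le_cancel_right)
qed

text \<open>Completing the square turns the density times \<open>exp (c * x)\<close> into a constant
  times the density of the normal law with mean \<open>c\<close> and variance 1.\<close>

lemma nn_integral_std_normal_exp:
  "(\<integral>\<^sup>+x. ennreal (exp (c * x)) \<partial>std_normal_distribution) = ennreal (exp (c\<^sup>2 / 2))"
proof -
  have *: "std_normal_density x * exp (c * x) = exp (c\<^sup>2 / 2) * normal_density c 1 x" for x
    by (simp add: normal_density_def flip: exp_add) (simp add: power2_eq_square field_simps)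
  have "(\<integral>\<^sup>+x. ennreal (exp (c * x)) \<partial>std_normal_distribution)
      = (\<integral>\<^sup>+x. ennreal (std_normal_density x) * ennreal (exp (c * x)) \<partial>lborel)"
    by (subst nn_integral_density) auto
  also have "\<dots> = (\<integral>\<^sup>+x. ennreal (exp (c\<^sup>2 / 2)) * ennreal (normal_density c 1 x) \<partial>lborel)"
    by (intro nn_integral_cong) (simp add: * normal_density_nonneg flip: ennreal_mult)
  also have "\<dots> = ennreal (exp (c\<^sup>2 / 2)) * (\<integral>\<^sup>+x. ennreal (normal_density c 1 x) \<partial>lborel)"
    by (rule nn_integral_cmult) simp
  also have "(\<integral>\<^sup>+x. ennreal (normal_density c 1 x) \<partial>lborel) = 1"
    using prob_space.emeasure_space_1[OF prob_space_normal_density[of 1 c]]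
    by (simp add: emeasure_density)
  finally show ?thesis by simp
qed

section \<open>The standard normal vector and its exponential moments\<close>

lemma product_std_normal: "product_prob_space (\<lambda>_::'i. std_normal_distribution)"
proof -
  interpret real_distribution std_normal_distribution by (rule real_dist_normal_dist)
  show ?thesis by unfold_locales
qed

lemma prob_space_std_normal_vec: "prob_space (std_normal_vec :: (real ^ 'n) measure)"
proof -
  interpret product_prob_space "\<lambda>_::'n. std_normal_distribution" by (rule product_std_normal)
  show ?thesis unfolding std_normal_vec_def
    by (rule prob_space.prob_space_distr) (auto intro: prob_space_PiM M.prob_space_axioms)
qed

lemma sets_std_normal_vec [measurable_cong, simp]: "sets std_normal_vec = sets borel"
  by (simp add: std_normal_vec_def)

lemma space_std_normal_vec [simp]: "space std_normal_vec = UNIV"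
  by (simp add: std_normal_vec_def)

lemma nn_integral_std_normal_vec_exp:
  fixes c :: "real ^ 'n"
  shows "(\<integral>\<^sup>+z. ennreal (exp (c \<bullet> z)) \<partial>std_normal_vec) = ennreal (exp ((norm c)\<^sup>2 / 2))"
proof -
  interpret product_prob_space "\<lambda>_::'n. std_normal_distribution" by (rule product_std_normal)
  let ?P = "Pi\<^sub>M UNIV (\<lambda>_::'n. std_normal_distribution)"
  have "(\<integral>\<^sup>+z. ennreal (exp (c \<bullet> z)) \<partial>std_normal_vec) = (\<integral>\<^sup>+z. ennreal (exp (c \<bullet> (\<chi> i. z i))) \<partial>?P)"
    unfolding std_normal_vec_def by (subst nn_integral_distr) auto
  also have "\<dots> = (\<integral>\<^sup>+z. (\<Prod>i\<in>UNIV. ennreal (exp (c $ i * z i))) \<partial>?P)"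
    by (simp add: inner_vec_def prod_ennreal exp_sum)
  also have "\<dots> = (\<Prod>i\<in>UNIV. \<integral>\<^sup>+x. ennreal (exp (c $ i * x)) \<partial>std_normal_distribution)"
    by (rule product_nn_integral_prod) auto
  also have "\<dots> = ennreal (exp (\<Sum>i\<in>UNIV. (c $ i)\<^sup>2 / 2))"
    by (simp only: nn_integral_std_normal_exp) (simp add: prod_ennreal flip: exp_sum)
  also have "(\<Sum>i\<in>UNIV. (c $ i)\<^sup>2 / 2) = (norm c)\<^sup>2 / 2"
    unfolding power2_norm_eq_inner by (simp add: inner_vec_def power2_eq_square sum_divide_distrib)
  finally show ?thesis .
qed

text \<open>A majorant of \<open>exp (norm x)\<close> whose moments are given by moment generating functions.\<close>

definition expo :: "'a::euclidean_space \<Rightarrow> real" where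
  "expo x = (\<Sum>b\<in>Basis. exp (DIM('a) * (x \<bullet> b)) + exp (- (DIM('a) * (x \<bullet> b))))"

lemma expo_nonneg: "0 \<le> expo x"
  unfolding expo_def by (intro sum_nonneg add_nonneg_nonneg) auto

lemma borel_measurable_expo [measurable]: "expo \<in> borel_measurable borel"
  unfolding expo_def by measurable

text \<open>If \<open>b\<close> is the basis vector for which the coordinate of \<open>x\<close> is
  largest in modulus, the norm is at most \<open>DIM('a)\<close> times that modulus. This is where
  the factor in the exponents of \<open>expo\<close> comes from; both signs occur because the
  coordinate may be negative.\<close>

lemma exp_norm_le_expo: "exp (norm x) \<le> expo x" for x :: "'a::euclidean_space"
proof -
  obtain b where b: "b \<in> Basis" "\<And>c. c \<in> Basis \<Longrightarrow> \<bar>x \<bullet> c\<bar> \<le> \<bar>x \<bullet> b\<bar>"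
  proof -
    let ?m = "Max ((\<lambda>c. \<bar>x \<bullet> c\<bar>) ` Basis)"
    have "?m \<in> (\<lambda>c. \<bar>x \<bullet> c\<bar>) ` Basis" by (intro Max_in) auto
    then obtain b where "b \<in> Basis" "?m = \<bar>x \<bullet> b\<bar>" by blast
    with that[of b] show ?thesis by (metis Max_ge finite_Basis finite_imageI imageI)
  qed
  have "norm x \<le> (\<Sum>c\<in>Basis. \<bar>x \<bullet> c\<bar>)" by (rule norm_le_l1)
  also have "\<dots> \<le> (\<Sum>c\<in>(Basis::'a set). \<bar>x \<bullet> b\<bar>)" by (intro sum_mono b)
  also have "\<dots> = DIM('a) * \<bar>x \<bullet> b\<bar>" by simp
  finally have "exp (norm x) \<le> exp (DIM('a) * \<bar>x \<bullet> b\<bar>)" by simp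
  also have "\<dots> \<le> exp (DIM('a) * (x \<bullet> b)) + exp (- (DIM('a) * (x \<bullet> b)))"
    by (cases "x \<bullet> b \<ge> 0") auto
  also have "\<dots> \<le> expo x"
    unfolding expo_def by (rule member_le_sum) (use b in auto)
  finally show ?thesis .
qed

text \<open>A shift of length at most 1 changes each exponent by at most the dimension. This lets
  the weight be evaluated at a nearby variable whose exponential moments are known.\<close>

lemma expo_close:
  fixes x y :: "'a::euclidean_space"
  assumes "norm (x - y) \<le> 1"
  shows "expo x \<le> exp DIM('a) * expo y"
proof -
  have *: "DIM('a) * (x \<bullet> b) \<le> DIM('a) + DIM('a) * (y \<bullet> b)" "- (DIM('a) * (x \<bullet> b)) \<le> DIM('a) + - (DIM('a) * (y \<bullet> b))"
    if "b \<in> Basis" for b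
  proof -
    have "\<bar>(x - y) \<bullet> b\<bar> \<le> 1" using Basis_le_norm[OF that, of "x - y"] assms by linarith
    then have 1: "x \<bullet> b \<le> 1 + y \<bullet> b" "y \<bullet> b \<le> 1 + x \<bullet> b" by (auto simp: inner_diff_left)
    have d: "real DIM('a) \<ge> 0" by simp
    show "DIM('a) * (x \<bullet> b) \<le> DIM('a) + DIM('a) * (y \<bullet> b)" "- (DIM('a) * (x \<bullet> b)) \<le> DIM('a) + - (DIM('a) * (y \<bullet> b))"
      using mult_left_mono[OF 1(1) d] mult_left_mono[OF 1(2) d] by (auto simp: algebra_simps)
  qed
  show ?thesis
    unfolding expo_def sum_distrib_left distrib_left exp_add[symmetric]
    by (intro sum_mono add_mono) (use * in auto)
qed

text \<open>The summands of \<open>expo\<close> are exponentials of linear functionals in the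
  directions \<open>DIM('a)\<close> times plus or minus a basis vector: \<open>2 * DIM('a)\<close>
  of them, all of norm \<open>DIM('a)\<close>. A sub-Gaussian bound for linear functionals thus
  controls the exponential of the norm.\<close>

lemma nn_integral_expo_bound:
  fixes X :: "'w \<Rightarrow> 'a::euclidean_space"
  assumes [measurable]: "X \<in> borel_measurable M"
    and le: "\<And>l. (\<integral>\<^sup>+\<omega>. ennreal (exp (l \<bullet> X \<omega>)) \<partial>M) \<le> ennreal (exp ((norm l)\<^sup>2 * c))"
  shows "(\<integral>\<^sup>+\<omega>. ennreal (expo (X \<omega>)) \<partial>M) \<le> ennreal (2 * DIM('a) * exp ((real DIM('a))\<^sup>2 * c))"
proof -
  have "(\<integral>\<^sup>+\<omega>. ennreal (expo (X \<omega>)) \<partial>M) = (\<integral>\<^sup>+\<omega>. (\<Sum>b\<in>Basis.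
      ennreal (exp (DIM('a) * (X \<omega> \<bullet> b))) + ennreal (exp (- (DIM('a) * (X \<omega> \<bullet> b))))) \<partial>M)"
    unfolding expo_def by (simp flip: sum_ennreal)
  also have "\<dots> = (\<Sum>b\<in>Basis. (\<integral>\<^sup>+\<omega>. ennreal (exp (DIM('a) * (X \<omega> \<bullet> b))) \<partial>M) +
      (\<integral>\<^sup>+\<omega>. ennreal (exp (- (DIM('a) * (X \<omega> \<bullet> b)))) \<partial>M))"
    by (simp add: nn_integral_sum nn_integral_add)
  also have "\<dots> \<le> (\<Sum>b\<in>(Basis::'a set). ennreal (exp ((real DIM('a))\<^sup>2 * c)) + ennreal (exp ((real DIM('a))\<^sup>2 * c)))"
  proof (intro sum_mono add_mono)
    fix b :: 'a assume b: "b \<in> Basis"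
    show "(\<integral>\<^sup>+\<omega>. ennreal (exp (DIM('a) * (X \<omega> \<bullet> b))) \<partial>M) \<le> ennreal (exp ((real DIM('a))\<^sup>2 * c))"
      using le[of "real DIM('a) *\<^sub>R b"] b by (simp add: inner_commute)
    show "(\<integral>\<^sup>+\<omega>. ennreal (exp (- (DIM('a) * (X \<omega> \<bullet> b)))) \<partial>M) \<le> ennreal (exp ((real DIM('a))\<^sup>2 * c))"
      using le[of "- real DIM('a) *\<^sub>R b"] b by (simp add: inner_commute)
  qed
  also have "\<dots> = ennreal (2 * DIM('a) * exp ((real DIM('a))\<^sup>2 * c))"
    by (simp add: ennreal_of_nat_eq_real_of_nat flip: ennreal_plus ennreal_mult)
  finally show ?thesis .
qed

lemma nn_integral_std_normal_expo:
  "(\<integral>\<^sup>+z. ennreal (expo z) \<partial>(std_normal_vec :: (real ^ 'n) measure)) < \<infinity>"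
  by (rule order_le_less_trans[OF nn_integral_expo_bound[where c = "1/2"]])
    (auto simp: nn_integral_std_normal_vec_exp)

lemma integrable_expo: "integrable (std_normal_vec :: (real ^ 'n) measure) expo"
  by (rule integrableI_bounded) (use nn_integral_std_normal_expo in \<open>auto simp: expo_nonneg\<close>)

text \<open>One term of the exponential series at \<open>1 + x\<close> is at most its sum, since all
  terms are nonnegative.\<close>

lemma one_plus_power_le_exp:
  fixes x :: real
  assumes "0 \<le> x"
  shows "(1 + x) ^ m \<le> fact m * exp 1 * exp x"
proof -
  have "(1 + x) ^ m / fact m \<le> exp (1 + x)"
    using exp_lower_Taylor_quadratic assms
  proof -
    have "(\<Sum>k\<in>{m}. (1 + x) ^ k /\<^sub>R fact k) \<le> (\<Sum>k. (1 + x) ^ k /\<^sub>R fact k)"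
      using assms by (intro sum_le_suminf summable_exp_generic) auto
    then show ?thesis by (simp add: exp_def field_simps)
  qed
  then show ?thesis by (simp add: field_simps exp_add)
qed

lemma integrable_std_normal_vec_power:
  "integrable (std_normal_vec :: (real ^ 'n) measure) (\<lambda>z. (1 + K * norm z) ^ m)" if "K \<ge> 0"
proof (rule Bochner_Integration.integrable_bound[where
      f = "\<lambda>z. (max 1 K) ^ m * (fact m * exp 1 * expo z)"])
  show "integrable (std_normal_vec :: (real ^ 'n) measure) (\<lambda>z. (max 1 K) ^ m * (fact m * exp 1 * expo z))"
    by (intro integrable_mult_right integrable_expo)
  show "AE z in (std_normal_vec :: (real ^ 'n) measure). norm ((1 + K * norm z) ^ m) \<le> norm ((max 1 K) ^ m * (fact m * exp 1 * expo z))"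
  proof (rule AE_I2)
    fix z :: "real ^ 'n"
    have "1 + K * norm z \<le> max 1 K * (1 + norm z)"
      by (simp add: distrib_left add_mono mult_right_mono)
    then have "(1 + K * norm z) ^ m \<le> (max 1 K) ^ m * (1 + norm z) ^ m"
      using that by (subst power_mult_distrib[symmetric]) (intro power_mono add_nonneg_nonneg, auto)
    also have "\<dots> \<le> (max 1 K) ^ m * (fact m * exp 1 * expo z)"
      by (intro mult_left_mono order_trans[OF one_plus_power_le_exp] mult_left_mono exp_norm_le_expo) auto
    finally show "norm ((1 + K * norm z) ^ m) \<le> norm ((max 1 K) ^ m * (fact m * exp 1 * expo z))"
      using that by (simp add: expo_nonneg abs_mult)
  qed
qed auto

text \<open>The coordinate is written as a product over all coordinates, with factors 1 elsewhere,
  so that the integral factorises and the first moment of a single factor makes it vanish.\<close>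

lemma std_normal_vec_mean: "(\<integral>z. z $ i \<partial>(std_normal_vec :: (real ^ 'n) measure)) = 0"
proof -
  interpret product_prob_space "\<lambda>_::'n. std_normal_distribution" by (rule product_std_normal)
  let ?P = "Pi\<^sub>M UNIV (\<lambda>_::'n. std_normal_distribution)"
  have int: "integrable std_normal_distribution (\<lambda>x. if j = i then x else 1)" for j
    using integrable_std_normal_distribution_moment[of 1] by (cases "j = i") auto
  have "(\<integral>z. z $ i \<partial>(std_normal_vec :: (real ^ 'n) measure)) = (\<integral>z. z i \<partial>?P)"
    unfolding std_normal_vec_def by (subst integral_distr) auto
  also have "\<dots> = (\<integral>z. (\<Prod>j\<in>UNIV. (if j = i then z j else 1)) \<partial>?P)"
    by (simp add: prod.delta)
  also have "\<dots> = (\<Prod>j\<in>UNIV. \<integral>x. (if j = i then x else 1) \<partial>std_normal_distribution)"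
    by (rule product_integral_prod) (auto intro: int)
  also have "\<dots> = (\<Prod>j\<in>UNIV. if j = i then (\<integral>x. x \<partial>std_normal_distribution) else 1)"
    by (intro prod.cong refl) (auto simp: M.prob_space[simplified])
  also have "\<dots> = 0"
    using integral_std_normal_distribution_moment_odd[of 1] by (simp add: prod.delta)
  finally show ?thesis .
qed

lemma integrable_std_normal_vec_norm_sq:
  "integrable (std_normal_vec :: (real ^ 'n) measure) (\<lambda>z. (norm z)\<^sup>2)"
  by (rule Bochner_Integration.integrable_bound[OF integrable_std_normal_vec_power[of 1 2]])
    (auto simp: power2_eq_square algebra_simps)

lemma integrable_std_normal_vec_inner:
  "integrable (std_normal_vec :: (real ^ 'n) measure) (\<lambda>z. c \<bullet> z)"
  by (rule Bochner_Integration.integrable_bound[OF integrable_std_normal_vec_power[of "norm c" 1]])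
    (auto intro!: AE_I2 add_increasing Cauchy_Schwarz_ineq2)

lemma std_normal_vec_mean_inner: "(\<integral>z. c \<bullet> z \<partial>(std_normal_vec :: (real ^ 'n) measure)) = 0"
proof -
  have 1: "integrable (std_normal_vec :: (real ^ 'n) measure) (\<lambda>z. z $ i)" for i
    using integrable_std_normal_vec_inner[of "axis i 1"] by (simp add: inner_axis' )
  show ?thesis
    by (simp add: inner_vec_def 1 Bochner_Integration.integral_sum std_normal_vec_mean)
qed

text \<open>An upper bound for \<open>E |A Z|\<^sup>2 / |A|\<^sup>2\<close> with \<open>Z\<close> standard normal (the Frobenius norm would allow
  the constant 1, but its value is irrelevant here).\<close>

definition m2 :: "'n::finite itself \<Rightarrow> real" where
  "m2 _ = (\<integral>z. (norm z)\<^sup>2 \<partial>(std_normal_vec :: (real ^ 'n) measure))"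

lemma m2_nonneg: "0 \<le> m2 TYPE('n::finite)"
  unfolding m2_def by (rule integral_nonneg_AE) simp

text \<open>One step of the isometry. In the expansion of the square the mixed term is linear in
  \<open>z\<close> and integrates to 0; the last term is estimated by the product of the norms of
  \<open>A\<close> and \<open>z\<close>, hence an inequality.\<close>

lemma std_normal_vec_affine_norm_sq:
  fixes A :: "real ^ 'n ^ 'd"
  assumes "0 \<le> r"
  shows "(\<integral>\<^sup>+z. ennreal ((norm (s + A *v (sqrt r *\<^sub>R z)))\<^sup>2) \<partial>std_normal_vec)
    \<le> ennreal ((norm s)\<^sup>2) + ennreal (m2 TYPE('n) * r) * ennreal ((norm A)\<^sup>2)"
proof -
  let ?c = "(2 * sqrt r) *\<^sub>R (transpose A *v s)"
  interpret S: prob_space "std_normal_vec :: (real ^ 'n) measure" by (rule prob_space_std_normal_vec)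
  let ?h = "\<lambda>z. (norm s)\<^sup>2 + (?c \<bullet> z + (r * (norm A)\<^sup>2) * (norm z)\<^sup>2)"
  have i0: "integrable std_normal_vec (\<lambda>z. ?c \<bullet> z + (r * (norm A)\<^sup>2) * (norm z)\<^sup>2)"
    by (rule Bochner_Integration.integrable_add[OF integrable_std_normal_vec_inner
        integrable_mult_right[OF integrable_std_normal_vec_norm_sq]])
  have int: "integrable std_normal_vec ?h"
    by (rule Bochner_Integration.integrable_add[OF S.integrable_const i0])
  have "(\<integral>z. ?h z \<partial>std_normal_vec) = (\<integral>z. (norm s)\<^sup>2 \<partial>(std_normal_vec :: (real ^ 'n) measure))
      + (\<integral>z. ?c \<bullet> z + (r * (norm A)\<^sup>2) * (norm z)\<^sup>2 \<partial>std_normal_vec)"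
    by (rule Bochner_Integration.integral_add[OF S.integrable_const i0])
  also have "(\<integral>z. ?c \<bullet> z + (r * (norm A)\<^sup>2) * (norm z)\<^sup>2 \<partial>std_normal_vec)
      = (\<integral>z. ?c \<bullet> z \<partial>std_normal_vec) + (\<integral>z. (r * (norm A)\<^sup>2) * (norm z)\<^sup>2 \<partial>(std_normal_vec :: (real ^ 'n) measure))"
    by (rule Bochner_Integration.integral_add[OF integrable_std_normal_vec_inner[of ?c]
        integrable_mult_right[OF integrable_std_normal_vec_norm_sq]])
  also have "(\<integral>z. ?c \<bullet> z \<partial>std_normal_vec) = 0" by (rule std_normal_vec_mean_inner)
  finally have inth: "(\<integral>z. ?h z \<partial>std_normal_vec) = (norm s)\<^sup>2 + (r * (norm A)\<^sup>2) * m2 TYPE('n)"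
    using S.prob_space by (simp add: m2_def)
  have le: "(norm (s + A *v (sqrt r *\<^sub>R z)))\<^sup>2 \<le> ?h z" for z
  proof -
    have gen: "(norm (s + q *\<^sub>R w))\<^sup>2 = (norm s)\<^sup>2 + (2 * q) * (s \<bullet> w) + q\<^sup>2 * (norm w)\<^sup>2" for q w
      unfolding power2_norm_eq_inner
      by (simp add: inner_add_left inner_add_right inner_commute[of w s] power2_eq_square algebra_simps)
    have "(norm (s + A *v (sqrt r *\<^sub>R z)))\<^sup>2
        = (norm s)\<^sup>2 + (2 * sqrt r) * (s \<bullet> (A *v z)) + (sqrt r)\<^sup>2 * (norm (A *v z))\<^sup>2"
      unfolding matrix_vector_mult_scaleR by (rule gen)
    also have "(2 * sqrt r) * (s \<bullet> (A *v z)) = ?c \<bullet> z"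
      unfolding inner_matrix_vector by (simp only: inner_scaleR_left)
    also have "(sqrt r)\<^sup>2 = r" using assms by simp
    finally have eq: "(norm (s + A *v (sqrt r *\<^sub>R z)))\<^sup>2 = (norm s)\<^sup>2 + ?c \<bullet> z + r * (norm (A *v z))\<^sup>2" .
    have "(norm (A *v z))\<^sup>2 \<le> (norm A)\<^sup>2 * (norm z)\<^sup>2"
      by (subst power_mult_distrib[symmetric]) (intro power_mono norm_matrix_vector_le norm_ge_zero)
    from mult_left_mono[OF this assms] show ?thesis unfolding eq by (simp only: mult.assoc add.assoc add_left_mono)
  qed
  have pos: "0 \<le> ?h z" for z using le[of z] by (rule order_trans[rotated]) simp
  have "(\<integral>\<^sup>+z. ennreal ((norm (s + A *v (sqrt r *\<^sub>R z)))\<^sup>2) \<partial>std_normal_vec) \<le> (\<integral>\<^sup>+z. ennreal (?h z) \<partial>std_normal_vec)"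
    by (intro nn_integral_mono ennreal_leI le)
  also have "\<dots> = ennreal (\<integral>z. ?h z \<partial>std_normal_vec)"
    by (intro nn_integral_eq_integral int AE_I2 pos)
  also note inth
  finally show ?thesis
    using assms m2_nonneg[where 'n='n] by (simp add: ennreal_plus ennreal_mult mult_ac)
qed

text \<open>One step of the exponential bound: the functional of \<open>A *v z\<close> in direction
  \<open>l\<close> is the functional of \<open>z\<close> in direction
  \<open>transpose A *v l\<close>, whose norm is at most \<open>K * norm l\<close>.\<close>

lemma std_normal_vec_affine_exp:
  fixes A :: "real ^ 'n ^ 'd"
  assumes "0 \<le> r" "norm A \<le> K"
  shows "(\<integral>\<^sup>+z. ennreal (exp (l \<bullet> (s + A *v (sqrt r *\<^sub>R z)))) \<partial>std_normal_vec)
    \<le> ennreal (exp (l \<bullet> s)) * ennreal (exp ((norm l)\<^sup>2 * (K\<^sup>2 * r / 2)))"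
proof -
  let ?c = "sqrt r *\<^sub>R (transpose A *v l)"
  have e: "l \<bullet> (s + A *v (sqrt r *\<^sub>R z)) = l \<bullet> s + ?c \<bullet> z" for z
    by (simp add: inner_add_right matrix_vector_mult_scaleR inner_matrix_vector del: transpose_matrix_vector)
  have "(\<integral>\<^sup>+z. ennreal (exp (l \<bullet> (s + A *v (sqrt r *\<^sub>R z)))) \<partial>std_normal_vec)
     = ennreal (exp (l \<bullet> s)) * ennreal (exp ((norm ?c)\<^sup>2 / 2))"
    by (simp only: e exp_add ennreal_mult'' exp_ge_zero)
      (subst nn_integral_cmult, simp_all only: nn_integral_std_normal_vec_exp, measurable)
  also have "(norm ?c)\<^sup>2 / 2 \<le> (norm l)\<^sup>2 * (K\<^sup>2 * r / 2)"
  proof -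
    have "norm (transpose A *v l) \<le> K * norm l"
      by (rule order_trans[OF norm_transpose_mult_le]) (intro mult_right_mono assms norm_ge_zero)
    then have "(norm (transpose A *v l))\<^sup>2 \<le> (K * norm l)\<^sup>2" by (intro power_mono) auto
    with assms(1) show ?thesis
      by (simp add: power_mult_distrib mult_left_mono mult_ac)
  qed
  finally show ?thesis by (simp add: mult_left_mono)
qed

section \<open>Sums against Brownian increments\<close>

abbreviation nsq :: "'a::real_normed_vector \<Rightarrow> ennreal" where
  "nsq x \<equiv> ennreal ((norm x)\<^sup>2)"

lemma continuous_on_matrix_vector_mult:
  fixes f :: "'a::topological_space \<Rightarrow> real ^ 'e ^ 'd"
  assumes "continuous_on S f" "continuous_on S g"
  shows "continuous_on S (\<lambda>x. f x *v g x)"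
  unfolding matrix_vector_mult_def by (intro continuous_intros assms)

lemma borel_measurable_matrix_vector_mult [measurable (raw)]:
  fixes f :: "'a \<Rightarrow> real ^ 'e ^ 'd"
  assumes "f \<in> borel_measurable M" "g \<in> borel_measurable M"
  shows "(\<lambda>x. f x *v g x) \<in> borel_measurable M"
  by (rule borel_measurable_continuous_Pair[OF assms])
    (intro continuous_on_matrix_vector_mult continuous_intros)

lemma normal_law_mat: "normal_law (mat c) = distr std_normal_vec borel (\<lambda>z::real^'n. c *\<^sub>R z)"
proof -
  have "mat c *v z = c *\<^sub>R z" for z :: "real ^ 'n"
    by (simp add: vec_eq_iff matrix_vector_mult_def mat_def if_distrib if_distribR cong: if_cong)
  then show ?thesis by (simp add: normal_law_def)
qed

section \<open>Brownian increments independent of the past\<close>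

locale brownian = prob_space M for M :: "'w measure" +
  fixes F :: "real \<Rightarrow> 'w measure" and W :: "real \<Rightarrow> 'w \<Rightarrow> real ^ 'e"
  assumes filtered: "filtered_prob_space M F" and bm: "brownian_motion M F W"
begin

lemma measurable_F_M: "0 \<le> t \<Longrightarrow> f \<in> measurable (F t) N \<Longrightarrow> f \<in> measurable M N"
  using filtered unfolding filtered_prob_space_def by (blast intro: measurable_from_subalg)

lemma measurable_F_mono: "0 \<le> s \<Longrightarrow> s \<le> t \<Longrightarrow> f \<in> measurable (F s) N \<Longrightarrow> f \<in> measurable (F t) N"
  using filtered unfolding filtered_prob_space_def
  by (intro measurable_from_subalg[of "F t" "F s"]) (auto simp: subalgebra_def)

lemma space_F: "0 \<le> t \<Longrightarrow> space (F t) = space M"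
  using filtered unfolding filtered_prob_space_def subalgebra_def by auto

lemma measurable_W: "0 \<le> t \<Longrightarrow> W t \<in> borel_measurable (F t)"
  using bm unfolding brownian_motion_def adapted_def by auto

lemma measurable_W_M: "0 \<le> t \<Longrightarrow> W t \<in> borel_measurable M"
  using measurable_F_M measurable_W by blast

text \<open>Independence says that the two laws multiply on rectangles, and rectangles determine the
  measure. The target space \<open>N\<close> is arbitrary, so that \<open>\<xi>\<close> can bundle
  several variables known at time \<open>s\<close>.\<close>

lemma freeze_distr:
  assumes st: "0 \<le> s" "s < t" and xi: "\<xi> \<in> measurable (F s) N"
  shows "distr M (N \<Otimes>\<^sub>M borel) (\<lambda>\<omega>. (\<xi> \<omega>, W t \<omega> - W s \<omega>))
    = distr M N \<xi> \<Otimes>\<^sub>M distr std_normal_vec borel (\<lambda>z. sqrt (t - s) *\<^sub>R z)"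
proof -
  let ?D = "\<lambda>\<omega>. W t \<omega> - W s \<omega>"
  have t: "0 \<le> t" using st by simp
  have [measurable]: "?D \<in> borel_measurable M"
    using measurable_W_M[OF st(1)] measurable_W_M[OF t] by measurable
  have [measurable]: "\<xi> \<in> measurable M N" by (rule measurable_F_M[OF st(1) xi])
  have ind: "indep_set (sets (F s)) {?D -` B \<inter> space M | B. B \<in> sets borel}"
    and dist: "distr M borel ?D = distr std_normal_vec borel (\<lambda>z. sqrt (t - s) *\<^sub>R z)"
    using bm st unfolding brownian_motion_def normal_law_mat by blast+
  interpret S: prob_space "std_normal_vec :: (real ^ 'e) measure" by (rule prob_space_std_normal_vec)
  interpret D: prob_space "distr std_normal_vec borel (\<lambda>z. sqrt (t - s) *\<^sub>R (z::real^'e))"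
    by (rule S.prob_space_distr) simp
  interpret X: prob_space "distr M N \<xi>" by (rule prob_space_distr) simp
  show ?thesis
  proof (rule pair_measure_eqI[symmetric])
    fix A B assume A: "A \<in> sets (distr M N \<xi>)"
      and B: "B \<in> sets (distr std_normal_vec borel (\<lambda>z. sqrt (t - s) *\<^sub>R (z::real^'e)))"
    then have [measurable]: "A \<in> sets N" "B \<in> sets borel" by auto
    have A': "\<xi> -` A \<inter> space M \<in> sets (F s)"
      using measurable_sets[OF xi, of A] space_F[OF st(1)] by simp
    have "emeasure (distr M (N \<Otimes>\<^sub>M borel) (\<lambda>\<omega>. (\<xi> \<omega>, ?D \<omega>))) (A \<times> B)
        = emeasure M ((\<xi> -` A \<inter> space M) \<inter> (?D -` B \<inter> space M))"
      by (subst emeasure_distr) (auto intro!: arg_cong[where f = "emeasure M"])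
    also have "\<dots> = emeasure M (\<xi> -` A \<inter> space M) * emeasure M (?D -` B \<inter> space M)"
    proof -
      have "?D -` B \<inter> space M \<in> {?D -` B \<inter> space M | B. B \<in> sets borel}"
        using \<open>B \<in> sets borel\<close> by blast
      from indep_setD[OF ind A' this] show ?thesis
        by (simp only: emeasure_eq_measure ennreal_mult[OF measure_nonneg measure_nonneg])
    qed
    also have "\<dots> = emeasure (distr M N \<xi>) A * emeasure (distr M borel ?D) B"
      by (subst (1 2) emeasure_distr) auto
    finally show "emeasure (distr M N \<xi>) A * emeasure (distr std_normal_vec borel (\<lambda>z. sqrt (t - s) *\<^sub>R z)) B
        = emeasure (distr M (N \<Otimes>\<^sub>M borel) (\<lambda>\<omega>. (\<xi> \<omega>, ?D \<omega>))) (A \<times> B)"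
      unfolding dist by simp
  qed (use sets_pair_measure_cong[of "distr M N \<xi>" N "distr std_normal_vec borel (\<lambda>z. sqrt (t - s) *\<^sub>R (z::real^'e))" borel]
       in \<open>auto intro: X.sigma_finite_measure_axioms D.sigma_finite_measure_axioms\<close>)
qed

text \<open>Integration over an increment with the past frozen, in place of a conditional
  expectation. The case \<open>s = t\<close> is included because partitions clipped to an interval
  have empty cells.\<close>

lemma freeze_nn:
  assumes st: "0 \<le> s" "s \<le> t" and xi: "\<xi> \<in> measurable (F s) N"
    and f [measurable]: "f \<in> borel_measurable (N \<Otimes>\<^sub>M borel)"
  shows "(\<integral>\<^sup>+\<omega>. f (\<xi> \<omega>, W t \<omega> - W s \<omega>) \<partial>M) = (\<integral>\<^sup>+\<omega>. \<integral>\<^sup>+z. f (\<xi> \<omega>, sqrt (t - s) *\<^sub>R z) \<partial>std_normal_vec \<partial>M)"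
proof (cases "s = t")
  case True
  interpret S: prob_space "std_normal_vec :: (real ^ 'e) measure" by (rule prob_space_std_normal_vec)
  show ?thesis using True S.emeasure_space_1 by simp
next
  case False
  then have st': "s < t" using st by simp
  have t: "0 \<le> t" using st by simp
  have [measurable]: "W t \<in> borel_measurable M" "W s \<in> borel_measurable M"
    using measurable_W_M[OF st(1)] measurable_W_M[OF t] by measurable
  have [measurable]: "\<xi> \<in> measurable M N" by (rule measurable_F_M[OF st(1) xi])
  interpret S: prob_space "std_normal_vec :: (real ^ 'e) measure" by (rule prob_space_std_normal_vec)
  interpret D: prob_space "distr std_normal_vec borel (\<lambda>z. sqrt (t - s) *\<^sub>R (z::real^'e))"
    by (rule S.prob_space_distr) simp
  have "(\<integral>\<^sup>+\<omega>. f (\<xi> \<omega>, W t \<omega> - W s \<omega>) \<partial>M) = (\<integral>\<^sup>+p. f p \<partial>distr M (N \<Otimes>\<^sub>M borel) (\<lambda>\<omega>. (\<xi> \<omega>, W t \<omega> - W s \<omega>)))"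
    by (subst nn_integral_distr) auto
  also have "\<dots> = (\<integral>\<^sup>+x. \<integral>\<^sup>+y. f (x, y) \<partial>distr std_normal_vec borel (\<lambda>z. sqrt (t - s) *\<^sub>R z) \<partial>distr M N \<xi>)"
    unfolding freeze_distr[OF st(1) st' xi]
    by (subst D.nn_integral_fst[symmetric]) (auto cong: measurable_cong_sets)
  also have "\<dots> = (\<integral>\<^sup>+\<omega>. \<integral>\<^sup>+y. f (\<xi> \<omega>, y) \<partial>distr std_normal_vec borel (\<lambda>z. sqrt (t - s) *\<^sub>R z) \<partial>M)"
    by (subst nn_integral_distr) (auto intro!: D.borel_measurable_nn_integral)
  also have "\<dots> = (\<integral>\<^sup>+\<omega>. \<integral>\<^sup>+z. f (\<xi> \<omega>, sqrt (t - s) *\<^sub>R z) \<partial>std_normal_vec \<partial>M)"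
    by (intro nn_integral_cong nn_integral_distr) (auto dest: measurable_space[OF \<open>\<xi> \<in> measurable M N\<close>])
  finally show ?thesis .
qed

lemma freeze_integral:
  fixes f :: "'x \<times> (real ^ 'e) \<Rightarrow> real"
  assumes st: "0 \<le> s" "s < t" and xi: "\<xi> \<in> measurable (F s) N"
    and f [measurable]: "f \<in> borel_measurable (N \<Otimes>\<^sub>M borel)"
    and int: "integrable M (\<lambda>\<omega>. f (\<xi> \<omega>, W t \<omega> - W s \<omega>))"
  shows "(\<integral>\<omega>. f (\<xi> \<omega>, W t \<omega> - W s \<omega>) \<partial>M) = (\<integral>\<omega>. \<integral>z. f (\<xi> \<omega>, sqrt (t - s) *\<^sub>R z) \<partial>std_normal_vec \<partial>M)"
proof -
  have t: "0 \<le> t" using st by simp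
  have [measurable]: "W t \<in> borel_measurable M" "W s \<in> borel_measurable M"
    using measurable_W_M[OF st(1)] measurable_W_M[OF t] by measurable
  have [measurable]: "\<xi> \<in> measurable M N" by (rule measurable_F_M[OF st(1) xi])
  interpret S: prob_space "std_normal_vec :: (real ^ 'e) measure" by (rule prob_space_std_normal_vec)
  interpret D: prob_space "distr std_normal_vec borel (\<lambda>z. sqrt (t - s) *\<^sub>R (z::real^'e))"
    by (rule S.prob_space_distr) simp
  interpret X: prob_space "distr M N \<xi>" by (rule prob_space_distr) simp
  interpret P: pair_prob_space "distr M N \<xi>" "distr std_normal_vec borel (\<lambda>z. sqrt (t - s) *\<^sub>R (z::real^'e))" ..
  have eq: "distr M (N \<Otimes>\<^sub>M borel) (\<lambda>\<omega>. (\<xi> \<omega>, W t \<omega> - W s \<omega>))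
      = distr M N \<xi> \<Otimes>\<^sub>M distr std_normal_vec borel (\<lambda>z. sqrt (t - s) *\<^sub>R z)"
    by (rule freeze_distr[OF st xi])
  have "integrable (distr M (N \<Otimes>\<^sub>M borel) (\<lambda>\<omega>. (\<xi> \<omega>, W t \<omega> - W s \<omega>))) f"
    using int by (subst integrable_distr_eq) auto
  then have int': "integrable (distr M N \<xi> \<Otimes>\<^sub>M distr std_normal_vec borel (\<lambda>z. sqrt (t - s) *\<^sub>R (z::real^'e))) f"
    unfolding eq .
  have "(\<integral>\<omega>. f (\<xi> \<omega>, W t \<omega> - W s \<omega>) \<partial>M) = (\<integral>p. f p \<partial>distr M (N \<Otimes>\<^sub>M borel) (\<lambda>\<omega>. (\<xi> \<omega>, W t \<omega> - W s \<omega>)))"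
    by (subst integral_distr) auto
  also have "\<dots> = (\<integral>x. \<integral>y. f (x, y) \<partial>distr std_normal_vec borel (\<lambda>z. sqrt (t - s) *\<^sub>R z) \<partial>distr M N \<xi>)"
    unfolding eq using P.integral_fst'[OF int'] by simp
  also have "\<dots> = (\<integral>\<omega>. \<integral>y. f (\<xi> \<omega>, y) \<partial>distr std_normal_vec borel (\<lambda>z. sqrt (t - s) *\<^sub>R z) \<partial>M)"
    by (subst integral_distr) (auto intro!: D.borel_measurable_lebesgue_integral)
  also have "\<dots> = (\<integral>\<omega>. \<integral>z. f (\<xi> \<omega>, sqrt (t - s) *\<^sub>R z) \<partial>std_normal_vec \<partial>M)"
    by (intro Bochner_Integration.integral_cong refl integral_distr)
      (auto dest: measurable_space[OF \<open>\<xi> \<in> measurable M N\<close>])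
  finally show ?thesis .
qed

text \<open>Compared with \<open>simple_integrand\<close>, times may coincide, because clipping a
  partition produces empty cells, and coefficients may be unbounded, because a merely measurable
  frozen value is subtracted from them later.\<close>

definition adapted_coeffs :: "nat \<Rightarrow> (nat \<Rightarrow> real) \<Rightarrow> (nat \<Rightarrow> 'w \<Rightarrow> real ^ 'e ^ 'd) \<Rightarrow> bool" where
  "adapted_coeffs L t c \<longleftrightarrow> 0 \<le> t 0 \<and> (\<forall>j<L. t j \<le> t (Suc j) \<and> c j \<in> borel_measurable (F (t j)))"

definition wsum :: "nat \<Rightarrow> (nat \<Rightarrow> real) \<Rightarrow> (nat \<Rightarrow> 'w \<Rightarrow> real ^ 'e ^ 'd) \<Rightarrow> 'w \<Rightarrow> real ^ 'd" where
  "wsum L t c \<omega> = (\<Sum>j<L. c j \<omega> *v (W (t (Suc j)) \<omega> - W (t j) \<omega>))"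

lemma adapted_coeffs_le:
  assumes "adapted_coeffs L t c" "i \<le> j" "j \<le> L"
  shows "t i \<le> t j"
  using assms(2,3)
proof (induction j rule: dec_induct)
  case (step n)
  then have "t i \<le> t n" "t n \<le> t (Suc n)" using assms(1) unfolding adapted_coeffs_def by auto
  then show ?case by (rule order_trans)
qed simp

lemma adapted_coeffs_nonneg:
  assumes "adapted_coeffs L t c" "j \<le> L"
  shows "0 \<le> t j"
  using adapted_coeffs_le[OF assms(1) _ assms(2), of 0] assms(1) unfolding adapted_coeffs_def by simp

lemma adapted_coeffs_Suc: "adapted_coeffs (Suc L) t c \<Longrightarrow> adapted_coeffs L t c"
  unfolding adapted_coeffs_def by auto

lemma measurable_wsum:
  assumes "adapted_coeffs L t c"
  shows "wsum L t c \<in> borel_measurable (F (t L))"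
proof -
  have "(\<lambda>\<omega>. c j \<omega> *v (W (t (Suc j)) \<omega> - W (t j) \<omega>)) \<in> borel_measurable (F (t L))" if "j < L" for j
  proof -
    have "0 \<le> t j" "t j \<le> t (Suc j)" "t (Suc j) \<le> t L" "c j \<in> borel_measurable (F (t j))"
      using that assms adapted_coeffs_nonneg[OF assms] adapted_coeffs_le[OF assms, of "Suc j" L]
      unfolding adapted_coeffs_def by auto
    then have [measurable]: "c j \<in> borel_measurable (F (t L))" "W (t j) \<in> borel_measurable (F (t L))"
      "W (t (Suc j)) \<in> borel_measurable (F (t L))"
      by (meson measurable_F_mono measurable_W order_trans)+
    show ?thesis by measurable
  qed
  then show ?thesis unfolding wsum_def[abs_def] by (intro borel_measurable_sum) auto
qed

lemma measurable_wsum_M: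
  assumes "adapted_coeffs L t c"
  shows "wsum L t c \<in> borel_measurable M"
  using measurable_F_M[OF adapted_coeffs_nonneg[OF assms order_refl] measurable_wsum[OF assms]] .

lemma wsum_step:
  assumes ac: "adapted_coeffs (Suc L) t c" and [measurable]: "f \<in> borel_measurable borel"
  shows "(\<integral>\<^sup>+\<omega>. f (wsum (Suc L) t c \<omega>) \<partial>M) =
    (\<integral>\<^sup>+\<omega>. \<integral>\<^sup>+z. f (wsum L t c \<omega> + c L \<omega> *v (sqrt (t (Suc L) - t L) *\<^sub>R z)) \<partial>std_normal_vec \<partial>M)"
proof -
  have L: "0 \<le> t L" "t L \<le> t (Suc L)" and [measurable]: "c L \<in> borel_measurable (F (t L))"
    using ac adapted_coeffs_nonneg[OF adapted_coeffs_Suc[OF ac] order_refl]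
    unfolding adapted_coeffs_def by auto
  have [measurable]: "wsum L t c \<in> borel_measurable (F (t L))"
    by (rule measurable_wsum[OF adapted_coeffs_Suc[OF ac]])
  have "(\<integral>\<^sup>+\<omega>. f (wsum (Suc L) t c \<omega>) \<partial>M) =
      (\<integral>\<^sup>+\<omega>. (\<lambda>p. f (fst (fst p) + snd (fst p) *v snd p)) ((wsum L t c \<omega>, c L \<omega>), W (t (Suc L)) \<omega> - W (t L) \<omega>) \<partial>M)"
    by (simp add: wsum_def)
  also have "\<dots> = (\<integral>\<^sup>+\<omega>. \<integral>\<^sup>+z. (\<lambda>p. f (fst (fst p) + snd (fst p) *v snd p)) ((wsum L t c \<omega>, c L \<omega>), sqrt (t (Suc L) - t L) *\<^sub>R z) \<partial>std_normal_vec \<partial>M)"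
    by (rule freeze_nn[OF L, where N = "borel \<Otimes>\<^sub>M borel"]) measurable
  finally show ?thesis by simp
qed

text \<open>By induction on the cells, each of which multiplies the bound by an exponential in its
  length; the lengths telescope. The result depends on \<open>K\<close> and the total length but not
  on the partition, and takes the place of moment inequalities for stochastic integrals.\<close>

lemma wsum_exp_moment:
  fixes c :: "nat \<Rightarrow> 'w \<Rightarrow> real ^ 'e ^ 'd"
  assumes "adapted_coeffs L t c" "\<And>j \<omega>. j < L \<Longrightarrow> \<omega> \<in> space M \<Longrightarrow> norm (c j \<omega>) \<le> K"
  shows "(\<integral>\<^sup>+\<omega>. ennreal (exp (l \<bullet> wsum L t c \<omega>)) \<partial>M) \<le> ennreal (exp ((norm l)\<^sup>2 * (K\<^sup>2 * (t L - t 0) / 2)))"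
  using assms
proof (induction L)
  case 0
  then show ?case by (simp add: wsum_def emeasure_space_1)
next
  case (Suc L)
  have ac: "adapted_coeffs L t c" by (rule adapted_coeffs_Suc[OF Suc.prems(1)])
  have r: "0 \<le> t (Suc L) - t L" using Suc.prems(1) unfolding adapted_coeffs_def by auto
  have [measurable]: "wsum L t c \<in> borel_measurable M" by (rule measurable_wsum_M[OF ac])
  let ?e = "exp ((norm l)\<^sup>2 * (K\<^sup>2 * (t (Suc L) - t L) / 2))"
  have "(\<integral>\<^sup>+\<omega>. ennreal (exp (l \<bullet> wsum (Suc L) t c \<omega>)) \<partial>M)
      = (\<integral>\<^sup>+\<omega>. \<integral>\<^sup>+z. ennreal (exp (l \<bullet> (wsum L t c \<omega> + c L \<omega> *v (sqrt (t (Suc L) - t L) *\<^sub>R z)))) \<partial>std_normal_vec \<partial>M)"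
    by (rule wsum_step[OF Suc.prems(1), where f = "\<lambda>x. ennreal (exp (l \<bullet> x))"]) measurable
  also have "\<dots> \<le> (\<integral>\<^sup>+\<omega>. ennreal (exp (l \<bullet> wsum L t c \<omega>)) * ennreal ?e \<partial>M)"
    by (intro nn_integral_mono std_normal_vec_affine_exp r Suc.prems(2)) auto
  also have "\<dots> = (\<integral>\<^sup>+\<omega>. ennreal (exp (l \<bullet> wsum L t c \<omega>)) \<partial>M) * ennreal ?e"
    by (rule nn_integral_multc) measurable
  also have "\<dots> \<le> ennreal (exp ((norm l)\<^sup>2 * (K\<^sup>2 * (t L - t 0) / 2))) * ennreal ?e"
    by (intro mult_right_mono Suc.IH ac Suc.prems(2)) auto
  also have "\<dots> = ennreal (exp ((norm l)\<^sup>2 * (K\<^sup>2 * (t (Suc L) - t 0) / 2)))"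
    by (simp add: ennreal_mult[symmetric] exp_add[symmetric]) (simp add: field_simps)
  finally show ?case .
qed

text \<open>The upper half of the isometry. The mixed term vanishes already for each frozen past,
  before the outer integration, so both sides may be infinite.\<close>

lemma wsum_second_moment:
  fixes c :: "nat \<Rightarrow> 'w \<Rightarrow> real ^ 'e ^ 'd"
  assumes "adapted_coeffs L t c"
  shows "(\<integral>\<^sup>+\<omega>. nsq (wsum L t c \<omega>) \<partial>M)
    \<le> ennreal (m2 TYPE('e)) * (\<integral>\<^sup>+\<omega>. (\<Sum>j<L. ennreal (t (Suc j) - t j) * nsq (c j \<omega>)) \<partial>M)"
  using assms
proof (induction L)
  case 0
  then show ?case by (simp add: wsum_def)
next
  case (Suc L)
  have ac: "adapted_coeffs L t c" by (rule adapted_coeffs_Suc[OF Suc.prems(1)])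
  have r: "0 \<le> t (Suc L) - t L" using Suc.prems(1) unfolding adapted_coeffs_def by auto
  have c: "c j \<in> borel_measurable M" if "j < Suc L" for j
    using measurable_F_M[of "t j"] adapted_coeffs_nonneg[OF Suc.prems, of j] Suc.prems that
    unfolding adapted_coeffs_def by auto
  have [measurable]: "wsum L t c \<in> borel_measurable M" "c L \<in> borel_measurable M"
    using measurable_wsum_M[OF ac] c[of L] by auto
  have ms: "(\<lambda>\<omega>. \<Sum>j<L. ennreal (t (Suc j) - t j) * nsq (c j \<omega>)) \<in> borel_measurable M"
  proof (intro borel_measurable_sum)
    fix j assume "j \<in> {..<L}"
    then have [measurable]: "c j \<in> borel_measurable M" using c[of j] by simp
    show "(\<lambda>\<omega>. ennreal (t (Suc j) - t j) * nsq (c j \<omega>)) \<in> borel_measurable M" by measurable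
  qed
  have "(\<integral>\<^sup>+\<omega>. nsq (wsum (Suc L) t c \<omega>) \<partial>M)
      = (\<integral>\<^sup>+\<omega>. \<integral>\<^sup>+z. nsq (wsum L t c \<omega> + c L \<omega> *v (sqrt (t (Suc L) - t L) *\<^sub>R z)) \<partial>std_normal_vec \<partial>M)"
    by (rule wsum_step[OF Suc.prems, where f = "\<lambda>x. ennreal ((norm x)\<^sup>2)"]) measurable
  also have "\<dots> \<le> (\<integral>\<^sup>+\<omega>. nsq (wsum L t c \<omega>)
       + ennreal (m2 TYPE('e)) * (ennreal (t (Suc L) - t L) * nsq (c L \<omega>)) \<partial>M)"
    by (intro nn_integral_mono order_trans[OF std_normal_vec_affine_norm_sq[OF r]])
      (simp add: ennreal_mult''[OF r] mult.assoc)
  also have "\<dots> = (\<integral>\<^sup>+\<omega>. nsq (wsum L t c \<omega>) \<partial>M)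
       + (\<integral>\<^sup>+\<omega>. ennreal (m2 TYPE('e)) * (ennreal (t (Suc L) - t L) * nsq (c L \<omega>)) \<partial>M)"
    by (rule nn_integral_add) measurable
  also have "\<dots> = (\<integral>\<^sup>+\<omega>. nsq (wsum L t c \<omega>) \<partial>M)
       + ennreal (m2 TYPE('e)) * (\<integral>\<^sup>+\<omega>. ennreal (t (Suc L) - t L) * nsq (c L \<omega>) \<partial>M)"
    by (subst nn_integral_cmult) auto
  also have "\<dots> \<le> ennreal (m2 TYPE('e)) * (\<integral>\<^sup>+\<omega>. (\<Sum>j<L. ennreal (t (Suc j) - t j) * nsq (c j \<omega>)) \<partial>M)
       + ennreal (m2 TYPE('e)) * (\<integral>\<^sup>+\<omega>. ennreal (t (Suc L) - t L) * nsq (c L \<omega>) \<partial>M)"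
    by (intro add_right_mono Suc.IH ac)
  also have "\<dots> = ennreal (m2 TYPE('e)) * (\<integral>\<^sup>+\<omega>. (\<Sum>j<Suc L. ennreal (t (Suc j) - t j) * nsq (c j \<omega>)) \<partial>M)"
    by (simp add: nn_integral_add[OF ms] distrib_left)
  finally show ?case .
qed

text \<open>Lenglart's inequality: the coefficients are set to zero as soon as the accumulated quadratic
  variation exceeds \<open>\<delta>\<close>, which is decided before the next increment.\<close>

lemma wsum_Lenglart:
  fixes c :: "nat \<Rightarrow> 'w \<Rightarrow> real ^ 'e ^ 'd"
  assumes ac: "adapted_coeffs L t c" and \<delta>: "0 \<le> \<delta>" and a: "0 < a"
  shows "measure M {\<omega>\<in>space M. a \<le> norm (wsum L t c \<omega>) \<and> (\<Sum>j<L. (t (Suc j) - t j) * (norm (c j \<omega>))\<^sup>2) \<le> \<delta>}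
    \<le> m2 TYPE('e) * \<delta> / a\<^sup>2"
proof -
  define Q where "Q m \<omega> = (\<Sum>j<m. (t (Suc j) - t j) * (norm (c j \<omega>))\<^sup>2)" for m \<omega>
  \<comment> \<open>\<open>Q (Suc j)\<close> contains the coming cell, whose length and coefficient
    are known at time \<open>t j\<close>. The coefficients \<open>b\<close> therefore stay adapted,
    and their accumulated sum never overshoots \<delta>.\<close>
  define b where "b j \<omega> = (if Q (Suc j) \<omega> \<le> \<delta> then c j \<omega> else 0)" for j \<omega>
  have inc: "0 \<le> (t (Suc j) - t j) * (norm (c j \<omega>))\<^sup>2" if "j < L" for j \<omega>
    using ac that unfolding adapted_coeffs_def by simp
  have cm: "c j \<in> borel_measurable (F (t m))" if "j \<le> m" "m < L" for j m
    using ac that adapted_coeffs_nonneg[OF ac, of j] adapted_coeffs_le[OF ac, of j m]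
    by (intro measurable_F_mono[of "t j" "t m"]) (auto simp: adapted_coeffs_def)
  have bm: "b m \<in> borel_measurable (F (t m))" if "m < L" for m
  proof -
    have [measurable]: "Q (Suc m) \<in> borel_measurable (F (t m))"
      unfolding Q_def[abs_def]
    proof (intro borel_measurable_sum)
      fix j assume "j \<in> {..<Suc m}"
      then have [measurable]: "c j \<in> borel_measurable (F (t m))" using cm[of j m] that by simp
      show "(\<lambda>\<omega>. (t (Suc j) - t j) * (norm (c j \<omega>))\<^sup>2) \<in> borel_measurable (F (t m))" by measurable
    qed
    have [measurable]: "c m \<in> borel_measurable (F (t m))" using cm[of m m] that by simp
    show ?thesis unfolding b_def[abs_def] by measurable
  qed
  have acb: "adapted_coeffs L t b" using ac bm unfolding adapted_coeffs_def by auto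
  have Qmono: "Q m \<omega> \<le> Q L \<omega>" if "m \<le> L" for m \<omega>
    unfolding Q_def by (rule sum_mono2) (use inc that in auto)
  \<comment> \<open>The bound \<open>Q m\<close> is carried along with \<delta> because a cell that
    is kept is compared with \<open>Q (Suc m)\<close>, which is at most \<delta> in that
    case.\<close>
  have Qb: "(\<Sum>j<m. (t (Suc j) - t j) * (norm (b j \<omega>))\<^sup>2) \<le> min \<delta> (Q m \<omega>)" if "m \<le> L" for m \<omega>
    using that
  proof (induction m)
    case 0
    then show ?case using \<delta> by (simp add: Q_def)
  next
    case (Suc m)
    then have IH: "(\<Sum>j<m. (t (Suc j) - t j) * (norm (b j \<omega>))\<^sup>2) \<le> min \<delta> (Q m \<omega>)" by simp
    have Qs: "Q (Suc m) \<omega> = Q m \<omega> + (t (Suc m) - t m) * (norm (c m \<omega>))\<^sup>2" by (simp add: Q_def)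
    show ?case using IH inc[of m \<omega>] Suc.prems
      by (cases "Q (Suc m) \<omega> \<le> \<delta>") (auto simp: b_def Qs)
  qed
  have [measurable]: "wsum L t b \<in> borel_measurable M" "wsum L t c \<in> borel_measurable M"
    using measurable_wsum_M acb ac by auto
  have "(\<integral>\<^sup>+\<omega>. nsq (wsum L t b \<omega>) \<partial>M)
      \<le> ennreal (m2 TYPE('e)) * (\<integral>\<^sup>+\<omega>. (\<Sum>j<L. ennreal (t (Suc j) - t j) * nsq (b j \<omega>)) \<partial>M)"
    by (rule wsum_second_moment[OF acb])
  also have "\<dots> \<le> ennreal (m2 TYPE('e)) * (\<integral>\<^sup>+\<omega>. ennreal \<delta> \<partial>M)"
  proof (intro mult_left_mono nn_integral_mono)
    fix \<omega>
    have "(\<Sum>j<L. ennreal (t (Suc j) - t j) * nsq (b j \<omega>))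
        = ennreal (\<Sum>j<L. (t (Suc j) - t j) * (norm (b j \<omega>))\<^sup>2)"
      using ac unfolding adapted_coeffs_def
      by (subst sum_ennreal[symmetric]) (auto simp: ennreal_mult)
    also have "\<dots> \<le> ennreal \<delta>" using Qb[OF order_refl, of \<omega>] by (intro ennreal_leI) simp
    finally show "(\<Sum>j<L. ennreal (t (Suc j) - t j) * nsq (b j \<omega>)) \<le> ennreal \<delta>" .
  qed simp
  also have "\<dots> = ennreal (m2 TYPE('e) * \<delta>)"
    using \<delta> m2_nonneg[where 'n='e] by (simp add: emeasure_space_1 ennreal_mult)
  finally have "measure M {\<omega>\<in>space M. nsq (wsum L t b \<omega>) \<ge> ennreal (a\<^sup>2)} \<le> m2 TYPE('e) * \<delta> / a\<^sup>2"
    using \<delta> m2_nonneg[where 'n='e] a by (intro markov) auto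
  moreover have "measure M {\<omega>\<in>space M. a \<le> norm (wsum L t c \<omega>) \<and> Q L \<omega> \<le> \<delta>}
      \<le> measure M {\<omega>\<in>space M. nsq (wsum L t b \<omega>) \<ge> ennreal (a\<^sup>2)}"
  proof (rule finite_measure_mono)
    show "{\<omega>\<in>space M. a \<le> norm (wsum L t c \<omega>) \<and> Q L \<omega> \<le> \<delta>}
        \<subseteq> {\<omega>\<in>space M. nsq (wsum L t b \<omega>) \<ge> ennreal (a\<^sup>2)}"
    proof safe
      fix \<omega> assume 1: "a \<le> norm (wsum L t c \<omega>)" and 2: "Q L \<omega> \<le> \<delta>"
      \<comment> \<open>\<open>Q\<close> is nondecreasing, so a final value of at most \<delta>
        means that no coefficient was cut.\<close>
      have "b j \<omega> = c j \<omega>" if "j < L" for j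
        using Qmono[of "Suc j" \<omega>] that 2 by (simp add: b_def)
      then have "wsum L t b \<omega> = wsum L t c \<omega>" unfolding wsum_def by (intro sum.cong) auto
      then show "ennreal (a\<^sup>2) \<le> nsq (wsum L t b \<omega>)"
        using 1 a by (intro ennreal_leI) (simp add: power_mono)
    qed
  qed measurable
  ultimately show ?thesis unfolding Q_def by linarith
qed

end

section \<open>Cadlag paths, grids and simple processes\<close>

definition clip :: "real \<Rightarrow> real \<Rightarrow> real \<Rightarrow> real" where
  "clip a b x = max a (min b x)"

text \<open>Every time has an open neighbourhood on which the path is bounded, by right-continuity
  on one side and the left limit on the other; finitely many of these cover the compact
  interval.\<close>

lemma cadlag_bounded:
  fixes x :: "real \<Rightarrow> 'b::real_normed_vector"
  assumes x: "cadlag x" and T: "0 \<le> T"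
  shows "bounded (x ` {0..T})"
proof -
  have loc: "\<exists>U. open U \<and> t \<in> U \<and> bounded (x ` (U \<inter> {0..T}))" if t: "t \<in> {0..T}" for t
  proof -
    have "(x \<longlongrightarrow> x t) (at_right t)" using x t unfolding cadlag_def by auto
    then have "\<forall>\<^sub>F s in at_right t. dist (x s) (x t) < 1" by (rule tendstoD) simp
    then obtain b where b: "b > t" "\<And>s. t < s \<Longrightarrow> s < b \<Longrightarrow> dist (x s) (x t) < 1"
      unfolding eventually_at_right_field by blast
    obtain a B where a: "a < t" "\<And>s. a < s \<Longrightarrow> s < t \<Longrightarrow> 0 \<le> s \<Longrightarrow> norm (x s) \<le> B"
    proof (cases "t > 0")
      case True
      then obtain l where "(x \<longlongrightarrow> l) (at_left t)" using x unfolding cadlag_def by auto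
      then have "\<forall>\<^sub>F s in at_left t. dist (x s) l < 1" by (rule tendstoD) simp
      then obtain a where a: "a < t" "\<And>s. a < s \<Longrightarrow> s < t \<Longrightarrow> dist (x s) l < 1"
        unfolding eventually_at_left_field by blast
      have "norm (x s) \<le> norm l + 1" if "a < s" "s < t" for s
        using a(2)[OF that] norm_triangle_sub[of "x s" l] by (simp add: dist_norm)
      with a(1) that show ?thesis by blast
    next
      case False
      with t have "t = 0" by simp
      \<comment> \<open>At time 0 there is no left limit, but also no nonnegative time to its
        left.\<close>
      then show ?thesis using that[of "t - 1" 0] by auto
    qed
    have "norm (x s) \<le> max B (norm (x t) + 1)" if "s \<in> {a<..<b} \<inter> {0..T}" for s
    proof -
      consider "s < t" | "s = t" | "s > t" by linarith
      then show ?thesis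
      proof cases
        case 1
        then show ?thesis using a(2)[of s] that by auto
      next
        case 3
        then have "dist (x s) (x t) < 1" using b(2)[of s] that by auto
        then show ?thesis using norm_triangle_sub[of "x s" "x t"] by (simp add: dist_norm)
      qed simp
    qed
    then have "bounded (x ` ({a<..<b} \<inter> {0..T}))"
      unfolding bounded_iff by (intro exI[of _ "max B (norm (x t) + 1)"]) blast
    with a(1) b(1) show ?thesis by (intro exI[of _ "{a<..<b}"]) auto
  qed
  then obtain U where U: "\<And>t. t \<in> {0..T} \<Longrightarrow> open (U t) \<and> t \<in> U t \<and> bounded (x ` (U t \<inter> {0..T}))"
    by metis
  have "compact {0..T}" by simp
  then obtain D where D: "D \<subseteq> {0..T}" "finite D" "{0..T} \<subseteq> (\<Union>t\<in>D. U t)"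
    using compactE_image[of "{0..T}" "{0..T}" U] U by blast
  have "x ` {0..T} \<subseteq> (\<Union>t\<in>D. x ` (U t \<inter> {0..T}))" using D(3) by blast
  moreover have "bounded (\<Union>t\<in>D. x ` (U t \<inter> {0..T}))"
    using D U by (intro bounded_UN) auto
  ultimately show ?thesis by (rule bounded_subset[rotated])
qed

lemma cadlag_left_limit:
  fixes x :: "real \<Rightarrow> 'b::t2_space"
  assumes "cadlag x" "0 < t"
  shows "(x \<longlongrightarrow> left_limit x t) (at_left t)"
proof -
  obtain l where l: "(x \<longlongrightarrow> l) (at_left t)" using assms unfolding cadlag_def by auto
  then have "Lim (at_left t) x = l" by (intro tendsto_Lim) auto
  with l assms(2) show ?thesis by (simp add: left_limit_def)
qed

text \<open>For \<open>u > 0\<close> this is the index \<open>i\<close> of the cell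
  \<open>(i/n, (i+1)/n]\<close> that contains \<open>u\<close>. The cells are open on the left like
  those of simple processes, hence a ceiling minus 1 instead of a floor.\<close>

definition grid_floor :: "nat \<Rightarrow> real \<Rightarrow> nat" where
  "grid_floor n u = nat (\<lceil>real n * u\<rceil> - 1)"

lemma measurable_grid_floor [measurable]: "grid_floor n \<in> measurable borel (count_space UNIV)"
  unfolding grid_floor_def[abs_def] by measurable

lemma grid_floor_eq:
  assumes "n \<ge> 1" "u \<in> {real i / real n<..real (Suc i) / real n}"
  shows "grid_floor n u = i"
proof -
  have "real i < real n * u" "real n * u \<le> real (Suc i)"
    using assms by (auto simp: field_simps)
  then have "\<lceil>real n * u\<rceil> = int i + 1" by (intro ceiling_unique) auto
  then show ?thesis by (simp add: grid_floor_def)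
qed

lemma grid_floor_bounds:
  assumes "n \<ge> 1" "u > 0"
  shows "real (grid_floor n u) / real n < u" "u \<le> real (Suc (grid_floor n u)) / real n"
    "u \<in> {real (grid_floor n u) / real n<..real (Suc (grid_floor n u)) / real n}"
proof -
  have "real n * u > 0" using assms by simp
  then have "\<lceil>real n * u\<rceil> \<ge> 1" by linarith
  then have "real (grid_floor n u) = of_int \<lceil>real n * u\<rceil> - 1" by (simp add: grid_floor_def)
  then have "real (grid_floor n u) < real n * u" "real n * u \<le> real (grid_floor n u) + 1"
    by linarith+
  then show "real (grid_floor n u) / real n < u" "u \<le> real (Suc (grid_floor n u)) / real n"
    "u \<in> {real (grid_floor n u) / real n<..real (Suc (grid_floor n u)) / real n}"
    using assms by (auto simp: field_simps)
qed

text \<open>The left end of the cell containing \<open>u\<close> lies strictly below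
  \<open>u\<close>, so the samples see the left limit, even at a jump. The lag \<open>l\<close>
  shifts by a fixed number of cells; natural subtraction keeps the time nonnegative.\<close>

lemma grid_left_tendsto:
  fixes x :: "real \<Rightarrow> 'b::t2_space"
  assumes x: "cadlag x" and u: "0 < u"
  shows "(\<lambda>n. x (real (grid_floor n u - l) / real n)) \<longlonglongrightarrow> left_limit x u"
proof -
  have "filterlim (\<lambda>n. real (grid_floor n u - l) / real n) (at_left u) sequentially"
    unfolding filterlim_at
  proof
    have b: "u - (1 + real l) / real n \<le> real (grid_floor n u - l) / real n \<and> real (grid_floor n u - l) / real n < u" if "n \<ge> 1" for n
    proof
      have "real (grid_floor n u - l) / real n \<le> real (grid_floor n u) / real n"
        by (intro divide_right_mono) auto
      with grid_floor_bounds(1)[OF that u] show "real (grid_floor n u - l) / real n < u" by linarith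
      have "real (grid_floor n u) - real l \<le> real (grid_floor n u - l)" by linarith
      then have "(real (grid_floor n u) - real l) / real n \<le> real (grid_floor n u - l) / real n"
        by (intro divide_right_mono) auto
      moreover have "u - (1 + real l) / real n \<le> (real (grid_floor n u) - real l) / real n"
        using grid_floor_bounds(2)[OF that u] by (simp add: diff_divide_distrib add_divide_distrib)
      ultimately show "u - (1 + real l) / real n \<le> real (grid_floor n u - l) / real n" by linarith
    qed
    show "\<forall>\<^sub>F n in sequentially. real (grid_floor n u - l) / real n \<in> {..<u} \<and> real (grid_floor n u - l) / real n \<noteq> u"
      using eventually_ge_at_top[of 1] by eventually_elim (use b in fastforce)
    show "(\<lambda>n. real (grid_floor n u - l) / real n) \<longlonglongrightarrow> u"
    proof (rule tendsto_sandwich)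
      have "(\<lambda>n. u - (1 + real l) / real n) \<longlonglongrightarrow> u - 0"
        by (intro tendsto_intros tendsto_divide_0 filterlim_real_sequentially[THEN filterlim_at_top_imp_at_infinity])
      then show "(\<lambda>n. u - (1 + real l) / real n) \<longlonglongrightarrow> u" by simp
      show "\<forall>\<^sub>F n in sequentially. u - (1 + real l) / real n \<le> real (grid_floor n u - l) / real n"
        using eventually_ge_at_top[of 1] by eventually_elim (use b in blast)
      show "\<forall>\<^sub>F n in sequentially. real (grid_floor n u - l) / real n \<le> u"
        using eventually_ge_at_top[of 1] by eventually_elim (use b in force)
    qed simp
  qed
  with cadlag_left_limit[OF x u] show ?thesis by (rule filterlim_compose)
qed

text \<open>The right end of the cell may be equal to \<open>u\<close>, so the convergence is taken
  along the closed half-line starting at \<open>u\<close>, where right-continuity yields the value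
  itself.\<close>

lemma grid_right_tendsto:
  fixes x :: "real \<Rightarrow> 'b::t2_space"
  assumes x: "cadlag x" and u: "0 < u"
  shows "(\<lambda>n. x (real (Suc (grid_floor n u)) / real n)) \<longlonglongrightarrow> x u"
proof -
  have "(x \<longlongrightarrow> x u) (at_right u)" using x u unfolding cadlag_def by auto
  then have "\<forall>\<^sub>F s in nhds u. s \<in> {u..} \<longrightarrow> x s \<in> S" if "open S" "x u \<in> S" for S
    using that unfolding tendsto_def eventually_at_filter
    by (auto elim!: eventually_mono simp: less_le)
  then have c: "(x \<longlongrightarrow> x u) (inf (nhds u) (principal {u..}))"
    unfolding tendsto_def eventually_inf_principal by blast
  have "filterlim (\<lambda>n. real (Suc (grid_floor n u)) / real n) (nhds u) sequentially"
  proof (rule tendsto_sandwich)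
    show "\<forall>\<^sub>F n in sequentially. u \<le> real (Suc (grid_floor n u)) / real n"
      using eventually_ge_at_top[of 1] by eventually_elim (use grid_floor_bounds u in blast)
    show "\<forall>\<^sub>F n in sequentially. real (Suc (grid_floor n u)) / real n \<le> u + 1 / real n"
      using eventually_ge_at_top[of 1]
    proof eventually_elim
      case (elim n)
      have "real (Suc (grid_floor n u)) / real n = real (grid_floor n u) / real n + 1 / real n"
        by (simp add: add_divide_distrib)
      with grid_floor_bounds(1)[OF elim u] show ?case by linarith
    qed
    have "(\<lambda>n. u + 1 / real n) \<longlonglongrightarrow> u + 0"
      by (intro tendsto_intros tendsto_divide_0 filterlim_real_sequentially[THEN filterlim_at_top_imp_at_infinity])
    then show "(\<lambda>n. u + 1 / real n) \<longlonglongrightarrow> u" by simp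
  qed simp
  moreover have "\<forall>\<^sub>F n in sequentially. real (Suc (grid_floor n u)) / real n \<in> {u..}"
    using eventually_ge_at_top[of 1]
    by eventually_elim (simp only: atLeast_iff grid_floor_bounds(2)[OF _ u])
  ultimately have "filterlim (\<lambda>n. real (Suc (grid_floor n u)) / real n) (inf (nhds u) (principal {u..})) sequentially"
    unfolding filterlim_inf filterlim_principal by blast
  with c show ?thesis by (rule filterlim_compose)
qed

text \<open>The inequality between the end points is part of the induction, which splits the
  interval at \<open>t L\<close>.\<close>

lemma nn_integral_interval_sum:
  fixes t :: "nat \<Rightarrow> real"
  assumes "\<And>j. j < L \<Longrightarrow> t j \<le> t (Suc j)" and [measurable]: "f \<in> borel_measurable lborel"
  shows "t 0 \<le> t L \<and> (\<integral>\<^sup>+u\<in>{t 0<..t L}. f u \<partial>lborel) = (\<Sum>j<L. \<integral>\<^sup>+u\<in>{t j<..t (Suc j)}. f u \<partial>lborel)"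
  using assms(1)
proof (induction L)
  case 0
  have "{t 0<..t 0} = {}" by auto
  then show ?case by simp
next
  case (Suc L)
  then have IH: "t 0 \<le> t L" "(\<integral>\<^sup>+u\<in>{t 0<..t L}. f u \<partial>lborel) = (\<Sum>j<L. \<integral>\<^sup>+u\<in>{t j<..t (Suc j)}. f u \<partial>lborel)"
    by auto
  have le: "t L \<le> t (Suc L)" using Suc.prems by simp
  have "(\<integral>\<^sup>+u\<in>{t 0<..t (Suc L)}. f u \<partial>lborel)
      = (\<integral>\<^sup>+u. f u * indicator {t 0<..t L} u + f u * indicator {t L<..t (Suc L)} u \<partial>lborel)"
    by (intro nn_integral_cong) (use IH(1) le in \<open>auto split: split_indicator\<close>)
  also have "\<dots> = (\<integral>\<^sup>+u\<in>{t 0<..t L}. f u \<partial>lborel) + (\<integral>\<^sup>+u\<in>{t L<..t (Suc L)}. f u \<partial>lborel)"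
    by (rule nn_integral_add) measurable
  finally show ?case using IH le by simp
qed

lemma nn_integral_step:
  fixes t :: "nat \<Rightarrow> real"
  assumes "\<And>j. j < L \<Longrightarrow> t j \<le> t (Suc j)" and [measurable]: "f \<in> borel_measurable lborel"
    and c: "\<And>j u. j < L \<Longrightarrow> u \<in> {t j<..t (Suc j)} \<Longrightarrow> f u = c j"
  shows "(\<integral>\<^sup>+u\<in>{t 0<..t L}. f u \<partial>lborel) = (\<Sum>j<L. ennreal (t (Suc j) - t j) * c j)"
proof -
  have "(\<integral>\<^sup>+u\<in>{t 0<..t L}. f u \<partial>lborel) = (\<Sum>j<L. \<integral>\<^sup>+u\<in>{t j<..t (Suc j)}. f u \<partial>lborel)"
    by (rule conjunct2[OF nn_integral_interval_sum]) (use assms in auto)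
  also have "\<dots> = (\<Sum>j<L. ennreal (t (Suc j) - t j) * c j)"
  proof (intro sum.cong refl)
    fix j assume j: "j \<in> {..<L}"
    have "(\<integral>\<^sup>+u\<in>{t j<..t (Suc j)}. f u \<partial>lborel) = (\<integral>\<^sup>+u\<in>{t j<..t (Suc j)}. c j \<partial>lborel)"
      by (intro nn_integral_cong) (use c j in \<open>auto split: split_indicator\<close>)
    also have "\<dots> = ennreal (t (Suc j) - t j) * c j"
      using assms(1)[of j] j by (simp add: nn_integral_cmult_indicator mult.commute)
    finally show "(\<integral>\<^sup>+u\<in>{t j<..t (Suc j)}. f u \<partial>lborel) = ennreal (t (Suc j) - t j) * c j" .
  qed
  finally show ?thesis .
qed

section \<open>Values of simple processes\<close>

lemma simple_process_measurable [measurable]: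
  "(\<lambda>u. simple_process N \<tau> \<xi> u \<omega>) \<in> borel_measurable borel"
  unfolding simple_process_def by measurable

lemma simple_times_mono:
  assumes "simple_integrand M F N \<tau> \<xi>" "i \<le> j" "j \<le> N"
  shows "\<tau> i \<le> \<tau> j"
  using assms(2,3)
proof (induction j rule: dec_induct)
  case (step n)
  then have "\<tau> i \<le> \<tau> n" "\<tau> n < \<tau> (Suc n)" using assms(1) unfolding simple_integrand_def by auto
  then show ?case by linarith
qed simp

text \<open>The cells are disjoint, so a single indicator survives. Only the times come from the
  assumption; the coefficients \<open>\<zeta>\<close> are free, so that the lemma serves for
  transformed coefficients as well.\<close>

lemma simple_process_eq:
  assumes si: "simple_integrand M F N \<tau> \<xi>" and j: "j < N" and u: "u \<in> {\<tau> j<..\<tau> (Suc j)}"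
  shows "simple_process N \<tau> \<zeta> u \<omega> = \<zeta> j \<omega>"
proof -
  have "indicator {\<tau> i<..\<tau> (Suc i)} u = (0::real)" if i: "i < N" "i \<noteq> j" for i
  proof (cases "i < j")
    case True
    then have "\<tau> (Suc i) \<le> \<tau> j" using simple_times_mono[OF si, of "Suc i" j] j by simp
    with u show ?thesis by simp
  next
    case False
    with i have "\<tau> (Suc j) \<le> \<tau> i" using simple_times_mono[OF si, of "Suc j" i] by simp
    with u show ?thesis by simp
  qed
  then have "simple_process N \<tau> \<zeta> u \<omega> = (\<Sum>i<N. if i = j then \<zeta> j \<omega> else 0)"
    unfolding simple_process_def by (intro sum.cong) (use u in auto)
  with j show ?thesis by simp
qed

lemma simple_process_zero:
  assumes si: "simple_integrand M F N \<tau> \<xi>" and u: "u \<le> \<tau> 0 \<or> \<tau> N < u"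
  shows "simple_process N \<tau> \<xi> u \<omega> = 0"
  unfolding simple_process_def
proof (intro sum.neutral ballI)
  fix i assume "i \<in> {..<N}"
  then have "\<tau> 0 \<le> \<tau> i" "\<tau> (Suc i) \<le> \<tau> N"
    using simple_times_mono[OF si, of 0 i] simple_times_mono[OF si, of "Suc i" N] by auto
  with u show "indicator {\<tau> i<..\<tau> (Suc i)} u *\<^sub>R \<xi> i \<omega> = 0" by auto
qed

text \<open>On a cell both sides are \<open>\<phi>\<close> of its coefficient; off the cells the
  process is 0, and this is where \<open>\<phi> 0 = 0\<close> enters.\<close>

lemma simple_process_map:
  assumes si: "simple_integrand M F N \<tau> \<xi>" and \<phi>: "\<phi> 0 = 0"
  shows "simple_process N \<tau> (\<lambda>i \<omega>. \<phi> (\<xi> i \<omega>)) u \<omega> = \<phi> (simple_process N \<tau> \<xi> u \<omega>)"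
proof (cases "\<exists>j<N. u \<in> {\<tau> j<..\<tau> (Suc j)}")
  case True
  then obtain j where j: "j < N" "u \<in> {\<tau> j<..\<tau> (Suc j)}" by blast
  show ?thesis by (simp only: simple_process_eq[OF si j])
next
  case False
  then have "indicator {\<tau> i<..\<tau> (Suc i)} u = (0::real)" if "i < N" for i using that by auto
  then show ?thesis using \<phi> by (simp add: simple_process_def)
qed

section \<open>Simple stochastic integrals\<close>

text \<open>Dominated convergence twice, in \<open>u\<close> for fixed \<open>\<omega>\<close> and
  then in \<open>\<omega>\<close>. Time 0 is left out because limits along the grid are known only
  for \<open>u > 0\<close>.\<close>

lemma set_nn_integral_dominated_zero:
  fixes f :: "nat \<Rightarrow> 'w \<Rightarrow> real \<Rightarrow> real"
  assumes "prob_space M" and R: "0 \<le> R"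
    and meas: "\<And>n. (\<lambda>p. f n (fst p) (snd p)) \<in> borel_measurable (M \<Otimes>\<^sub>M lborel)"
    and bound: "\<And>n \<omega> u. \<omega> \<in> space M \<Longrightarrow> 0 < u \<Longrightarrow> \<bar>f n \<omega> u\<bar> \<le> C"
    and lim: "\<And>\<omega> u. \<omega> \<in> space M \<Longrightarrow> 0 < u \<Longrightarrow> (\<lambda>n. f n \<omega> u) \<longlonglongrightarrow> 0"
  shows "(\<lambda>n. \<integral>\<^sup>+\<omega>. (\<integral>\<^sup>+u\<in>{0<..R}. ennreal (f n \<omega> u) \<partial>lborel) \<partial>M) \<longlonglongrightarrow> 0"
proof -
  interpret prob_space M by fact
  have [measurable]: "f n \<omega> \<in> borel_measurable lborel" if "\<omega> \<in> space M" for n \<omega>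
    using measurable_compose[OF measurable_Pair1' meas[of n], of \<omega>] that by simp
  have q: "(\<lambda>n. \<integral>\<^sup>+u\<in>{0<..R}. ennreal (f n \<omega> u) \<partial>lborel) \<longlonglongrightarrow> 0" if \<omega>: "\<omega> \<in> space M" for \<omega>
  proof -
    have "(\<lambda>n. \<integral>\<^sup>+u\<in>{0<..R}. ennreal (f n \<omega> u) \<partial>lborel) \<longlonglongrightarrow> (\<integral>\<^sup>+(u::real). 0 \<partial>lborel)"
    proof (rule nn_integral_dominated_convergence[where w = "\<lambda>u. ennreal C * indicator {0<..R} u"])
      show "AE u in lborel. ennreal (f n \<omega> u) * indicator {0<..R} u \<le> ennreal C * indicator {0<..R} u" for n
        using bound[OF \<omega>, of _ n] by (intro AE_I2) (auto split: split_indicator intro!: ennreal_leI dest: abs_le_D1)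
      show "AE u in lborel. (\<lambda>n. ennreal (f n \<omega> u) * indicator {0<..R} u) \<longlonglongrightarrow> 0"
      proof (rule AE_I2)
        fix u :: real
        show "(\<lambda>n. ennreal (f n \<omega> u) * indicator {0<..R} u) \<longlonglongrightarrow> 0"
        proof (cases "u \<in> {0<..R}")
          case True
          with tendsto_ennrealI[OF lim[OF \<omega>, of u]] show ?thesis by simp
        qed simp
      qed
    qed (use \<omega> R in \<open>auto simp: nn_integral_cmult_indicator ennreal_mult_less_top\<close>)
    then show ?thesis by simp
  qed
  have "(\<lambda>n. \<integral>\<^sup>+\<omega>. (\<integral>\<^sup>+u\<in>{0<..R}. ennreal (f n \<omega> u) \<partial>lborel) \<partial>M) \<longlonglongrightarrow> (\<integral>\<^sup>+\<omega>. 0 \<partial>M)"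
  proof (rule nn_integral_dominated_convergence[where w = "\<lambda>\<omega>. ennreal C * ennreal R"])
    show "(\<lambda>\<omega>. \<integral>\<^sup>+u\<in>{0<..R}. ennreal (f n \<omega> u) \<partial>lborel) \<in> borel_measurable M" for n
    proof (rule lborel.borel_measurable_nn_integral)
      note meas[of n, measurable]
      show "(\<lambda>(\<omega>, u). ennreal (f n \<omega> u) * indicator {0<..R} u) \<in> borel_measurable (M \<Otimes>\<^sub>M lborel)"
        unfolding split_beta by measurable
    qed
    show "AE \<omega> in M. (\<integral>\<^sup>+u\<in>{0<..R}. ennreal (f n \<omega> u) \<partial>lborel) \<le> ennreal C * ennreal R" for n
    proof (rule AE_I2)
      fix \<omega> assume \<omega>: "\<omega> \<in> space M"
      have "(\<integral>\<^sup>+u\<in>{0<..R}. ennreal (f n \<omega> u) \<partial>lborel) \<le> (\<integral>\<^sup>+u\<in>{0<..R}. ennreal C \<partial>lborel)"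
        using bound[OF \<omega>, of _ n]
        by (intro nn_integral_mono) (auto split: split_indicator intro!: ennreal_leI dest: abs_le_D1)
      also have "\<dots> = ennreal C * ennreal R"
        using R by (simp add: nn_integral_cmult_indicator)
      finally show "(\<integral>\<^sup>+u\<in>{0<..R}. ennreal (f n \<omega> u) \<partial>lborel) \<le> ennreal C * ennreal R" .
    qed
    show "AE \<omega> in M. (\<lambda>n. \<integral>\<^sup>+u\<in>{0<..R}. ennreal (f n \<omega> u) \<partial>lborel) \<longlonglongrightarrow> 0"
      using q by (intro AE_I2)
  qed (auto simp: emeasure_space_1 ennreal_mult_less_top)
  then show ?thesis by simp
qed

text \<open>The generators of the predictable sigma-algebra are rectangles, which are measurable for
  the product after exchanging the factors. The maximum with 0 extends the process to the whole
  line.\<close>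

lemma predictable_joint:
  assumes sub: "\<And>t. 0 \<le> t \<Longrightarrow> sets (F t) \<subseteq> sets M" and X: "predictable M F X"
  shows "(\<lambda>p. X (max 0 (snd p)) (fst p)) \<in> borel_measurable (M \<Otimes>\<^sub>M borel)"
proof -
  let ?G = "{{0} \<times> A | A. A \<in> sets (F 0)} \<union> {{s<..t} \<times> A | s t A. 0 \<le> s \<and> s < t \<and> A \<in> sets (F s)}"
  have AM: "A \<in> sets M" if "A \<in> sets (F s)" "0 \<le> s" for A s
    using sub[OF that(2)] that(1) by blast
  have gen: "\<exists>A I. y = I \<times> A \<and> I \<in> sets borel \<and> I \<subseteq> {0..} \<and> A \<in> sets M" if "y \<in> ?G" for y
    using that
  proof
    assume "y \<in> {{0} \<times> A | A. A \<in> sets (F 0)}"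
    then obtain A where "y = {0} \<times> A" "A \<in> sets (F 0)" by blast
    with AM[of A 0] show ?thesis by (intro exI[of _ A] exI[of _ "{0}"]) simp
  next
    assume "y \<in> {{s<..t} \<times> A | s t A. 0 \<le> s \<and> s < t \<and> A \<in> sets (F s)}"
    then obtain s t A where "y = {s<..t} \<times> A" "0 \<le> s" "A \<in> sets (F s)" by blast
    with AM[of A s] show ?thesis by (intro exI[of _ A] exI[of _ "{s<..t}"]) auto
  qed
  have G: "?G \<subseteq> Pow ({0..} \<times> space M)"
  proof
    fix y assume "y \<in> ?G"
    from gen[OF this] obtain A I where "y = I \<times> A" "I \<subseteq> {0..}" "A \<in> sets M" by blast
    with sets.sets_into_space[of A M] show "y \<in> Pow ({0..} \<times> space M)" by blast
  qed
  have "(\<lambda>p. (max (0::real) (snd p), fst p)) \<in> measurable (M \<Otimes>\<^sub>M borel) (predictable_sigma M F)"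
    unfolding predictable_sigma_def
  proof (rule measurable_measure_of[OF G])
    show "(\<lambda>p. (max (0::real) (snd p), fst p)) \<in> space (M \<Otimes>\<^sub>M borel) \<rightarrow> {0..} \<times> space M"
      by (auto simp: space_pair_measure)
    fix y assume "y \<in> ?G"
    from gen[OF this] obtain A I where y: "y = I \<times> A" "I \<in> sets borel" "A \<in> sets M" by blast
    then have [measurable]: "I \<in> sets borel" "A \<in> sets M" by auto
    have "(\<lambda>p. (max (0::real) (snd p), fst p)) -` y \<inter> space (M \<Otimes>\<^sub>M borel)
        = {p \<in> space (M \<Otimes>\<^sub>M borel). max (0::real) (snd p) \<in> I \<and> fst p \<in> A}"
      by (auto simp: y)
    also have "\<dots> \<in> sets (M \<Otimes>\<^sub>M borel)" by measurable
    finally show "(\<lambda>p. (max (0::real) (snd p), fst p)) -` y \<inter> space (M \<Otimes>\<^sub>M borel) \<in> sets (M \<Otimes>\<^sub>M borel)" .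
  qed
  from measurable_compose[OF this X[unfolded predictable_def]] show ?thesis by simp
qed

context brownian
begin

text \<open>The increment of a simple integral over \<open>[a, b]\<close> is a sum over the times
  clipped to \<open>[a, b]\<close>. Two cells with coefficient 0 are added, from \<open>a\<close> to
  the first clipped time and from the last one to \<open>b\<close>, so that the partition fills the
  interval and the values of the process can be read off on all of it.\<close>

lemma cell_representation:
  fixes \<xi> :: "nat \<Rightarrow> 'w \<Rightarrow> real ^ 'e ^ 'd"
  assumes si: "simple_integrand M F N \<tau> \<xi>" and ab: "0 \<le> a" "a \<le> b"
  obtains L t c where "adapted_coeffs L t c" "t 0 = a" "t L = b"
    "\<And>j u \<omega>. j < L \<Longrightarrow> u \<in> {t j<..t (Suc j)} \<Longrightarrow> simple_process N \<tau> \<xi> u \<omega> = c j \<omega>"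
    "\<And>\<omega>. wsum L t c \<omega> = simple_integral W N \<tau> \<xi> b \<omega> - simple_integral W N \<tau> \<xi> a \<omega>"
    "\<And>j \<omega>. c j \<omega> = 0 \<or> (\<exists>i<N. c j \<omega> = \<xi> i \<omega>)"
proof -
  define t where "t j = (case j of 0 \<Rightarrow> a | Suc i \<Rightarrow> if i \<le> N then clip a b (\<tau> i) else b)" for j
  \<comment> \<open>If \<open>\<tau> i \<ge> b\<close>, the clipped time is \<open>b\<close> and
    \<open>\<xi> i\<close> may be unknown by then; the cell is empty, so 0 can be used instead. If
    \<open>\<tau> i < b\<close>, clipping can only move the time forward.\<close>
  define c where "c j \<omega> = (case j of 0 \<Rightarrow> 0 | Suc i \<Rightarrow> if i < N \<and> \<tau> i < b then \<xi> i \<omega> else 0)" for j \<omega>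
  have \<tau>0: "0 \<le> \<tau> i" if "i \<le> N" for i
    using simple_times_mono[OF si, of 0 i] si that unfolding simple_integrand_def by auto
  have \<tau>S: "\<tau> i \<le> \<tau> (Suc i)" if "i < N" for i
    using simple_times_mono[OF si, of i "Suc i"] that by simp
  have t0: "t 0 = a" and tS: "\<And>i. i \<le> N \<Longrightarrow> t (Suc i) = clip a b (\<tau> i)" and tL: "t (Suc (Suc N)) = b"
    and c0: "\<And>\<omega>. c 0 \<omega> = 0" and cS: "\<And>i \<omega>. c (Suc i) \<omega> = (if i < N \<and> \<tau> i < b then \<xi> i \<omega> else 0)"
    by (auto simp: t_def c_def)
  have ac: "adapted_coeffs (Suc (Suc N)) t c"
    unfolding adapted_coeffs_def
  proof (intro conjI allI impI)
    show "0 \<le> t 0" using ab by (simp add: t0)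
    fix j assume j: "j < Suc (Suc N)"
    show "t j \<le> t (Suc j)"
    proof (cases j)
      case 0
      then show ?thesis using ab by (simp add: t0 tS clip_def)
    next
      case (Suc i)
      show ?thesis
      proof (cases "i < N")
        case True
        then show ?thesis using \<tau>S[of i] by (auto simp: Suc tS clip_def)
      next
        case False
        then have "i = N" using j Suc by simp
        then show ?thesis using ab by (simp add: Suc tS tL clip_def)
      qed
    qed
    show "c j \<in> borel_measurable (F (t j))"
    proof (cases j)
      case 0
      then show ?thesis by (simp add: c0[abs_def])
    next
      case (Suc i)
      show ?thesis
      proof (cases "i < N \<and> \<tau> i < b")
        case True
        then have "\<xi> i \<in> borel_measurable (F (\<tau> i))" using si unfolding simple_integrand_def by blast
        then have "\<xi> i \<in> borel_measurable (F (clip a b (\<tau> i)))"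
          by (rule measurable_F_mono[rotated 2]) (use True \<tau>0 in \<open>auto simp: clip_def\<close>)
        with True show ?thesis by (simp add: Suc cS[abs_def] tS)
      next
        case False
        then have "c (Suc i) = (\<lambda>_. 0)" by (auto simp: fun_eq_iff cS)
        then show ?thesis by (simp add: Suc)
      qed
    qed
  qed
  show ?thesis
  proof (rule that[OF ac t0 tL])
    fix j u \<omega> assume j: "j < Suc (Suc N)" and u: "u \<in> {t j<..t (Suc j)}"
    show "simple_process N \<tau> \<xi> u \<omega> = c j \<omega>"
    proof (cases j)
      case 0
      with u have "u \<le> \<tau> 0" by (auto simp: t0 tS clip_def)
      with 0 show ?thesis using simple_process_zero[OF si] by (simp add: c0)
    next
      case (Suc i)
      show ?thesis
      proof (cases "i < N")
        case True
        with u ab have "\<tau> i < b" "u \<in> {\<tau> i<..\<tau> (Suc i)}"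
          by (auto simp: Suc tS clip_def max_def min_def split: if_splits)
        with True show ?thesis using simple_process_eq[OF si True] by (simp add: Suc cS)
      next
        case False
        then have i: "i = N" using j Suc by simp
        with u ab have "\<tau> N < u" by (auto simp: Suc tS tL clip_def max_def min_def split: if_splits)
        with i show ?thesis using simple_process_zero[OF si] by (simp add: Suc cS)
      qed
    qed
  next
    fix \<omega>
    have tm: "c (Suc i) \<omega> *v (W (t (Suc (Suc i))) \<omega> - W (t (Suc i)) \<omega>)
        = \<xi> i \<omega> *v (W (min b (\<tau> (Suc i))) \<omega> - W (min b (\<tau> i)) \<omega>) - \<xi> i \<omega> *v (W (min a (\<tau> (Suc i))) \<omega> - W (min a (\<tau> i)) \<omega>)"
      if i: "i < N" for i
    proof -
      \<comment> \<open>Stopping at \<open>b\<close> minus stopping at \<open>a\<close> depends on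
        \<open>x\<close> only through its clipped value; the constant \<open>W a\<close> cancels in
        differences.\<close>
      have cl: "W (min b x) \<omega> - W (min a x) \<omega> = W (clip a b x) \<omega> - W a \<omega>" for x
        using ab by (cases "x \<le> a") (auto simp: clip_def max_def min_def)
      have "\<xi> i \<omega> *v (W (min b (\<tau> (Suc i))) \<omega> - W (min b (\<tau> i)) \<omega>) - \<xi> i \<omega> *v (W (min a (\<tau> (Suc i))) \<omega> - W (min a (\<tau> i)) \<omega>)
          = \<xi> i \<omega> *v ((W (min b (\<tau> (Suc i))) \<omega> - W (min a (\<tau> (Suc i))) \<omega>) - (W (min b (\<tau> i)) \<omega> - W (min a (\<tau> i)) \<omega>))"
        by (simp add: matrix_vector_mult_diff_distrib)
      also have "\<dots> = \<xi> i \<omega> *v (W (clip a b (\<tau> (Suc i))) \<omega> - W (clip a b (\<tau> i)) \<omega>)"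
        unfolding cl by simp
      also have "\<dots> = c (Suc i) \<omega> *v (W (t (Suc (Suc i))) \<omega> - W (t (Suc i)) \<omega>)"
      proof (cases "\<tau> i < b")
        case True
        then show ?thesis using i by (simp add: cS tS)
      next
        case False
        then have "clip a b (\<tau> (Suc i)) = clip a b (\<tau> i)" using \<tau>S[OF i] by (simp add: clip_def)
        then show ?thesis using False i by (simp add: cS tS)
      qed
      finally show ?thesis by simp
    qed
    have "wsum (Suc (Suc N)) t c \<omega> = (\<Sum>i<N. c (Suc i) \<omega> *v (W (t (Suc (Suc i))) \<omega> - W (t (Suc i)) \<omega>))"
      unfolding wsum_def sum.lessThan_Suc[of _ "Suc N"] sum.lessThan_Suc_shift[of _ N] by (simp add: c0 cS[of N])
    also have "\<dots> = simple_integral W N \<tau> \<xi> b \<omega> - simple_integral W N \<tau> \<xi> a \<omega>"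
      unfolding simple_integral_def sum_subtractf[symmetric] by (intro sum.cong) (auto simp: tm)
    finally show "wsum (Suc (Suc N)) t c \<omega> = simple_integral W N \<tau> \<xi> b \<omega> - simple_integral W N \<tau> \<xi> a \<omega>" .
    show "c j \<omega> = 0 \<or> (\<exists>i<N. c j \<omega> = \<xi> i \<omega>)" for j
      by (auto simp: c_def split: nat.split)
  qed
qed

section \<open>Moment and tail bounds for simple integrals\<close>

lemma simple_integral_measurable:
  fixes \<xi> :: "nat \<Rightarrow> 'w \<Rightarrow> real ^ 'e ^ 'd"
  assumes si: "simple_integrand M F N \<tau> \<xi>" and s: "0 \<le> s"
  shows "simple_integral W N \<tau> \<xi> s \<in> borel_measurable M"
  unfolding simple_integral_def[abs_def]
proof (rule borel_measurable_sum)
  fix i assume i: "i \<in> {..<N}"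
  have 0: "0 \<le> \<tau> j" if "j \<le> N" for j
    using simple_times_mono[OF si, of 0 j] si that unfolding simple_integrand_def by auto
  have [measurable]: "\<xi> i \<in> borel_measurable M"
    using si i measurable_F_M[OF 0, of i "\<xi> i" borel] unfolding simple_integrand_def by auto
  have [measurable]: "W (min s (\<tau> (Suc i))) \<in> borel_measurable M" "W (min s (\<tau> i)) \<in> borel_measurable M"
    by (intro measurable_W_M; use 0[of i] 0[of "Suc i"] s i in auto)+
  show "(\<lambda>\<omega>. \<xi> i \<omega> *v (W (min s (\<tau> (Suc i))) \<omega> - W (min s (\<tau> i)) \<omega>)) \<in> borel_measurable M"
    by measurable
qed

lemma simple_integral_0: "simple_integrand M F N \<tau> \<xi> \<Longrightarrow> simple_integral W N \<tau> \<xi> 0 \<omega> = 0"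
  unfolding simple_integral_def
proof (intro sum.neutral ballI)
  fix i assume si: "simple_integrand M F N \<tau> \<xi>" and i: "i \<in> {..<N}"
  have 0: "0 \<le> \<tau> j" if "j \<le> N" for j
    using simple_times_mono[OF si, of 0 j] si that unfolding simple_integrand_def by auto
  show "\<xi> i \<omega> *v (W (min 0 (\<tau> (Suc i))) \<omega> - W (min 0 (\<tau> i)) \<omega>) = 0"
    using 0[of i] 0[of "Suc i"] i by (simp add: min_def)
qed

lemma simple_integral_exp_moment:
  fixes \<xi> :: "nat \<Rightarrow> 'w \<Rightarrow> real ^ 'e ^ 'd"
  assumes si: "simple_integrand M F N \<tau> \<xi>" and ab: "0 \<le> a" "a \<le> b"
    and K: "\<And>i \<omega>. i < N \<Longrightarrow> norm (\<xi> i \<omega>) \<le> K" "0 \<le> K"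
  shows "(\<integral>\<^sup>+\<omega>. ennreal (exp (l \<bullet> (simple_integral W N \<tau> \<xi> b \<omega> - simple_integral W N \<tau> \<xi> a \<omega>))) \<partial>M)
    \<le> ennreal (exp ((norm l)\<^sup>2 * (K\<^sup>2 * (b - a) / 2)))"
proof -
  obtain L t c where r: "adapted_coeffs L t c" "t 0 = a" "t L = b"
    "\<And>\<omega>. wsum L t c \<omega> = simple_integral W N \<tau> \<xi> b \<omega> - simple_integral W N \<tau> \<xi> a \<omega>"
    "\<And>j \<omega>. c j \<omega> = 0 \<or> (\<exists>i<N. c j \<omega> = \<xi> i \<omega>)"
    using cell_representation[OF si ab] by metis
  have "norm (c j \<omega>) \<le> K" for j \<omega> using r(5)[of j \<omega>] K by auto
  then show ?thesis using wsum_exp_moment[OF r(1), of K l] by (simp add: r)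
qed

text \<open>A coefficient known at time \<open>a\<close> can be subtracted on every cell of
  \<open>(a, b]\<close> without losing adaptedness, and the increments of \<open>W\<close> that it
  multiplies telescope.\<close>

lemma simple_integral_second_moment:
  fixes \<xi> :: "nat \<Rightarrow> 'w \<Rightarrow> real ^ 'e ^ 'd"
  assumes si: "simple_integrand M F N \<tau> \<xi>" and ab: "0 \<le> a" "a \<le> b"
    and \<zeta>: "\<zeta> \<in> borel_measurable (F a)"
  shows "(\<integral>\<^sup>+\<omega>. nsq (simple_integral W N \<tau> \<xi> b \<omega> - simple_integral W N \<tau> \<xi> a \<omega> - \<zeta> \<omega> *v (W b \<omega> - W a \<omega>)) \<partial>M)
    \<le> ennreal (m2 TYPE('e)) * (\<integral>\<^sup>+\<omega>. (\<integral>\<^sup>+u\<in>{a<..b}. nsq (simple_process N \<tau> \<xi> u \<omega> - \<zeta> \<omega>) \<partial>lborel) \<partial>M)"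
proof -
  obtain L t c where r: "adapted_coeffs L t c" "t 0 = a" "t L = b"
    "\<And>j u \<omega>. j < L \<Longrightarrow> u \<in> {t j<..t (Suc j)} \<Longrightarrow> simple_process N \<tau> \<xi> u \<omega> = c j \<omega>"
    "\<And>\<omega>. wsum L t c \<omega> = simple_integral W N \<tau> \<xi> b \<omega> - simple_integral W N \<tau> \<xi> a \<omega>"
    using cell_representation[OF si ab] by metis
  let ?c = "\<lambda>j \<omega>. c j \<omega> - \<zeta> \<omega>"
  have ac: "adapted_coeffs L t ?c"
    unfolding adapted_coeffs_def
  proof (intro conjI allI impI)
    fix j assume j: "j < L"
    show "t j \<le> t (Suc j)" using r(1) j unfolding adapted_coeffs_def by blast
    have [measurable]: "\<zeta> \<in> borel_measurable (F (t j))"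
      by (rule measurable_F_mono[OF ab(1) _ \<zeta>]) (use adapted_coeffs_le[OF r(1), of 0 j] j r(2) in simp)
    have [measurable]: "c j \<in> borel_measurable (F (t j))" using r(1) j unfolding adapted_coeffs_def by blast
    show "?c j \<in> borel_measurable (F (t j))" by measurable
  qed (use ab r(2) in simp)
  have "wsum L t ?c \<omega> = simple_integral W N \<tau> \<xi> b \<omega> - simple_integral W N \<tau> \<xi> a \<omega> - \<zeta> \<omega> *v (W b \<omega> - W a \<omega>)" for \<omega>
  proof -
    have "wsum L t ?c \<omega> = wsum L t c \<omega> - (\<Sum>j<L. \<zeta> \<omega> *v (W (t (Suc j)) \<omega> - W (t j) \<omega>))"
      by (simp add: wsum_def matrix_vector_mult_diff_rdistrib sum_subtractf)
    also have "(\<Sum>j<L. \<zeta> \<omega> *v (W (t (Suc j)) \<omega> - W (t j) \<omega>)) = \<zeta> \<omega> *v (\<Sum>j<L. W (t (Suc j)) \<omega> - W (t j) \<omega>)"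
      by (simp add: linear_sum[OF matrix_vector_mul_linear])
    also have "(\<Sum>j<L. W (t (Suc j)) \<omega> - W (t j) \<omega>) = W b \<omega> - W a \<omega>"
      using sum_lessThan_telescope[of "\<lambda>j. W (t j) \<omega>" L] by (simp add: r)
    finally show ?thesis by (simp add: r)
  qed
  moreover have "(\<integral>\<^sup>+u\<in>{a<..b}. nsq (simple_process N \<tau> \<xi> u \<omega> - \<zeta> \<omega>) \<partial>lborel)
      = (\<Sum>j<L. ennreal (t (Suc j) - t j) * nsq (?c j \<omega>))" for \<omega>
    using nn_integral_step[of L t "\<lambda>u. nsq (simple_process N \<tau> \<xi> u \<omega> - \<zeta> \<omega>)" "\<lambda>j. nsq (?c j \<omega>)"]
      r(1,4) unfolding r(2,3) adapted_coeffs_def by simp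
  ultimately show ?thesis using wsum_second_moment[OF ac] by simp
qed

text \<open>Stated with an exceptional set, so that finitely many times \<open>s\<close> can be
  combined by a union while the smallness of the quadratic variation is checked path by
  path.\<close>

lemma simple_integral_Lenglart:
  fixes \<xi> :: "nat \<Rightarrow> 'w \<Rightarrow> real ^ 'e ^ 'd"
  assumes si: "simple_integrand M F N \<tau> \<xi>" and s: "0 \<le> s" and \<delta>: "0 \<le> \<delta>" and a: "0 < a"
  obtains A where "A \<in> sets M" "measure M A \<le> m2 TYPE('e) * \<delta> / a\<^sup>2"
    "\<And>\<omega>. \<omega> \<in> space M - A \<Longrightarrow> (\<integral>\<^sup>+u\<in>{0<..s}. nsq (simple_process N \<tau> \<xi> u \<omega>) \<partial>lborel) \<le> ennreal \<delta> \<Longrightarrow>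
      norm (simple_integral W N \<tau> \<xi> s \<omega>) < a"
proof -
  obtain L t c where r: "adapted_coeffs L t c" "t 0 = 0" "t L = s"
    "\<And>j u \<omega>. j < L \<Longrightarrow> u \<in> {t j<..t (Suc j)} \<Longrightarrow> simple_process N \<tau> \<xi> u \<omega> = c j \<omega>"
    "\<And>\<omega>. wsum L t c \<omega> = simple_integral W N \<tau> \<xi> s \<omega> - simple_integral W N \<tau> \<xi> 0 \<omega>"
    using cell_representation[OF si order_refl s] by metis
  let ?A = "{\<omega>\<in>space M. a \<le> norm (wsum L t c \<omega>) \<and> (\<Sum>j<L. (t (Suc j) - t j) * (norm (c j \<omega>))\<^sup>2) \<le> \<delta>}"
  have "(\<lambda>\<omega>. \<Sum>j<L. (t (Suc j) - t j) * (norm (c j \<omega>))\<^sup>2) \<in> borel_measurable M"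
  proof (intro borel_measurable_sum)
    fix j assume "j \<in> {..<L}"
    then have [measurable]: "c j \<in> borel_measurable M"
      using r(1) by (intro measurable_F_M[OF adapted_coeffs_nonneg[OF r(1), of j]]) (auto simp: adapted_coeffs_def)
    show "(\<lambda>\<omega>. (t (Suc j) - t j) * (norm (c j \<omega>))\<^sup>2) \<in> borel_measurable M" by measurable
  qed
  moreover note measurable_wsum_M[OF r(1), measurable]
  ultimately have A: "?A \<in> sets M" by measurable
  show ?thesis
  proof (rule that[OF A wsum_Lenglart[OF r(1) \<delta> a]])
    fix \<omega> assume \<omega>: "\<omega> \<in> space M - ?A"
      and le: "(\<integral>\<^sup>+u\<in>{0<..s}. nsq (simple_process N \<tau> \<xi> u \<omega>) \<partial>lborel) \<le> ennreal \<delta>"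
    have "(\<integral>\<^sup>+u\<in>{0<..s}. nsq (simple_process N \<tau> \<xi> u \<omega>) \<partial>lborel)
      = (\<Sum>j<L. ennreal (t (Suc j) - t j) * nsq (c j \<omega>))"
      using nn_integral_step[of L t "\<lambda>u. nsq (simple_process N \<tau> \<xi> u \<omega>)" "\<lambda>j. nsq (c j \<omega>)"]
        r(1,4) unfolding r(2,3) adapted_coeffs_def by simp
    also have "\<dots> = ennreal (\<Sum>j<L. (t (Suc j) - t j) * (norm (c j \<omega>))\<^sup>2)"
      using r(1) unfolding adapted_coeffs_def
      by (subst sum_ennreal[symmetric]) (auto simp: ennreal_mult)
    finally have "(\<Sum>j<L. (t (Suc j) - t j) * (norm (c j \<omega>))\<^sup>2) \<le> \<delta>" using le \<delta> by simp
    with \<omega> show "norm (simple_integral W N \<tau> \<xi> s \<omega>) < a"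
      by (auto simp: r(5) simple_integral_0[OF si])
  qed
qed

end

section \<open>Truncation of the integrand\<close>

text \<open>The metric projection onto the ball. It is Lipschitz with constant 1, and the part that
  it removes from \<open>x\<close> is no longer than the distance from \<open>x\<close> to any point
  of the ball; both properties are used.\<close>

definition trunc :: "real \<Rightarrow> 'a::euclidean_space \<Rightarrow> 'a" where
  "trunc K = closest_point (cball 0 K)"

context
  fixes K :: real
  assumes K: "0 \<le> K"
begin

lemma norm_trunc_le: "norm (trunc K x) \<le> K"
  using closest_point_exists(1)[of "cball (0::'a) K" x] K by (auto simp: trunc_def)

lemma trunc_id: "norm x \<le> K \<Longrightarrow> trunc K x = x"
  unfolding trunc_def by (rule closest_point_self) simp

lemma norm_trunc_diff_le: "norm (trunc K x - trunc K y) \<le> norm (x - y)"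
  using closest_point_lipschitz[of "cball (0::'a) K" x y] K by (auto simp: trunc_def dist_norm)

text \<open>Meant for \<open>y\<close> the integrand itself: where that is bounded by
  \<open>K\<close>, the excess of an approximation over \<open>K\<close> is dominated by the error
  of the approximation.\<close>

lemma norm_diff_trunc_le: "norm y \<le> K \<Longrightarrow> norm (x - trunc K x) \<le> norm (x - y)"
  using closest_point_le[of "cball (0::'a) K" y x] by (simp add: trunc_def dist_norm)

lemma continuous_on_trunc: "continuous_on S (trunc K :: 'a::euclidean_space \<Rightarrow> 'a)"
  unfolding trunc_def by (rule continuous_on_closest_point) (use K in auto)

lemma borel_measurable_trunc [measurable]: "trunc K \<in> borel_measurable borel"
  by (rule borel_measurable_continuous_onI[OF continuous_on_trunc])

end

lemma norm_diff_sq_le: "(norm (x - y))\<^sup>2 \<le> 2 * (norm (x - z))\<^sup>2 + 2 * (norm (z - y))\<^sup>2"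
  for x y z :: "'a::real_normed_vector"
proof -
  have "(norm (x - y))\<^sup>2 \<le> (norm (x - z) + norm (z - y))\<^sup>2"
    using norm_triangle_ineq[of "x - z" "z - y"] by (intro power_mono) auto
  also have "\<dots> \<le> 2 * (norm (x - z))\<^sup>2 + 2 * (norm (z - y))\<^sup>2"
    using sum_squares_bound[of "norm (x - z)" "norm (z - y)"] by (simp add: power2_sum)
  finally show ?thesis .
qed

context brownian
begin

lemma simple_integrand_measurable:
  assumes si: "simple_integrand M F N \<tau> \<xi>" and i: "i < N"
  shows "\<xi> i \<in> borel_measurable M"
proof -
  have "0 \<le> \<tau> i"
    using simple_times_mono[OF si, of 0 i] si i unfolding simple_integrand_def by auto
  then show ?thesis using si i unfolding simple_integrand_def by (auto intro: measurable_F_M)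
qed

lemma simple_process_joint:
  assumes si: "simple_integrand M F N \<tau> \<xi>"
  shows "(\<lambda>p. simple_process N \<tau> \<xi> (snd p) (fst p)) \<in> borel_measurable (M \<Otimes>\<^sub>M lborel)"
  unfolding simple_process_def
proof (rule borel_measurable_sum)
  fix i assume "i \<in> {..<N}"
  then have [measurable]: "\<xi> i \<in> borel_measurable M" using simple_integrand_measurable[OF si] by auto
  show "(\<lambda>p. indicator {\<tau> i<..\<tau> (Suc i)} (snd p) *\<^sub>R \<xi> i (fst p)) \<in> borel_measurable (M \<Otimes>\<^sub>M lborel)"
    by measurable
qed

lemma simple_integrand_comp:
  fixes \<xi> :: "nat \<Rightarrow> 'w \<Rightarrow> real ^ 'e ^ 'd" and \<phi> :: "real ^ 'e ^ 'd \<Rightarrow> real ^ 'e ^ 'd"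
  assumes si: "simple_integrand M F N \<tau> \<xi>" and \<phi>: "continuous_on UNIV \<phi>"
  shows "simple_integrand M F N \<tau> (\<lambda>i \<omega>. \<phi> (\<xi> i \<omega>))"
  unfolding simple_integrand_def
proof (intro conjI allI impI)
  fix i assume i: "i < N"
  then have m: "\<xi> i \<in> borel_measurable (F (\<tau> i))" and b: "bounded (\<xi> i ` space M)"
    using si unfolding simple_integrand_def by auto
  show "(\<lambda>\<omega>. \<phi> (\<xi> i \<omega>)) \<in> borel_measurable (F (\<tau> i))"
    by (rule measurable_compose[OF m borel_measurable_continuous_onI[OF \<phi>]])
  have "compact (closure (\<xi> i ` space M))" using b by simp
  then have "bounded (\<phi> ` closure (\<xi> i ` space M))"
    by (intro compact_imp_bounded compact_continuous_image continuous_on_subset[OF \<phi>]) auto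
  then show "bounded ((\<lambda>\<omega>. \<phi> (\<xi> i \<omega>)) ` space M)"
    by (rule bounded_subset) (use closure_subset in fastforce)
qed (use si in \<open>auto simp: simple_integrand_def\<close>)

text \<open>Truncating the coefficients of a good approximation keeps it good. The removed part is
  dominated by the error of the approximation as long as \<open>H\<close> stays below
  \<open>K\<close>, so off \<open>B\<close> its quadratic variation is small, and the Lenglart bound
  makes its integral small at each of the finitely many times in \<open>D\<close>. The last
  conclusion holds in mean on the whole space: both truncated processes are bounded, so convergence
  in probability implies it.\<close>

lemma truncated_approximation:
  fixes H :: "real \<Rightarrow> 'w \<Rightarrow> real ^ 'e ^ 'd"
  assumes ito: "is_ito_integral M F W H I" and K: "0 \<le> K" and R: "0 \<le> R"
    and B: "\<And>\<omega> u. \<omega> \<in> space M - B \<Longrightarrow> 0 < u \<Longrightarrow> u \<le> R \<Longrightarrow> norm (H u \<omega>) \<le> K"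
    and D: "finite D" "D \<subseteq> {0..R}" and e: "0 < \<epsilon>"
  obtains N \<tau> \<xi> A where "simple_integrand M F N \<tau> \<xi>" "\<And>i \<omega>. norm (\<xi> i \<omega>) \<le> K"
    "A \<in> sets M" "measure M A \<le> \<epsilon>"
    "\<And>\<omega> s. \<omega> \<in> space M - A - B \<Longrightarrow> s \<in> D \<Longrightarrow> norm (simple_integral W N \<tau> \<xi> s \<omega> - I s \<omega>) \<le> \<epsilon>"
    "(\<integral>\<^sup>+\<omega>. (\<integral>\<^sup>+u\<in>{0<..R}. nsq (simple_process N \<tau> \<xi> u \<omega> - trunc K (H u \<omega>)) \<partial>lborel) \<partial>M) \<le> ennreal \<epsilon>"
proof -
  obtain N \<tau> \<xi> where si: "\<And>k. simple_integrand M F (N k) (\<tau> k) (\<xi> k)"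
    and L2: "\<And>t. 0 \<le> t \<Longrightarrow> tends_to_zero_in_prob M (\<lambda>k \<omega>. \<integral>\<^sup>+u\<in>{0..t}.
              nsq (simple_process (N k) (\<tau> k) (\<xi> k) u \<omega> - H u \<omega>) \<partial>lborel)"
    and ucp: "ucp_tendsto M (\<lambda>k. simple_integral W (N k) (\<tau> k) (\<xi> k)) I"
    using ito unfolding is_ito_integral_def by blast
  define Z where "Z k \<omega> = (\<integral>\<^sup>+u\<in>{0..R}. nsq (simple_process (N k) (\<tau> k) (\<xi> k) u \<omega> - H u \<omega>) \<partial>lborel)" for k \<omega>
  define V where "V k \<omega> = (SUP s\<in>{0..R}. ennreal (norm (simple_integral W (N k) (\<tau> k) (\<xi> k) s \<omega> - I s \<omega>)))" for k \<omega>
  have Z: "tends_to_zero_in_prob M Z" using L2[OF R] unfolding Z_def[abs_def] .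
  have V: "tends_to_zero_in_prob M V" using ucp R unfolding ucp_tendsto_def V_def[abs_def] by blast
  have [measurable]: "Z k \<in> borel_measurable M" "V k \<in> borel_measurable M" for k
    using Z V unfolding tends_to_zero_in_prob_def by auto
  \<comment> \<open>The Lenglart bound at level \<open>\<epsilon>/2\<close> is proportional to
    \<open>\<delta> / (\<epsilon>/2)^2\<close> with factor \<open>m2\<close>; summed over
    \<open>D\<close> it stays below \<open>\<epsilon>/4\<close>. The summands 1 avoid division by
    zero.\<close>
  define \<delta> where "\<delta> = \<epsilon> * (\<epsilon>/2)\<^sup>2 / (4 * (m2 TYPE('e) + 1) * (card D + 1))"
  have m2: "0 \<le> m2 TYPE('e)" by (rule m2_nonneg)
  have \<delta>: "0 < \<delta>" using e m2 by (simp add: \<delta>_def add_nonneg_pos)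
  \<comment> \<open>The truncated processes differ by at most \<open>2 * K\<close>, so the integral
    of their squared distance over \<open>(0, R]\<close> is at most \<open>4 * K^2 * R\<close>; on
    an event of probability \<theta> this contributes at most \<open>\<epsilon>/2\<close> to the
    mean.\<close>
  define \<theta> where "\<theta> = \<epsilon> / (2 * (4 * K\<^sup>2 * R + 1))"
  have \<theta>: "0 < \<theta>" using e R K by (simp add: \<theta>_def add_nonneg_pos)
  have e4: "0 < \<epsilon>/4" "0 < \<epsilon>/2" using e by auto
  have "\<forall>\<^sub>F k in sequentially. measure M {\<omega>\<in>space M. Z k \<omega> > ennreal \<delta>} \<le> \<epsilon>/4 \<and>
      measure M {\<omega>\<in>space M. V k \<omega> > ennreal (\<epsilon>/2)} \<le> \<epsilon>/4 \<and>
      measure M {\<omega>\<in>space M. Z k \<omega> > ennreal (\<epsilon>/2)} \<le> \<theta>"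
    using tends_to_zero_in_probD[OF Z \<delta> e4(1)] tends_to_zero_in_probD[OF V e4(2,1)]
      tends_to_zero_in_probD[OF Z e4(2) \<theta>] by eventually_elim blast
  then obtain k where k: "measure M {\<omega>\<in>space M. Z k \<omega> > ennreal \<delta>} \<le> \<epsilon>/4"
      "measure M {\<omega>\<in>space M. V k \<omega> > ennreal (\<epsilon>/2)} \<le> \<epsilon>/4"
      "measure M {\<omega>\<in>space M. Z k \<omega> > ennreal (\<epsilon>/2)} \<le> \<theta>"
    unfolding eventually_sequentially by blast
  let ?\<xi> = "\<lambda>i \<omega>. trunc K (\<xi> k i \<omega>)" and ?\<eta> = "\<lambda>i \<omega>. \<xi> k i \<omega> - trunc K (\<xi> k i \<omega>)"
  have t0: "trunc K 0 = (0 :: real ^ 'e ^ 'd)" using K by (intro trunc_id) auto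
  have si1: "simple_integrand M F (N k) (\<tau> k) ?\<xi>"
    by (rule simple_integrand_comp[OF si continuous_on_trunc[OF K]])
  have si2: "simple_integrand M F (N k) (\<tau> k) ?\<eta>"
    by (rule simple_integrand_comp[OF si, where \<phi> = "\<lambda>x. x - trunc K x"])
      (intro continuous_intros continuous_on_trunc[OF K])
  have sp1: "simple_process (N k) (\<tau> k) ?\<xi> u \<omega> = trunc K (simple_process (N k) (\<tau> k) (\<xi> k) u \<omega>)" for u \<omega>
    by (rule simple_process_map[OF si, where \<phi> = "trunc K"]) (rule t0)
  have sp2: "simple_process (N k) (\<tau> k) ?\<eta> u \<omega>
      = simple_process (N k) (\<tau> k) (\<xi> k) u \<omega> - trunc K (simple_process (N k) (\<tau> k) (\<xi> k) u \<omega>)" for u \<omega>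
    by (rule simple_process_map[OF si, where \<phi> = "\<lambda>x. x - trunc K x"]) (simp add: t0)
  have J: "simple_integral W (N k) (\<tau> k) (\<xi> k) s \<omega>
      = simple_integral W (N k) (\<tau> k) ?\<xi> s \<omega> + simple_integral W (N k) (\<tau> k) ?\<eta> s \<omega>" for s \<omega>
    unfolding simple_integral_def by (simp add: matrix_vector_mult_diff_rdistrib flip: sum.distrib)
  have "\<forall>s\<in>D. \<exists>A. A \<in> sets M \<and> measure M A \<le> m2 TYPE('e) * \<delta> / (\<epsilon>/2)\<^sup>2 \<and>
      (\<forall>\<omega>\<in>space M - A. (\<integral>\<^sup>+u\<in>{0<..s}. nsq (simple_process (N k) (\<tau> k) ?\<eta> u \<omega>) \<partial>lborel) \<le> ennreal \<delta> \<longrightarrow>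
      norm (simple_integral W (N k) (\<tau> k) ?\<eta> s \<omega>) < \<epsilon>/2)" (is "\<forall>s\<in>D. \<exists>A. ?P s A")
  proof
    fix s assume s: "s \<in> D"
    then have s0: "0 \<le> s" using D by auto
    show "\<exists>A. ?P s A"
    proof (rule simple_integral_Lenglart[OF si2 s0 less_imp_le[OF \<delta>] e4(2)])
      fix A
      assume "A \<in> sets M" "measure M A \<le> m2 TYPE('e) * \<delta> / (\<epsilon>/2)\<^sup>2"
        and "\<And>\<omega>. \<omega> \<in> space M - A \<Longrightarrow>
          (\<integral>\<^sup>+u\<in>{0<..s}. nsq (simple_process (N k) (\<tau> k) ?\<eta> u \<omega>) \<partial>lborel) \<le> ennreal \<delta> \<Longrightarrow>
          norm (simple_integral W (N k) (\<tau> k) ?\<eta> s \<omega>) < \<epsilon>/2"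
      then show ?thesis by (intro exI[of _ A] conjI ballI impI)
    qed
  qed
  from bchoice[OF this] obtain A3 where A3': "\<forall>s\<in>D. ?P s (A3 s)" by blast
  have A3: "\<And>s. s \<in> D \<Longrightarrow> A3 s \<in> sets M"
     "\<And>s. s \<in> D \<Longrightarrow> measure M (A3 s) \<le> m2 TYPE('e) * \<delta> / (\<epsilon>/2)\<^sup>2"
     "\<And>s \<omega>. s \<in> D \<Longrightarrow> \<omega> \<in> space M - A3 s \<Longrightarrow>
      (\<integral>\<^sup>+u\<in>{0<..s}. nsq (simple_process (N k) (\<tau> k) ?\<eta> u \<omega>) \<partial>lborel) \<le> ennreal \<delta> \<Longrightarrow>
      norm (simple_integral W (N k) (\<tau> k) ?\<eta> s \<omega>) < \<epsilon>/2"
    using bspec[OF A3'] by (simp_all only:)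
  define A where "A = {\<omega>\<in>space M. Z k \<omega> > ennreal \<delta>} \<union> {\<omega>\<in>space M. V k \<omega> > ennreal (\<epsilon>/2)} \<union> (\<Union>s\<in>D. A3 s)"
  have A_sets: "A \<in> sets M" unfolding A_def by (intro sets.Un sets.finite_UN D A3) measurable
  have "measure M (\<Union>s\<in>D. A3 s) \<le> (\<Sum>s\<in>D. measure M (A3 s))"
    by (rule measure_UNION_le) (use D A3 in auto)
  also have "\<dots> \<le> (\<Sum>s\<in>D. m2 TYPE('e) * \<delta> / (\<epsilon>/2)\<^sup>2)" by (intro sum_mono A3)
  also have "\<dots> = card D * (m2 TYPE('e) * \<delta> / (\<epsilon>/2)\<^sup>2)" by simp
  also have "\<dots> = card D * (m2 TYPE('e) * (\<delta> / (\<epsilon>/2)\<^sup>2))" by simp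
  also have "\<delta> / (\<epsilon>/2)\<^sup>2 = \<epsilon> / (4 * (m2 TYPE('e) + 1) * (card D + 1))"
    using e by (simp add: \<delta>_def)
  also have "card D * (m2 TYPE('e) * (\<epsilon> / (4 * (m2 TYPE('e) + 1) * (card D + 1))))
      = (\<epsilon>/4) * (card D / (card D + 1)) * (m2 TYPE('e) / (m2 TYPE('e) + 1))"
    by (simp add: algebra_simps)
  also have "\<dots> \<le> (\<epsilon>/4) * 1 * 1"
    using e m2 by (intro mult_mono) auto
  finally have m3: "measure M (\<Union>s\<in>D. A3 s) \<le> \<epsilon>/4" by simp
  have mA: "measure M A \<le> \<epsilon>"
  proof -
    have "measure M A \<le> measure M ({\<omega>\<in>space M. Z k \<omega> > ennreal \<delta>} \<union> {\<omega>\<in>space M. V k \<omega> > ennreal (\<epsilon>/2)}) + measure M (\<Union>s\<in>D. A3 s)"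
      unfolding A_def by (rule measure_Un_le) (use D A3 in auto)
    also have "measure M ({\<omega>\<in>space M. Z k \<omega> > ennreal \<delta>} \<union> {\<omega>\<in>space M. V k \<omega> > ennreal (\<epsilon>/2)})
        \<le> measure M {\<omega>\<in>space M. Z k \<omega> > ennreal \<delta>} + measure M {\<omega>\<in>space M. V k \<omega> > ennreal (\<epsilon>/2)}"
      by (rule measure_Un_le) auto
    finally show ?thesis using k m3 e by linarith
  qed
  have close: "norm (simple_integral W (N k) (\<tau> k) ?\<xi> s \<omega> - I s \<omega>) \<le> \<epsilon>"
    if \<omega>: "\<omega> \<in> space M - A - B" and s: "s \<in> D" for \<omega> s
  proof -
    have sR: "0 \<le> s" "s \<le> R" using s D by auto
    have "(\<integral>\<^sup>+u\<in>{0<..s}. nsq (simple_process (N k) (\<tau> k) ?\<eta> u \<omega>) \<partial>lborel) \<le> Z k \<omega>"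
      unfolding Z_def
    proof (intro nn_integral_mono)
      fix u
      show "nsq (simple_process (N k) (\<tau> k) ?\<eta> u \<omega>) * indicator {0<..s} u
        \<le> nsq (simple_process (N k) (\<tau> k) (\<xi> k) u \<omega> - H u \<omega>) * indicator {0..R} u"
      proof (cases "u \<in> {0<..s}")
        case True
        then have "norm (H u \<omega>) \<le> K" using B[of \<omega> u] \<omega> sR by auto
        then show ?thesis using True sR unfolding sp2
          by (auto intro!: ennreal_leI power_mono norm_diff_trunc_le[OF K])
      qed simp
    qed
    also have "Z k \<omega> \<le> ennreal \<delta>" using \<omega> by (auto simp: A_def)
    finally have 1: "norm (simple_integral W (N k) (\<tau> k) ?\<eta> s \<omega>) < \<epsilon>/2"
      using A3(3)[OF s, of \<omega>] \<omega> s by (auto simp: A_def)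
    have "ennreal (norm (simple_integral W (N k) (\<tau> k) (\<xi> k) s \<omega> - I s \<omega>)) \<le> V k \<omega>"
      unfolding V_def by (rule SUP_upper) (use sR in auto)
    also have "V k \<omega> \<le> ennreal (\<epsilon>/2)" using \<omega> by (auto simp: A_def)
    finally have 2: "norm (simple_integral W (N k) (\<tau> k) (\<xi> k) s \<omega> - I s \<omega>) \<le> \<epsilon>/2" using e by simp
    have eq: "simple_integral W (N k) (\<tau> k) ?\<xi> s \<omega> - I s \<omega>
      = (simple_integral W (N k) (\<tau> k) (\<xi> k) s \<omega> - I s \<omega>) - simple_integral W (N k) (\<tau> k) ?\<eta> s \<omega>"
      unfolding J by simp
    show ?thesis
      unfolding eq using norm_triangle_ineq4[of "simple_integral W (N k) (\<tau> k) (\<xi> k) s \<omega> - I s \<omega>" "simple_integral W (N k) (\<tau> k) ?\<eta> s \<omega>"] 1 2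
      by linarith
  qed
  have mean: "(\<integral>\<^sup>+\<omega>. (\<integral>\<^sup>+u\<in>{0<..R}. nsq (simple_process (N k) (\<tau> k) ?\<xi> u \<omega> - trunc K (H u \<omega>)) \<partial>lborel) \<partial>M) \<le> ennreal \<epsilon>"
  proof -
    let ?A = "{\<omega>\<in>space M. Z k \<omega> > ennreal (\<epsilon>/2)}"
    have "(\<integral>\<^sup>+\<omega>. (\<integral>\<^sup>+u\<in>{0<..R}. nsq (simple_process (N k) (\<tau> k) ?\<xi> u \<omega> - trunc K (H u \<omega>)) \<partial>lborel) \<partial>M)
        \<le> (\<integral>\<^sup>+\<omega>. ennreal (\<epsilon>/2) + ennreal (4 * K\<^sup>2 * R) * indicator ?A \<omega> \<partial>M)"
    proof (rule nn_integral_mono)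
      fix \<omega> assume \<omega>: "\<omega> \<in> space M"
      show "(\<integral>\<^sup>+u\<in>{0<..R}. nsq (simple_process (N k) (\<tau> k) ?\<xi> u \<omega> - trunc K (H u \<omega>)) \<partial>lborel)
          \<le> ennreal (\<epsilon>/2) + ennreal (4 * K\<^sup>2 * R) * indicator ?A \<omega>"
      proof (cases "\<omega> \<in> ?A")
        case True
        have "(\<integral>\<^sup>+u\<in>{0<..R}. nsq (simple_process (N k) (\<tau> k) ?\<xi> u \<omega> - trunc K (H u \<omega>)) \<partial>lborel)
            \<le> (\<integral>\<^sup>+u\<in>{0<..R}. ennreal (4 * K\<^sup>2) \<partial>lborel)"
        proof (intro nn_integral_mono mult_right_mono ennreal_leI)
          fix u
          have "norm (simple_process (N k) (\<tau> k) ?\<xi> u \<omega> - trunc K (H u \<omega>)) \<le> K + K"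
            unfolding sp1 by (intro order_trans[OF norm_triangle_ineq4] add_mono norm_trunc_le K)
          then have "(norm (simple_process (N k) (\<tau> k) ?\<xi> u \<omega> - trunc K (H u \<omega>)))\<^sup>2 \<le> (K + K)\<^sup>2"
            by (intro power_mono) auto
          then show "(norm (simple_process (N k) (\<tau> k) ?\<xi> u \<omega> - trunc K (H u \<omega>)))\<^sup>2 \<le> 4 * K\<^sup>2"
            by (simp add: power2_eq_square)
        qed simp
        also have "\<dots> = ennreal (4 * K\<^sup>2 * R)"
          using R by (simp add: nn_integral_cmult_indicator ennreal_mult)
        finally show ?thesis using True by (simp add: add_increasing)
      next
        case False
        have "(\<integral>\<^sup>+u\<in>{0<..R}. nsq (simple_process (N k) (\<tau> k) ?\<xi> u \<omega> - trunc K (H u \<omega>)) \<partial>lborel) \<le> Z k \<omega>"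
          unfolding Z_def sp1
          by (intro nn_integral_mono mult_mono ennreal_leI power_mono norm_trunc_diff_le K)
            (auto split: split_indicator)
        also have "\<dots> \<le> ennreal (\<epsilon>/2)" using False \<omega> by auto
        finally show ?thesis by (simp add: add_increasing2)
      qed
    qed
    also have "\<dots> = ennreal (\<epsilon>/2) + ennreal (4 * K\<^sup>2 * R) * emeasure M ?A"
      by (subst nn_integral_add) (auto simp: nn_integral_cmult_indicator emeasure_space_1)
    also have "\<dots> = ennreal (\<epsilon>/2 + 4 * K\<^sup>2 * R * measure M ?A)"
      using e R by (simp add: emeasure_eq_measure ennreal_mult)
    also have "\<dots> \<le> ennreal \<epsilon>"
    proof (rule ennreal_leI)
      have "4 * K\<^sup>2 * R * measure M ?A \<le> 4 * K\<^sup>2 * R * \<theta>" using k(3) R by (intro mult_left_mono) auto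
      also have "\<dots> \<le> (4 * K\<^sup>2 * R + 1) * \<theta>" using \<theta> by (intro mult_right_mono) auto
      also have "\<dots> = \<epsilon>/2"
      proof -
        have "0 < 4 * K\<^sup>2 * R + 1" using R by (simp add: add_nonneg_pos)
        then show ?thesis unfolding \<theta>_def by (simp add: field_simps)
      qed
      finally show "\<epsilon>/2 + 4 * K\<^sup>2 * R * measure M ?A \<le> \<epsilon>" by simp
    qed
    finally show ?thesis .
  qed
  show ?thesis
    by (rule that[OF si1 norm_trunc_le[OF K] A_sets mA close mean])
qed

lemma grid_second_moment:
  fixes \<xi> :: "nat \<Rightarrow> 'w \<Rightarrow> real ^ 'e ^ 'd" and \<zeta> :: "nat \<Rightarrow> 'w \<Rightarrow> real ^ 'e ^ 'd"
  assumes si: "simple_integrand M F N \<tau> \<xi>" and n: "n \<ge> 1"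
    and \<zeta>: "\<And>i. \<zeta> i \<in> borel_measurable (F (real i / real n))"
    and G: "(\<lambda>p. G (snd p) (fst p)) \<in> borel_measurable (M \<Otimes>\<^sub>M lborel)"
  shows "(\<Sum>i<m. \<integral>\<^sup>+\<omega>. nsq (simple_integral W N \<tau> \<xi> (real (Suc i) / real n) \<omega> - simple_integral W N \<tau> \<xi> (real i / real n) \<omega>
      - \<zeta> i \<omega> *v (W (real (Suc i) / real n) \<omega> - W (real i / real n) \<omega>)) \<partial>M)
    \<le> ennreal (2 * m2 TYPE('e)) * ((\<integral>\<^sup>+\<omega>. (\<integral>\<^sup>+u\<in>{0<..real m / real n}. nsq (simple_process N \<tau> \<xi> u \<omega> - G u \<omega>) \<partial>lborel) \<partial>M)
      + (\<integral>\<^sup>+\<omega>. (\<integral>\<^sup>+u\<in>{0<..real m / real n}. nsq (G u \<omega> - \<zeta> (grid_floor n u) \<omega>) \<partial>lborel) \<partial>M))"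
proof -
  let ?t = "\<lambda>i. real i / real n"
  have tle: "?t i \<le> ?t (Suc i)" for i by (intro divide_right_mono) auto
  have [measurable]: "\<zeta> i \<in> borel_measurable M" for i
    by (rule measurable_F_M[OF _ \<zeta>]) simp
  note simple_process_joint[OF si, measurable] G[measurable]
  have [measurable]: "(\<lambda>p. \<zeta> (grid_floor n (snd p)) (fst p)) \<in> borel_measurable (M \<Otimes>\<^sub>M lborel)"
    by (rule measurable_compose_countable[where f = "\<lambda>i p. \<zeta> i (fst p)"]) measurable
  have sec: "(\<lambda>u. G u \<omega>) \<in> borel_measurable lborel" "(\<lambda>u. \<zeta> (grid_floor n u) \<omega>) \<in> borel_measurable lborel"
    if "\<omega> \<in> space M" for \<omega>
    using measurable_compose[OF measurable_Pair1' G, of \<omega>] that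
      measurable_compose[OF measurable_Pair1' \<open>(\<lambda>p. \<zeta> (grid_floor n (snd p)) (fst p)) \<in> borel_measurable (M \<Otimes>\<^sub>M lborel)\<close>, of \<omega>]
    by auto
  have inner: "(\<lambda>\<omega>. \<integral>\<^sup>+u\<in>{a<..b}. nsq (simple_process N \<tau> \<xi> u \<omega> - \<zeta> i \<omega>) \<partial>lborel) \<in> borel_measurable M" for a b i
    by (rule lborel.borel_measurable_nn_integral) (unfold split_beta, measurable)
  have inner1: "(\<lambda>\<omega>. \<integral>\<^sup>+u\<in>{a<..b}. nsq (simple_process N \<tau> \<xi> u \<omega> - G u \<omega>) \<partial>lborel) \<in> borel_measurable M" for a b
    by (rule lborel.borel_measurable_nn_integral) (unfold split_beta, measurable)
  have inner2: "(\<lambda>\<omega>. \<integral>\<^sup>+u\<in>{a<..b}. nsq (G u \<omega> - \<zeta> (grid_floor n u) \<omega>) \<partial>lborel) \<in> borel_measurable M" for a b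
    by (rule lborel.borel_measurable_nn_integral) (unfold split_beta, measurable)
  have "(\<Sum>i<m. \<integral>\<^sup>+\<omega>. nsq (simple_integral W N \<tau> \<xi> (?t (Suc i)) \<omega> - simple_integral W N \<tau> \<xi> (?t i) \<omega>
      - \<zeta> i \<omega> *v (W (?t (Suc i)) \<omega> - W (?t i) \<omega>)) \<partial>M)
    \<le> (\<Sum>i<m. ennreal (m2 TYPE('e)) * (\<integral>\<^sup>+\<omega>. (\<integral>\<^sup>+u\<in>{?t i<..?t (Suc i)}. nsq (simple_process N \<tau> \<xi> u \<omega> - \<zeta> i \<omega>) \<partial>lborel) \<partial>M))"
    by (intro sum_mono simple_integral_second_moment[OF si _ tle \<zeta>]) simp
  also have "\<dots> = ennreal (m2 TYPE('e)) * (\<integral>\<^sup>+\<omega>. (\<Sum>i<m. \<integral>\<^sup>+u\<in>{?t i<..?t (Suc i)}. nsq (simple_process N \<tau> \<xi> u \<omega> - \<zeta> i \<omega>) \<partial>lborel) \<partial>M)"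
    by (simp add: nn_integral_sum[OF inner] sum_distrib_left)
  also have "\<dots> \<le> ennreal (m2 TYPE('e)) * (\<integral>\<^sup>+\<omega>. ennreal 2 * ((\<integral>\<^sup>+u\<in>{0<..?t m}. nsq (simple_process N \<tau> \<xi> u \<omega> - G u \<omega>) \<partial>lborel)
      + (\<integral>\<^sup>+u\<in>{0<..?t m}. nsq (G u \<omega> - \<zeta> (grid_floor n u) \<omega>) \<partial>lborel)) \<partial>M)"
  proof (intro mult_left_mono nn_integral_mono)
    fix \<omega> assume \<omega>: "\<omega> \<in> space M"
    note sec[OF \<omega>, measurable]
    have "(\<Sum>i<m. \<integral>\<^sup>+u\<in>{?t i<..?t (Suc i)}. nsq (simple_process N \<tau> \<xi> u \<omega> - \<zeta> i \<omega>) \<partial>lborel)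
      = (\<Sum>i<m. \<integral>\<^sup>+u\<in>{?t i<..?t (Suc i)}. nsq (simple_process N \<tau> \<xi> u \<omega> - \<zeta> (grid_floor n u) \<omega>) \<partial>lborel)"
    proof (intro sum.cong refl nn_integral_cong)
      fix i u
      show "nsq (simple_process N \<tau> \<xi> u \<omega> - \<zeta> i \<omega>) * indicator {?t i<..?t (Suc i)} u
        = nsq (simple_process N \<tau> \<xi> u \<omega> - \<zeta> (grid_floor n u) \<omega>) * indicator {?t i<..?t (Suc i)} u"
        using grid_floor_eq[OF n, of u i] by (cases "u \<in> {?t i<..?t (Suc i)}") (simp_all del: greaterThanAtMost_iff)
    qed
    also have "\<dots> = (\<integral>\<^sup>+u\<in>{?t 0<..?t m}. nsq (simple_process N \<tau> \<xi> u \<omega> - \<zeta> (grid_floor n u) \<omega>) \<partial>lborel)"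
      by (rule conjunct2[OF nn_integral_interval_sum, symmetric]) (rule tle, measurable)
    also have "?t 0 = 0" by simp
    also have "(\<integral>\<^sup>+u\<in>{0<..?t m}. nsq (simple_process N \<tau> \<xi> u \<omega> - \<zeta> (grid_floor n u) \<omega>) \<partial>lborel)
      \<le> (\<integral>\<^sup>+u. ennreal 2 * (nsq (simple_process N \<tau> \<xi> u \<omega> - G u \<omega>) * indicator {0<..?t m} u
          + nsq (G u \<omega> - \<zeta> (grid_floor n u) \<omega>) * indicator {0<..?t m} u) \<partial>lborel)"
    proof (rule nn_integral_mono)
      fix u
      have "nsq (simple_process N \<tau> \<xi> u \<omega> - \<zeta> (grid_floor n u) \<omega>)
          \<le> ennreal (2 * (norm (simple_process N \<tau> \<xi> u \<omega> - G u \<omega>))\<^sup>2 + 2 * (norm (G u \<omega> - \<zeta> (grid_floor n u) \<omega>))\<^sup>2)"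
        by (intro ennreal_leI norm_diff_sq_le)
      also have "\<dots> = ennreal 2 * (nsq (simple_process N \<tau> \<xi> u \<omega> - G u \<omega>) + nsq (G u \<omega> - \<zeta> (grid_floor n u) \<omega>))"
        by (simp only: ennreal_plus ennreal_mult distrib_left zero_le_power2 zero_le_numeral mult_nonneg_nonneg)
      finally show "nsq (simple_process N \<tau> \<xi> u \<omega> - \<zeta> (grid_floor n u) \<omega>) * indicator {0<..?t m} u
        \<le> ennreal 2 * (nsq (simple_process N \<tau> \<xi> u \<omega> - G u \<omega>) * indicator {0<..?t m} u
          + nsq (G u \<omega> - \<zeta> (grid_floor n u) \<omega>) * indicator {0<..?t m} u)"
        by (cases "u \<in> {0<..?t m}") (simp_all del: greaterThanAtMost_iff)
    qed
    also have "\<dots> = ennreal 2 * ((\<integral>\<^sup>+u\<in>{0<..?t m}. nsq (simple_process N \<tau> \<xi> u \<omega> - G u \<omega>) \<partial>lborel)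
      + (\<integral>\<^sup>+u\<in>{0<..?t m}. nsq (G u \<omega> - \<zeta> (grid_floor n u) \<omega>) \<partial>lborel))"
      by (subst nn_integral_cmult, measurable, subst nn_integral_add, measurable)
    finally show "(\<Sum>i<m. \<integral>\<^sup>+u\<in>{?t i<..?t (Suc i)}. nsq (simple_process N \<tau> \<xi> u \<omega> - \<zeta> i \<omega>) \<partial>lborel)
      \<le> ennreal 2 * ((\<integral>\<^sup>+u\<in>{0<..?t m}. nsq (simple_process N \<tau> \<xi> u \<omega> - G u \<omega>) \<partial>lborel)
      + (\<integral>\<^sup>+u\<in>{0<..?t m}. nsq (G u \<omega> - \<zeta> (grid_floor n u) \<omega>) \<partial>lborel))" .
  qed simp
  also have "\<dots> = ennreal (2 * m2 TYPE('e)) * ((\<integral>\<^sup>+\<omega>. (\<integral>\<^sup>+u\<in>{0<..?t m}. nsq (simple_process N \<tau> \<xi> u \<omega> - G u \<omega>) \<partial>lborel) \<partial>M)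
      + (\<integral>\<^sup>+\<omega>. (\<integral>\<^sup>+u\<in>{0<..?t m}. nsq (G u \<omega> - \<zeta> (grid_floor n u) \<omega>) \<partial>lborel) \<partial>M))"
    using m2_nonneg[where 'n='e]
    by (simp only: nn_integral_add[OF inner1 inner2] nn_integral_cmult[OF borel_measurable_add[OF inner1 inner2]]
        mult.commute[of 2 "m2 TYPE('e)"] ennreal_mult zero_le_numeral mult.assoc)
  finally show ?thesis .
qed

end

section \<open>Growth bounds, Gaussian means and a maximal inequality\<close>

text \<open>Powers of \<open>1 + norm x\<close> increase with the exponent, unlike powers of
  \<open>norm x\<close> near 0; this allows rounding \<open>p\<close> up to a natural
  number.\<close>

lemma poly_growth_nat:
  fixes f :: "'a::real_normed_vector \<Rightarrow> real"
  assumes "poly_growth f"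
  obtains C m where "0 < C" "\<And>x. \<bar>f x\<bar> \<le> C * (1 + norm x) ^ m"
proof -
  obtain C p where C: "0 < C" "2 \<le> p" "\<And>x. norm (f x) \<le> C * (1 + norm x powr p)"
    using assms unfolding poly_growth_def by blast
  let ?m = "nat \<lceil>p\<rceil>"
  have "\<bar>f x\<bar> \<le> (2 * C) * (1 + norm x) ^ ?m" for x
  proof -
    have "norm x powr p \<le> (1 + norm x) powr p" using C by (intro powr_mono2) auto
    also have "\<dots> \<le> (1 + norm x) powr (real ?m)" by (intro powr_mono real_nat_ceiling_ge) simp
    also have "\<dots> = (1 + norm x) ^ ?m" by (rule powr_realpow) (simp add: add_pos_nonneg)
    finally have "norm x powr p \<le> (1 + norm x) ^ ?m" .
    moreover have "1 \<le> (1 + norm x) ^ ?m" by (rule one_le_power) simp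
    ultimately have "1 + norm x powr p \<le> 2 * (1 + norm x) ^ ?m" by linarith
    then have "C * (1 + norm x powr p) \<le> C * (2 * (1 + norm x) ^ ?m)"
      using C by (intro mult_left_mono) auto
    with C(3)[of x] show ?thesis by simp
  qed
  with C(1) that[of "2 * C" ?m] show ?thesis by simp
qed

text \<open>With \<open>r\<close> the norm of the pair, \<open>r / 2\<close> is at most the larger
  of the two component norms, so \<open>exp (r / 2)\<close> is below the sum of the two weights, and
  any polynomial in \<open>r\<close> is negligible against it.\<close>

lemma product_growth:
  fixes g :: "'a::euclidean_space \<Rightarrow> real" and h :: "'b::euclidean_space \<Rightarrow> real"
  assumes g: "\<And>x. \<bar>g x\<bar> \<le> C1 * (1 + norm x) ^ k1" and h: "\<And>x. \<bar>h x\<bar> \<le> C2 * (1 + norm x) ^ k2"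
    and C: "0 \<le> C1" "0 \<le> C2" and e: "0 < \<epsilon>"
  shows "\<exists>R. \<forall>x. R \<le> norm x \<longrightarrow> \<bar>g (fst x) * h (snd x)\<bar> \<le> \<epsilon> * (expo (fst x) + expo (snd x))"
proof -
  let ?m = "k1 + k2"
  \<comment> \<open>The constant for which the product times \<open>1 + r\<close> is at most
    \<open>D * exp (r / 2)\<close>. The additional factor \<open>1 + r\<close> is the source of the
    smallness: it exceeds \<open>D / \<epsilon>\<close> for large \<open>r\<close>.\<close>
  define D where "D = 2 ^ Suc ?m * (fact (Suc ?m) * exp 1) * (C1 * C2)"
  have D: "0 \<le> D" using C by (simp add: D_def)
  have "\<bar>g (fst x) * h (snd x)\<bar> \<le> \<epsilon> * (expo (fst x) + expo (snd x))" if x: "D / \<epsilon> \<le> norm x" for x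
  proof -
    let ?r = "norm x"
    have r: "norm (fst x) \<le> ?r" "norm (snd x) \<le> ?r" "?r \<le> norm (fst x) + norm (snd x)"
      using norm_fst_le[of "fst x" "snd x"] norm_snd_le[of "snd x" "fst x"] norm_Pair_le[of "fst x" "snd x"] by auto
    have "\<bar>g (fst x) * h (snd x)\<bar> \<le> (C1 * (1 + ?r) ^ k1) * (C2 * (1 + ?r) ^ k2)"
      unfolding abs_mult
      by (intro mult_mono order_trans[OF g] order_trans[OF h] mult_left_mono power_mono add_left_mono r)
        (use C in auto)
    also have "\<dots> = (C1 * C2) * (1 + ?r) ^ ?m" by (simp add: power_add mult_ac)
    finally have 1: "\<bar>g (fst x) * h (snd x)\<bar> * (1 + ?r) \<le> (C1 * C2) * (1 + ?r) ^ Suc ?m"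
      using mult_right_mono[of "\<bar>g (fst x) * h (snd x)\<bar>" "(C1 * C2) * (1 + ?r) ^ ?m" "1 + ?r"] by (simp add: mult_ac)
    \<comment> \<open>Halving the norm costs a power of 2 and produces the exponential at
      \<open>r / 2\<close> instead of \<open>r\<close>.\<close>
    have "(1 + ?r) ^ Suc ?m \<le> (2 * (1 + ?r / 2)) ^ Suc ?m" by (intro power_mono) auto
    also have "\<dots> = 2 ^ Suc ?m * (1 + ?r / 2) ^ Suc ?m" by (rule power_mult_distrib)
    also have "\<dots> \<le> 2 ^ Suc ?m * (fact (Suc ?m) * exp 1 * exp (?r / 2))"
      by (intro mult_left_mono one_plus_power_le_exp) auto
    finally have "(C1 * C2) * (1 + ?r) ^ Suc ?m \<le> (C1 * C2) * (2 ^ Suc ?m * (fact (Suc ?m) * exp 1 * exp (?r / 2)))"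
      using C by (intro mult_left_mono) auto
    also have "\<dots> = D * exp (?r / 2)" by (simp add: D_def)
    finally have "\<bar>g (fst x) * h (snd x)\<bar> * (1 + ?r) \<le> D * exp (?r / 2)" using 1 by linarith
    also have "\<dots> \<le> (\<epsilon> * (1 + ?r)) * exp (?r / 2)"
      using x e by (intro mult_right_mono) (auto simp: field_simps)
    finally have "\<bar>g (fst x) * h (snd x)\<bar> * (1 + ?r) \<le> (\<epsilon> * exp (?r / 2)) * (1 + ?r)"
      by (simp add: mult_ac)
    then have "\<bar>g (fst x) * h (snd x)\<bar> \<le> \<epsilon> * exp (?r / 2)"
      by (rule mult_right_le_imp_le) (simp add: add_pos_nonneg)
    also have "exp (?r / 2) \<le> expo (fst x) + expo (snd x)"
    proof (cases "norm (fst x) \<le> norm (snd x)")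
      case True
      then have "exp (?r / 2) \<le> exp (norm (snd x))" using r by simp
      then show ?thesis using exp_norm_le_expo[of "snd x"] expo_nonneg[of "fst x"] by linarith
    next
      case False
      then have "exp (?r / 2) \<le> exp (norm (fst x))" using r by simp
      then show ?thesis using exp_norm_le_expo[of "fst x"] expo_nonneg[of "snd x"] by linarith
    qed
    finally show ?thesis using e by simp
  qed
  then show ?thesis by blast
qed

text \<open>Inside a ball, close points give \<epsilon> by uniform continuity; outside, both values
  are below \<epsilon> times the weight; points at distance at least \<open>d\<close> are covered by
  the quadratic term.\<close>

lemma dominated_increment_bound:
  fixes f G :: "'a::euclidean_space \<Rightarrow> real"
  assumes f: "continuous_on UNIV f" and G: "\<And>x. 0 \<le> G x"
    and dom: "\<exists>R. \<forall>x. R \<le> norm x \<longrightarrow> \<bar>f x\<bar> \<le> \<epsilon> * G x" and e: "0 < \<epsilon>"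
  obtains C where "0 \<le> C" "\<And>x y. \<bar>f x - f y\<bar> \<le> \<epsilon> * (1 + G x + G y) + C * (norm (x - y))\<^sup>2"
proof -
  obtain R where R: "\<And>x. R \<le> norm x \<Longrightarrow> \<bar>f x\<bar> \<le> \<epsilon> * G x" using dom by blast
  have "compact (f ` cball 0 R)"
    by (intro compact_continuous_image continuous_on_subset[OF f]) auto
  then obtain B where B: "\<And>x. norm x \<le> R \<Longrightarrow> \<bar>f x\<bar> \<le> B" "0 < B"
    using compact_imp_bounded[of "f ` cball 0 R"] unfolding bounded_pos by fastforce
  have fB: "\<bar>f x\<bar> \<le> B + \<epsilon> * G x" for x
    using B(1)[of x] R[of x] B(2) G[of x] e
    by (cases "norm x \<le> R") (auto intro: add_increasing2)
  \<comment> \<open>The margin 1 ensures that two close points are both in the larger ball as soon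
    as one of them is in the ball of radius \<open>R\<close>; this is why \<open>d\<close> is kept
    below 1.\<close>
  have "uniformly_continuous_on (cball 0 (R + 1)) f"
    by (intro compact_uniformly_continuous continuous_on_subset[OF f]) auto
  then obtain d0 where d0: "0 < d0" "\<And>x y. norm x \<le> R + 1 \<Longrightarrow> norm y \<le> R + 1 \<Longrightarrow> dist y x < d0 \<Longrightarrow> dist (f y) (f x) < \<epsilon>"
    unfolding uniformly_continuous_on_def using e by (metis dist_0_norm mem_cball)
  define d where "d = min d0 1"
  have d: "0 < d" "d \<le> 1" "d \<le> d0" using d0 by (auto simp: d_def)
  \<comment> \<open>At distance at least \<open>d\<close> the quadratic term is at least
    \<open>2 * B\<close>, the part of the two values that the weights do not cover.\<close>
  define C where "C = 2 * B / d\<^sup>2"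
  have C: "0 \<le> C" using B d by (simp add: C_def)
  have "\<bar>f x - f y\<bar> \<le> \<epsilon> * (1 + G x + G y) + C * (norm (x - y))\<^sup>2" for x y
  proof (cases "norm (x - y) < d")
    case True
    have n: "norm x \<le> norm y + 1" "norm y \<le> norm x + 1"
      using norm_triangle_sub[of x y] norm_triangle_sub[of y x] True d by (auto simp: norm_minus_commute)
    have c0: "0 \<le> C * (norm (x - y))\<^sup>2" using C by simp
    show ?thesis
    proof (cases "norm x \<le> R \<or> norm y \<le> R")
      case True
      then have "dist (f x) (f y) < \<epsilon>" using n d0(2)[of y x] \<open>norm (x - y) < d\<close> d by (auto simp: dist_norm)
      then have "\<bar>f x - f y\<bar> \<le> \<epsilon> * 1" by (simp add: dist_real_def)
      also have "\<dots> \<le> \<epsilon> * (1 + G x + G y)" using e G[of x] G[of y] by (intro mult_left_mono) auto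
      finally show ?thesis using c0 by linarith
    next
      case False
      then have "\<bar>f x\<bar> \<le> \<epsilon> * G x" "\<bar>f y\<bar> \<le> \<epsilon> * G y" using R[of x] R[of y] by auto
      then have "\<bar>f x - f y\<bar> \<le> \<epsilon> * G x + \<epsilon> * G y" by linarith
      also have "\<dots> \<le> \<epsilon> * (1 + G x + G y)" using e by (simp add: distrib_left)
      finally show ?thesis using c0 by linarith
    qed
  next
    case False
    then have "d\<^sup>2 \<le> (norm (x - y))\<^sup>2" using d by (intro power_mono) auto
    then have "C * d\<^sup>2 \<le> C * (norm (x - y))\<^sup>2" using C by (intro mult_left_mono)
    then have "2 * B \<le> C * (norm (x - y))\<^sup>2" using d by (simp add: C_def)
    moreover have "\<epsilon> * (1 + G x + G y) = \<epsilon> + \<epsilon> * G x + \<epsilon> * G y" by (simp add: distrib_left)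
    ultimately show ?thesis using fB[of x] fB[of y] e by linarith
  qed
  with C that show ?thesis by blast
qed

text \<open>An entry of \<open>rho\<close> written against one fixed measure: the matrix enters only
  through the integrand, so that dominated convergence applies in \<open>A\<close>.\<close>

definition gauss_mean :: "(real ^ 'd \<Rightarrow> real) \<Rightarrow> real ^ 'e ^ 'd \<Rightarrow> real" where
  "gauss_mean f A = (\<integral>z. f (A *v z) \<partial>std_normal_vec)"

lemma rho_gauss_mean:
  assumes "\<And>i j. (\<lambda>x. f x $ i $ j) \<in> borel_measurable borel"
  shows "rho A f $ i $ j = gauss_mean (\<lambda>x. f x $ i $ j) A"
  unfolding rho_def normal_law_def gauss_mean_def
  by (simp, subst integral_distr) (use assms in auto)

section \<open>Gaussian means of functions of polynomial growth\<close>

context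
  fixes f :: "real ^ 'd \<Rightarrow> real" and C :: real and m :: nat
  assumes cont: "continuous_on UNIV f" and C: "0 \<le> C" and growth: "\<And>x. \<bar>f x\<bar> \<le> C * (1 + norm x) ^ m"
begin

lemma growth_measurable [measurable]: "f \<in> borel_measurable borel"
  by (rule borel_measurable_continuous_onI[OF cont])

lemma growth_image_le:
  fixes A :: "real ^ 'e ^ 'd"
  assumes "norm A \<le> K"
  shows "\<bar>f (A *v z)\<bar> \<le> C * (1 + K * norm z) ^ m"
proof -
  have "norm (A *v z) \<le> K * norm z"
    by (rule order_trans[OF norm_matrix_vector_le]) (intro mult_right_mono assms norm_ge_zero)
  then have "C * (1 + norm (A *v z)) ^ m \<le> C * (1 + K * norm z) ^ m"
    by (intro mult_left_mono power_mono C) auto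
  with growth[of "A *v z"] show ?thesis by linarith
qed

lemma growth_integrable: "integrable std_normal_vec (\<lambda>z. f ((A :: real ^ 'e ^ 'd) *v z))"
proof (rule Bochner_Integration.integrable_bound[where f = "\<lambda>z. C * (1 + norm A * norm z) ^ m"])
  show "integrable std_normal_vec (\<lambda>z :: real ^ 'e. C * (1 + norm A * norm z) ^ m)"
    by (intro integrable_mult_right integrable_std_normal_vec_power) simp
  show "AE z in std_normal_vec. norm (f (A *v z)) \<le> norm (C * (1 + norm A * norm z) ^ m)"
    using growth_image_le[of A "norm A"] C by (intro AE_I2) (simp add: abs_mult)
qed measurable

lemma gauss_mean_bounded: "\<exists>B\<ge>0. \<forall>A :: real ^ 'e ^ 'd. norm A \<le> K \<longrightarrow> \<bar>gauss_mean f A\<bar> \<le> B" if K: "0 \<le> K"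
proof (intro exI conjI allI impI)
  let ?B = "\<integral>z. C * (1 + K * norm z) ^ m \<partial>(std_normal_vec :: (real ^ 'e) measure)"
  have int: "integrable std_normal_vec (\<lambda>z :: real ^ 'e. C * (1 + K * norm z) ^ m)"
    by (intro integrable_mult_right integrable_std_normal_vec_power K)
  show "0 \<le> ?B" using C K by (intro integral_nonneg_AE AE_I2) auto
  fix A :: "real ^ 'e ^ 'd" assume A: "norm A \<le> K"
  have "\<bar>gauss_mean f A\<bar> \<le> (\<integral>z. \<bar>f (A *v z)\<bar> \<partial>std_normal_vec)"
    unfolding gauss_mean_def by (rule integral_abs_bound)
  also have "\<dots> \<le> ?B"
    by (intro integral_mono int growth_image_le[OF A] integrable_abs growth_integrable)
  finally show "\<bar>gauss_mean f A\<bar> \<le> ?B" .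
qed

lemma growth_second_moment:
  assumes K: "0 \<le> K"
  shows "\<exists>B\<ge>0. \<forall>A :: real ^ 'e ^ 'd. norm A \<le> K \<longrightarrow> (\<integral>\<^sup>+z. ennreal ((f (A *v z))\<^sup>2) \<partial>std_normal_vec) \<le> ennreal B"
proof (intro exI conjI allI impI)
  let ?B = "\<integral>z. C\<^sup>2 * (1 + K * norm z) ^ (m * 2) \<partial>(std_normal_vec :: (real ^ 'e) measure)"
  have int: "integrable std_normal_vec (\<lambda>z :: real ^ 'e. C\<^sup>2 * (1 + K * norm z) ^ (m * 2))"
    by (intro integrable_mult_right integrable_std_normal_vec_power K)
  show "0 \<le> ?B" using C K by (intro integral_nonneg_AE AE_I2) auto
  fix A :: "real ^ 'e ^ 'd" assume A: "norm A \<le> K"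
  have "(\<integral>\<^sup>+z. ennreal ((f (A *v z))\<^sup>2) \<partial>std_normal_vec) \<le> (\<integral>\<^sup>+(z :: real ^ 'e). ennreal (C\<^sup>2 * (1 + K * norm z) ^ (m * 2)) \<partial>std_normal_vec)"
  proof (intro nn_integral_mono ennreal_leI)
    fix z :: "real ^ 'e"
    have "\<bar>f (A *v z)\<bar>\<^sup>2 \<le> (C * (1 + K * norm z) ^ m)\<^sup>2" by (intro power_mono growth_image_le[OF A]) simp
    then show "(f (A *v z))\<^sup>2 \<le> C\<^sup>2 * (1 + K * norm z) ^ (m * 2)" by (simp add: power_mult_distrib power_mult)
  qed
  also have "\<dots> = ennreal ?B" by (rule nn_integral_eq_integral[OF int]) (use C K in auto)
  finally show "(\<integral>\<^sup>+z. ennreal ((f (A *v z))\<^sup>2) \<partial>std_normal_vec) \<le> ennreal ?B" .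
qed

text \<open>A convergent sequence of matrices is bounded by some \<open>K\<close>, and the growth
  bound with this \<open>K\<close> is an integrable majorant for the whole sequence.\<close>

lemma continuous_on_gauss_mean: "continuous_on S (gauss_mean f :: real ^ 'e ^ 'd \<Rightarrow> real)"
proof -
  have "isCont (gauss_mean f) A" for A :: "real ^ 'e ^ 'd"
    unfolding continuous_at_sequentially
  proof (intro allI impI)
    fix x :: "nat \<Rightarrow> real ^ 'e ^ 'd" assume x: "x \<longlonglongrightarrow> A"
    obtain K where K: "0 < K" "\<And>n. norm (x n) \<le> K"
      using convergent_imp_Bseq[OF convergentI[OF x]] unfolding Bseq_def by blast
    have "(\<lambda>n. \<integral>z. f (x n *v z) \<partial>std_normal_vec) \<longlonglongrightarrow> (\<integral>z. f (A *v z) \<partial>std_normal_vec)"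
    proof (rule integral_dominated_convergence[where w = "\<lambda>z. C * (1 + K * norm z) ^ m"])
      show "integrable std_normal_vec (\<lambda>z :: real ^ 'e. C * (1 + K * norm z) ^ m)"
        by (intro integrable_mult_right integrable_std_normal_vec_power) (use K in simp)
      show "AE z in std_normal_vec. (\<lambda>n. f (x n *v z)) \<longlonglongrightarrow> f (A *v z)"
      proof (rule AE_I2)
        fix z :: "real ^ 'e"
        have "continuous_on UNIV (\<lambda>B :: real ^ 'e ^ 'd. B *v z)"
          by (intro continuous_on_matrix_vector_mult continuous_intros)
        then have "(\<lambda>n. x n *v z) \<longlonglongrightarrow> A *v z"
          using x unfolding continuous_on_eq_continuous_at[OF open_UNIV] isCont_def
          by (intro isCont_tendsto_compose[OF _ x]) (auto simp: isCont_def)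
        moreover have "isCont f (A *v z)" using cont by (simp add: continuous_on_eq_continuous_at)
        ultimately show "(\<lambda>n. f (x n *v z)) \<longlonglongrightarrow> f (A *v z)" by (rule isCont_tendsto_compose[rotated])
      qed
      show "AE z in std_normal_vec. norm (f (x n *v z)) \<le> C * (1 + K * norm z) ^ m" for n
        using growth_image_le[OF K(2)] by (intro AE_I2) simp
    qed measurable
    then show "(gauss_mean f \<circ> x) \<longlonglongrightarrow> gauss_mean f A" by (simp add: gauss_mean_def o_def)
  qed
  then show ?thesis by (simp add: continuous_at_imp_continuous_on)
qed

end

section \<open>A maximal inequality for partial sums\<close>

lemma sum_lessThan_add:
  fixes f :: "nat \<Rightarrow> 'a::comm_monoid_add"
  shows "(\<Sum>i<a + r. f i) = (\<Sum>i<a. f i) + (\<Sum>i<r. f (a + i))"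
  by (induction r) (simp_all add: add_ac)

context prob_space
begin

text \<open>A maximal inequality without martingales: partial sums are controlled in \<open>L\<^sup>2\<close> at multiples of
  a large block length \<open>b\<close>, and the terms inside a block are added in absolute value.\<close>

lemma whp_max_partial_sums:
  fixes U :: "nat \<Rightarrow> nat \<Rightarrow> 'a \<Rightarrow> real"
  assumes meas [measurable]: "\<And>n i. U n i \<in> borel_measurable M" and C: "0 \<le> C"
    and U1: "\<And>n i. n \<ge> 1 \<Longrightarrow> (\<integral>\<^sup>+\<omega>. ennreal ((U n i \<omega>)\<^sup>2) \<partial>M) \<le> ennreal C"
    and U2: "\<And>n m. n \<ge> 1 \<Longrightarrow> (\<integral>\<^sup>+\<omega>. ennreal ((\<Sum>i<m. U n i \<omega>)\<^sup>2) \<partial>M) \<le> ennreal (C * real m)"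
    and e: "0 < \<epsilon>"
  shows "whp M (\<lambda>n \<omega>. \<forall>m\<le>n * T. \<bar>\<Sum>i<m. U n i \<omega>\<bar> \<le> \<epsilon> * real n)"
  unfolding whp_def
proof (intro allI impI)
  fix \<delta> :: real assume d: "\<delta> > 0"
  \<comment> \<open>Block ends and block interiors are each tested at the level
    \<open>\<epsilon> * n / 2\<close>, and Markov's inequality divides by its square.\<close>
  define c where "c = 4 * C / \<epsilon>\<^sup>2"
  have c: "0 \<le> c" using C by (simp add: c_def)
  \<comment> \<open>About \<open>n * T / b\<close> block ends with probability at most
    \<open>c * T / n\<close> each add up to \<open>c * T^2 / b\<close>, which does not decrease with
    \<open>n\<close> and is made small by \<open>b\<close> alone. The other terms are of order
    \<open>1 / n\<close> for fixed \<open>b\<close> and are left to \<open>n0\<close>.\<close>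
  obtain b :: nat where b: "b > 0" "c * T\<^sup>2 / (\<delta>/2) < real b"
    using reals_Archimedean2[of "max 1 (c * T\<^sup>2 / (\<delta>/2))"] by (metis max_less_iff_conj of_nat_0_less_iff zero_less_one order.strict_trans)
  obtain n0 :: nat where n0: "(c * T + c * b * T + c * b\<^sup>2) / (\<delta>/2) < real n0"
    using reals_Archimedean2 by blast
  show "\<forall>\<^sub>F n in sequentially. \<exists>A\<in>sets M. measure M A \<le> \<delta> \<and>
      (\<forall>\<omega>\<in>space M - A. \<forall>m\<le>n * T. \<bar>\<Sum>i<m. U n i \<omega>\<bar> \<le> \<epsilon> * real n)"
    unfolding eventually_sequentially
  proof (intro exI allI impI)
    fix n assume n: "max 1 n0 \<le> n"
    then have n1: "n \<ge> 1" and nn0: "n0 \<le> n" by auto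
    let ?Q = "{..n * T div b}"
    define A1 where "A1 q = {\<omega>\<in>space M. ennreal ((\<Sum>i<b*q. U n i \<omega>)\<^sup>2) \<ge> ennreal ((\<epsilon> * n / 2)\<^sup>2)}" for q
    \<comment> \<open>By Cauchy-Schwarz, \<open>b\<close> times the sum of squares dominates the
      square of the sum of absolute values over the block.\<close>
    define A2 where "A2 q = {\<omega>\<in>space M. ennreal (b * (\<Sum>i<b. (U n (b * q + i) \<omega>)\<^sup>2)) \<ge> ennreal ((\<epsilon> * n / 2)\<^sup>2)}" for q
    have [measurable]: "A1 q \<in> sets M" "A2 q \<in> sets M" for q unfolding A1_def A2_def by measurable
    have en: "0 < (\<epsilon> * n / 2)\<^sup>2" using e n1 by simp
    have mA1: "measure M (A1 q) \<le> c * T / n" if q: "q \<in> ?Q" for q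
    proof -
      have "q * b \<le> (n * T div b) * b" using q by (intro mult_le_mono1) simp
      then have bq: "b * q \<le> n * T"
        using div_times_less_eq_dividend[of "n * T" b] unfolding mult.commute[of b] by linarith
      have "measure M (A1 q) \<le> (C * real (b * q)) / (\<epsilon> * n / 2)\<^sup>2"
        unfolding A1_def by (rule markov[OF _ U2[OF n1] en]) (use C in auto)
      also have "\<dots> \<le> (C * real (n * T)) / (\<epsilon> * n / 2)\<^sup>2"
        using bq C by (intro divide_right_mono mult_left_mono) (auto simp del: of_nat_mult)
      also have "\<dots> = c * T / n" using n1 e by (simp add: c_def power2_eq_square field_simps)
      finally show ?thesis .
    qed
    have mA2: "measure M (A2 q) \<le> c * b\<^sup>2 / n\<^sup>2" for q
    proof -
      have "(\<integral>\<^sup>+\<omega>. ennreal (b * (\<Sum>i<b. (U n (b * q + i) \<omega>)\<^sup>2)) \<partial>M) = ennreal b * (\<Sum>i<b. \<integral>\<^sup>+\<omega>. ennreal ((U n (b * q + i) \<omega>)\<^sup>2) \<partial>M)"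
        by (simp add: ennreal_mult sum_nonneg nn_integral_cmult nn_integral_sum flip: sum_ennreal)
      also have "\<dots> \<le> ennreal b * (\<Sum>i<b. ennreal C)" by (intro mult_left_mono sum_mono U1[OF n1]) simp
      also have "\<dots> = ennreal (b * (b * C))" using C by (simp add: ennreal_mult ennreal_of_nat_eq_real_of_nat)
      finally have "measure M (A2 q) \<le> (b * (b * C)) / (\<epsilon> * n / 2)\<^sup>2"
        unfolding A2_def by (intro markov en) (use C in auto)
      also have "\<dots> = c * b\<^sup>2 / n\<^sup>2" using n1 e by (simp add: c_def power2_eq_square field_simps)
      finally show ?thesis .
    qed
    let ?A = "(\<Union>q\<in>?Q. A1 q \<union> A2 q)"
    have "measure M ?A \<le> (\<Sum>q\<in>?Q. measure M (A1 q \<union> A2 q))" by (rule measure_UNION_le) auto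
    also have "\<dots> \<le> (\<Sum>q\<in>?Q. c * T / n + c * b\<^sup>2 / n\<^sup>2)"
      by (intro sum_mono order_trans[OF measure_Un_le] add_mono mA1 mA2) auto
    also have "\<dots> = (real (n * T div b) + 1) * (c * T / n + c * b\<^sup>2 / n\<^sup>2)" by simp
    also have "\<dots> \<le> (n * T / b + 1) * (c * T / n + c * b\<^sup>2 / n\<^sup>2)"
    proof -
      have "real (n * T div b) \<le> n * T / b"
        using of_nat_div_le_of_nat[of "n * T" b, where 'a = real] by simp
      then show ?thesis using c by (intro mult_right_mono add_mono) auto
    qed
    also have "\<dots> = c * T\<^sup>2 / b + (c * T + c * b * T) / n + c * b\<^sup>2 / n\<^sup>2"
      using n1 b by (simp add: field_simps power2_eq_square)
    also have "\<dots> \<le> c * T\<^sup>2 / b + (c * T + c * b * T) / n + c * b\<^sup>2 / n"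
      using n1 c by (intro add_left_mono divide_left_mono) (auto simp: power2_eq_square)
    also have "\<dots> = c * T\<^sup>2 / b + (c * T + c * b * T + c * b\<^sup>2) / n" by (simp add: add_divide_distrib)
    also have "\<dots> \<le> \<delta>/2 + \<delta>/2"
    proof (rule add_mono)
      show "c * T\<^sup>2 / b \<le> \<delta>/2" using b d by (simp add: field_simps)
      have "(c * T + c * b * T + c * b\<^sup>2) / (\<delta>/2) \<le> real n" using n0 nn0 by linarith
      then show "(c * T + c * b * T + c * b\<^sup>2) / n \<le> \<delta>/2" using d n1 by (simp add: field_simps)
    qed
    finally have mA: "measure M ?A \<le> \<delta>" by simp
    have main: "\<bar>\<Sum>i<m. U n i \<omega>\<bar> \<le> \<epsilon> * real n" if \<omega>: "\<omega> \<in> space M - ?A" and m: "m \<le> n * T" for \<omega> m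
    proof -
      let ?q = "m div b" and ?r = "m mod b"
      have q: "?q \<in> ?Q" using m by (simp add: div_le_mono)
      have mm: "m = b * ?q + ?r" "?r \<le> b" using b by (simp_all add: less_imp_le)
      have "\<bar>\<Sum>i<b * ?q. U n i \<omega>\<bar> \<le> \<epsilon> * n / 2"
      proof -
        have "\<omega> \<notin> A1 ?q" using \<omega> q by blast
        then have "(\<Sum>i<b * ?q. U n i \<omega>)\<^sup>2 < (\<epsilon> * n / 2)\<^sup>2" using \<omega> by (auto simp: A1_def not_le ennreal_less_iff)
        then show ?thesis using e by (intro power2_le_imp_le[of "\<bar>\<Sum>i<b * ?q. U n i \<omega>\<bar>" "\<epsilon> * n / 2"]) auto
      qed
      moreover have "(\<Sum>i<b. \<bar>U n (b * ?q + i) \<omega>\<bar>) \<le> \<epsilon> * n / 2"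
      proof -
        have "\<omega> \<notin> A2 ?q" using \<omega> q by blast
        then have 1: "b * (\<Sum>i<b. (U n (b * ?q + i) \<omega>)\<^sup>2) < (\<epsilon> * n / 2)\<^sup>2"
          using \<omega> by (auto simp: A2_def not_le ennreal_less_iff sum_nonneg)
        have "(\<Sum>i<b. \<bar>U n (b * ?q + i) \<omega>\<bar>)\<^sup>2 \<le> b * (\<Sum>i<b. (U n (b * ?q + i) \<omega>)\<^sup>2)"
          using sum_squared_le_sum_of_squares[of "\<lambda>i. \<bar>U n (b * ?q + i) \<omega>\<bar>" "{..<b}"] by (simp add: mult.commute)
        with 1 have "(\<Sum>i<b. \<bar>U n (b * ?q + i) \<omega>\<bar>)\<^sup>2 < (\<epsilon> * n / 2)\<^sup>2" by linarith
        from power2_le_imp_le[OF less_imp_le[OF this]] e show ?thesis by simp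
      qed
      moreover have "(\<Sum>i<m. U n i \<omega>) = (\<Sum>i<b * ?q. U n i \<omega>) + (\<Sum>i<?r. U n (b * ?q + i) \<omega>)"
        by (subst mm(1)) (rule sum_lessThan_add)
      moreover have "\<bar>\<Sum>i<?r. U n (b * ?q + i) \<omega>\<bar> \<le> (\<Sum>i<?r. \<bar>U n (b * ?q + i) \<omega>\<bar>)" by (rule sum_abs)
      moreover have "\<dots> \<le> (\<Sum>i<b. \<bar>U n (b * ?q + i) \<omega>\<bar>)"
        by (rule sum_mono2) (use mm in auto)
      ultimately show ?thesis by linarith
    qed
    have "?A \<in> sets M" by (intro sets.finite_UN) auto
    with mA main show "\<exists>A\<in>sets M. measure M A \<le> \<delta> \<and>
      (\<forall>\<omega>\<in>space M - A. \<forall>m\<le>n * T. \<bar>\<Sum>i<m. U n i \<omega>\<bar> \<le> \<epsilon> * real n)" by blast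
  qed
qed

end

section \<open>Orthogonality of the compensated terms\<close>

lemma (in prob_space) integrable_mult_L2:
  fixes X Y :: "'a \<Rightarrow> real"
  assumes [measurable]: "X \<in> borel_measurable M" "Y \<in> borel_measurable M"
    and X: "(\<integral>\<^sup>+\<omega>. ennreal ((X \<omega>)\<^sup>2) \<partial>M) < \<infinity>" and Y: "(\<integral>\<^sup>+\<omega>. ennreal ((Y \<omega>)\<^sup>2) \<partial>M) < \<infinity>"
  shows "integrable M (\<lambda>\<omega>. X \<omega> * Y \<omega>)"
proof (rule Bochner_Integration.integrable_bound[where f = "\<lambda>\<omega>. (X \<omega>)\<^sup>2 + (Y \<omega>)\<^sup>2"])
  show "integrable M (\<lambda>\<omega>. (X \<omega>)\<^sup>2 + (Y \<omega>)\<^sup>2)"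
    by (intro Bochner_Integration.integrable_add integrableI_bounded) (use X Y in auto)
  show "AE \<omega> in M. norm (X \<omega> * Y \<omega>) \<le> norm ((X \<omega>)\<^sup>2 + (Y \<omega>)\<^sup>2)"
  proof (rule AE_I2)
    fix \<omega>
    have "\<bar>X \<omega> * Y \<omega>\<bar> \<le> (X \<omega>)\<^sup>2 + (Y \<omega>)\<^sup>2"
      using sum_squares_bound[of "\<bar>X \<omega>\<bar>" "\<bar>Y \<omega>\<bar>"] mult_nonneg_nonneg[of "\<bar>X \<omega>\<bar>" "\<bar>Y \<omega>\<bar>"]
      unfolding abs_mult power2_abs by linarith
    then show "norm (X \<omega> * Y \<omega>) \<le> norm ((X \<omega>)\<^sup>2 + (Y \<omega>)\<^sup>2)" by simp
  qed
qed measurable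

context brownian
begin

abbreviation W_incr :: "nat \<Rightarrow> nat \<Rightarrow> 'w \<Rightarrow> real ^ 'e" where
  "W_incr n j \<omega> \<equiv> W (real (Suc j) / real n) \<omega> - W (real j / real n) \<omega>"

text \<open>Normalised so as to be standard normal for every \<open>n \<ge> 1\<close>.\<close>

definition nincr :: "nat \<Rightarrow> nat \<Rightarrow> 'w \<Rightarrow> real ^ 'e" where
  "nincr n j \<omega> = sqrt (real n) *\<^sub>R W_incr n j \<omega>"

lemma measurable_nincr: "nincr n j \<in> borel_measurable (F (real (Suc j) / real n))"
proof -
  have "real j / real n \<le> real (Suc j) / real n" by (intro divide_right_mono) auto
  then have [measurable]: "W (real (Suc j) / real n) \<in> borel_measurable (F (real (Suc j) / real n))"
      "W (real j / real n) \<in> borel_measurable (F (real (Suc j) / real n))"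
    by (intro measurable_W measurable_F_mono[OF _ _ measurable_W, of "real j / real n" "real (Suc j) / real n"]; simp)+
  show ?thesis unfolding nincr_def[abs_def] by measurable
qed

lemma measurable_nincr_M [measurable]: "nincr n j \<in> borel_measurable M"
  by (rule measurable_F_M[OF _ measurable_nincr]) simp

lemma nincr_scale: "n \<ge> 1 \<Longrightarrow> sqrt (real n) *\<^sub>R sqrt (real (Suc j) / real n - real j / real n) *\<^sub>R (z :: real ^ 'e) = z"
  by (simp add: add_divide_distrib real_sqrt_divide)

lemma freeze_nincr_nn:
  assumes n: "n \<ge> 1" and xi: "\<xi> \<in> measurable (F (real j / real n)) N"
    and f [measurable]: "f \<in> borel_measurable (N \<Otimes>\<^sub>M borel)"
  shows "(\<integral>\<^sup>+\<omega>. f (\<xi> \<omega>, nincr n j \<omega>) \<partial>M) = (\<integral>\<^sup>+\<omega>. \<integral>\<^sup>+z. f (\<xi> \<omega>, z) \<partial>std_normal_vec \<partial>M)"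
proof -
  have le: "real j / real n \<le> real (Suc j) / real n" by (intro divide_right_mono) auto
  have "(\<integral>\<^sup>+\<omega>. (\<lambda>p. f (fst p, sqrt (real n) *\<^sub>R snd p)) (\<xi> \<omega>, W_incr n j \<omega>) \<partial>M)
    = (\<integral>\<^sup>+\<omega>. \<integral>\<^sup>+z. (\<lambda>p. f (fst p, sqrt (real n) *\<^sub>R snd p)) (\<xi> \<omega>, sqrt (real (Suc j) / real n - real j / real n) *\<^sub>R z) \<partial>std_normal_vec \<partial>M)"
    by (rule freeze_nn[OF _ le xi]) (simp, measurable)
  then show ?thesis using n by (simp only: fst_conv snd_conv nincr_scale nincr_def[symmetric])
qed

lemma freeze_nincr_integral:
  fixes f :: "'x \<times> (real ^ 'e) \<Rightarrow> real"
  assumes n: "n \<ge> 1" and xi: "\<xi> \<in> measurable (F (real j / real n)) N"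
    and f [measurable]: "f \<in> borel_measurable (N \<Otimes>\<^sub>M borel)"
    and int: "integrable M (\<lambda>\<omega>. f (\<xi> \<omega>, nincr n j \<omega>))"
  shows "(\<integral>\<omega>. f (\<xi> \<omega>, nincr n j \<omega>) \<partial>M) = (\<integral>\<omega>. \<integral>z. f (\<xi> \<omega>, z) \<partial>std_normal_vec \<partial>M)"
proof -
  have lt: "real j / real n < real (Suc j) / real n" using n by (intro divide_strict_right_mono) auto
  have "(\<integral>\<omega>. (\<lambda>p. f (fst p, sqrt (real n) *\<^sub>R snd p)) (\<xi> \<omega>, W_incr n j \<omega>) \<partial>M)
    = (\<integral>\<omega>. \<integral>z. (\<lambda>p. f (fst p, sqrt (real n) *\<^sub>R snd p)) (\<xi> \<omega>, sqrt (real (Suc j) / real n - real j / real n) *\<^sub>R z) \<partial>std_normal_vec \<partial>M)"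
    by (rule freeze_integral[OF _ lt xi]) (simp, measurable, use int in \<open>simp add: nincr_def\<close>)
  then show ?thesis using n by (simp only: fst_conv snd_conv nincr_scale nincr_def[symmetric])
qed

text \<open>Both factors carry the coefficient \<open>s j\<close>, although the second one belongs
  to the next cell: for \<open>s j\<close> known at time \<open>j/n\<close>, the subtracted product
  is then the conditional expectation given the information at that time.\<close>

definition cterm :: "(real ^ 'd \<Rightarrow> real) \<Rightarrow> (real ^ 'd \<Rightarrow> real) \<Rightarrow> nat \<Rightarrow>
    (nat \<Rightarrow> 'w \<Rightarrow> real ^ 'e ^ 'd) \<Rightarrow> nat \<Rightarrow> 'w \<Rightarrow> real" where
  "cterm g h n s j \<omega> = g (s j \<omega> *v nincr n j \<omega>) * h (s j \<omega> *v nincr n (Suc j) \<omega>)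
    - gauss_mean g (s j \<omega>) * gauss_mean h (s j \<omega>)"

context
  fixes g h :: "real ^ 'd \<Rightarrow> real" and K Cg Ch :: real and mg mh n :: nat
    and s :: "nat \<Rightarrow> 'w \<Rightarrow> real ^ 'e ^ 'd"
  assumes K: "0 \<le> K"
    and g: "continuous_on UNIV g" "0 \<le> Cg" "\<And>x. \<bar>g x\<bar> \<le> Cg * (1 + norm x) ^ mg"
    and h: "continuous_on UNIV h" "0 \<le> Ch" "\<And>x. \<bar>h x\<bar> \<le> Ch * (1 + norm x) ^ mh"
    and n: "n \<ge> 1"
    and s: "\<And>j. s j \<in> borel_measurable (F (real j / real n))" "\<And>j \<omega>. norm (s j \<omega>) \<le> K"
begin

lemmas g_meas [measurable] = growth_measurable[OF g] and h_meas [measurable] = growth_measurable[OF h]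

lemma gauss_mean_meas [measurable]:
  "gauss_mean g \<in> borel_measurable (borel :: (real ^ 'e ^ 'd) measure)"
  "gauss_mean h \<in> borel_measurable (borel :: (real ^ 'e ^ 'd) measure)"
  by (intro borel_measurable_continuous_onI continuous_on_gauss_mean[OF g] continuous_on_gauss_mean[OF h])+

lemma s_meas [measurable]: "s j \<in> borel_measurable M"
  by (rule measurable_F_M[OF _ s(1)]) simp

lemma F_grid_mono: "f \<in> measurable (F (real j / real n)) N \<Longrightarrow> j \<le> k \<Longrightarrow> f \<in> measurable (F (real k / real n)) N"
  by (rule measurable_F_mono[of "real j / real n"]) (auto intro: divide_right_mono)

text \<open>The last increment involved ends at time \<open>(j + 2) / n\<close>. Terms at distance
  at least 2 are thus ordered in time and will be orthogonal, while neighbours share an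
  increment.\<close>

lemma cterm_meas: "cterm g h n s j \<in> borel_measurable (F (real (j + 2) / real n))"
proof -
  have [measurable]: "s j \<in> borel_measurable (F (real (j + 2) / real n))"
      "nincr n j \<in> borel_measurable (F (real (j + 2) / real n))"
      "nincr n (Suc j) \<in> borel_measurable (F (real (j + 2) / real n))"
    using F_grid_mono[OF s(1)[of j], of "j + 2"] F_grid_mono[OF measurable_nincr[of n j], of "j + 2"]
      F_grid_mono[OF measurable_nincr[of n "Suc j"], of "j + 2"] by auto
  show ?thesis unfolding cterm_def[abs_def] by measurable
qed

lemma cterm_meas_M [measurable]: "cterm g h n s j \<in> borel_measurable M"
  by (rule measurable_F_M[OF _ cterm_meas]) simp

text \<open>Two freezings: the increment on the second cell is integrated out first, with the
  coefficient and the first factor fixed, and then the one on the first cell.\<close>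

lemma product_second_moment:
  assumes Bg: "0 \<le> Bg" "\<And>A :: real ^ 'e ^ 'd. norm A \<le> K \<Longrightarrow> (\<integral>\<^sup>+z. ennreal ((g (A *v z))\<^sup>2) \<partial>std_normal_vec) \<le> ennreal Bg"
    and Bh: "0 \<le> Bh" "\<And>A :: real ^ 'e ^ 'd. norm A \<le> K \<Longrightarrow> (\<integral>\<^sup>+z. ennreal ((h (A *v z))\<^sup>2) \<partial>std_normal_vec) \<le> ennreal Bh"
  shows "(\<integral>\<^sup>+\<omega>. ennreal ((g (s j \<omega> *v nincr n j \<omega>))\<^sup>2) \<partial>M) \<le> ennreal Bg"
    "(\<integral>\<^sup>+\<omega>. ennreal ((g (s j \<omega> *v nincr n j \<omega>) * h (s j \<omega> *v nincr n (Suc j) \<omega>))\<^sup>2) \<partial>M) \<le> ennreal (Bg * Bh)"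
proof -
  have "(\<integral>\<^sup>+\<omega>. (\<lambda>p. ennreal ((g (fst p *v snd p))\<^sup>2)) (s j \<omega>, nincr n j \<omega>) \<partial>M)
      = (\<integral>\<^sup>+\<omega>. \<integral>\<^sup>+z. (\<lambda>p. ennreal ((g (fst p *v snd p))\<^sup>2)) (s j \<omega>, z) \<partial>std_normal_vec \<partial>M)"
    by (rule freeze_nincr_nn[OF n s(1)]) measurable
  also have "\<dots> \<le> (\<integral>\<^sup>+\<omega>. ennreal Bg \<partial>M)" by (simp only: fst_conv snd_conv) (intro nn_integral_mono Bg s(2))
  finally show 1: "(\<integral>\<^sup>+\<omega>. ennreal ((g (s j \<omega> *v nincr n j \<omega>))\<^sup>2) \<partial>M) \<le> ennreal Bg"
    by (simp add: emeasure_space_1)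
  have [measurable]: "s j \<in> borel_measurable (F (real (Suc j) / real n))" "nincr n j \<in> borel_measurable (F (real (Suc j) / real n))"
    using F_grid_mono[OF s(1)[of j], of "Suc j"] measurable_nincr by auto
  have "(\<integral>\<^sup>+\<omega>. (\<lambda>p. ennreal ((g (fst (fst p) *v snd (fst p)) * h (fst (fst p) *v snd p))\<^sup>2)) ((s j \<omega>, nincr n j \<omega>), nincr n (Suc j) \<omega>) \<partial>M)
      = (\<integral>\<^sup>+\<omega>. \<integral>\<^sup>+z. (\<lambda>p. ennreal ((g (fst (fst p) *v snd (fst p)) * h (fst (fst p) *v snd p))\<^sup>2)) ((s j \<omega>, nincr n j \<omega>), z) \<partial>std_normal_vec \<partial>M)"
    by (rule freeze_nincr_nn[OF n, where N = "borel \<Otimes>\<^sub>M borel"]) measurable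
  also have "\<dots> \<le> (\<integral>\<^sup>+\<omega>. ennreal ((g (s j \<omega> *v nincr n j \<omega>))\<^sup>2) * ennreal Bh \<partial>M)"
  proof (rule nn_integral_mono)
    fix \<omega>
    have "(\<integral>\<^sup>+z. ennreal ((g (s j \<omega> *v nincr n j \<omega>) * h (s j \<omega> *v z))\<^sup>2) \<partial>std_normal_vec)
        = ennreal ((g (s j \<omega> *v nincr n j \<omega>))\<^sup>2) * (\<integral>\<^sup>+z. ennreal ((h (s j \<omega> *v z))\<^sup>2) \<partial>std_normal_vec)"
      by (subst nn_integral_cmult[symmetric]) (auto simp: power_mult_distrib ennreal_mult)
    also have "\<dots> \<le> ennreal ((g (s j \<omega> *v nincr n j \<omega>))\<^sup>2) * ennreal Bh"
      by (intro mult_left_mono Bh s(2)) simp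
    finally show "(\<integral>\<^sup>+z. (\<lambda>p. ennreal ((g (fst (fst p) *v snd (fst p)) * h (fst (fst p) *v snd p))\<^sup>2)) ((s j \<omega>, nincr n j \<omega>), z) \<partial>std_normal_vec)
       \<le> ennreal ((g (s j \<omega> *v nincr n j \<omega>))\<^sup>2) * ennreal Bh" by simp
  qed
  also have "\<dots> = (\<integral>\<^sup>+\<omega>. ennreal ((g (s j \<omega> *v nincr n j \<omega>))\<^sup>2) \<partial>M) * ennreal Bh"
    by (rule nn_integral_multc) measurable
  also have "\<dots> \<le> ennreal Bg * ennreal Bh" by (intro mult_right_mono 1) simp
  finally show "(\<integral>\<^sup>+\<omega>. ennreal ((g (s j \<omega> *v nincr n j \<omega>) * h (s j \<omega> *v nincr n (Suc j) \<omega>))\<^sup>2) \<partial>M) \<le> ennreal (Bg * Bh)"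
    using Bg Bh by (simp add: ennreal_mult)
qed

text \<open>Integrating out \<open>nincr n (Suc j)\<close> replaces the second factor by its
  Gaussian mean, and integrating out \<open>nincr n j\<close> does the same with the first;
  \<open>X\<close> is known before both and will be an earlier \<open>cterm\<close>. The integrands
  have no sign, so each stage requires its own integrability.\<close>

lemma cterm_mean_zero:
  assumes X: "X \<in> borel_measurable (F (real j / real n))" and X2: "(\<integral>\<^sup>+\<omega>. ennreal ((X \<omega>)\<^sup>2) \<partial>M) < \<infinity>"
  shows "integrable M (\<lambda>\<omega>. X \<omega> * cterm g h n s j \<omega>)" "(\<integral>\<omega>. X \<omega> * cterm g h n s j \<omega> \<partial>M) = 0"
proof -
  obtain Bg where Bg: "0 \<le> Bg" "\<And>A :: real ^ 'e ^ 'd. norm A \<le> K \<Longrightarrow> (\<integral>\<^sup>+z. ennreal ((g (A *v z))\<^sup>2) \<partial>std_normal_vec) \<le> ennreal Bg"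
    using growth_second_moment[OF g K] by blast
  obtain Bh where Bh: "0 \<le> Bh" "\<And>A :: real ^ 'e ^ 'd. norm A \<le> K \<Longrightarrow> (\<integral>\<^sup>+z. ennreal ((h (A *v z))\<^sup>2) \<partial>std_normal_vec) \<le> ennreal Bh"
    using growth_second_moment[OF h K] by blast
  obtain Dg where Dg: "0 \<le> Dg" "\<And>A :: real ^ 'e ^ 'd. norm A \<le> K \<Longrightarrow> \<bar>gauss_mean g A\<bar> \<le> Dg"
    using gauss_mean_bounded[OF g K] by blast
  obtain Dh where Dh: "0 \<le> Dh" "\<And>A :: real ^ 'e ^ 'd. norm A \<le> K \<Longrightarrow> \<bar>gauss_mean h A\<bar> \<le> Dh"
    using gauss_mean_bounded[OF h K] by blast
  have [measurable]: "X \<in> borel_measurable M" by (rule measurable_F_M[OF _ X]) simp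
  note X[measurable]
  have [measurable]: "s j \<in> borel_measurable (F (real j / real n))" by (rule s(1))
  have [measurable]: "s j \<in> borel_measurable (F (real (Suc j) / real n))" "nincr n j \<in> borel_measurable (F (real (Suc j) / real n))"
      "X \<in> borel_measurable (F (real (Suc j) / real n))"
    using F_grid_mono[OF s(1)[of j], of "Suc j"] F_grid_mono[OF X, of "Suc j"] measurable_nincr by auto
  have i1: "integrable M (\<lambda>\<omega>. X \<omega> * (g (s j \<omega> *v nincr n j \<omega>) * h (s j \<omega> *v nincr n (Suc j) \<omega>)))"
    by (rule integrable_mult_L2[OF _ _ X2 order_le_less_trans[OF product_second_moment(2)[OF Bg Bh]]]) auto
  have i2: "integrable M (\<lambda>\<omega>. X \<omega> * (g (s j \<omega> *v nincr n j \<omega>) * gauss_mean h (s j \<omega>)))"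
  proof (rule Bochner_Integration.integrable_bound)
    have "integrable M (\<lambda>\<omega>. X \<omega> * g (s j \<omega> *v nincr n j \<omega>))"
      by (rule integrable_mult_L2[OF _ _ X2 order_le_less_trans[OF product_second_moment(1)[OF Bg Bh]]]) auto
    then show "integrable M (\<lambda>\<omega>. Dh * \<bar>X \<omega> * g (s j \<omega> *v nincr n j \<omega>)\<bar>)" by auto
    show "AE \<omega> in M. norm (X \<omega> * (g (s j \<omega> *v nincr n j \<omega>) * gauss_mean h (s j \<omega>))) \<le> norm (Dh * \<bar>X \<omega> * g (s j \<omega> *v nincr n j \<omega>)\<bar>)"
    proof (rule AE_I2)
      fix \<omega>
      have "\<bar>gauss_mean h (s j \<omega>)\<bar> * \<bar>X \<omega> * g (s j \<omega> *v nincr n j \<omega>)\<bar> \<le> Dh * \<bar>X \<omega> * g (s j \<omega> *v nincr n j \<omega>)\<bar>"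
        by (intro mult_right_mono Dh s(2)) simp
      then show "norm (X \<omega> * (g (s j \<omega> *v nincr n j \<omega>) * gauss_mean h (s j \<omega>))) \<le> norm (Dh * \<bar>X \<omega> * g (s j \<omega> *v nincr n j \<omega>)\<bar>)"
        using Dh(1) by (simp add: abs_mult mult_ac)
    qed
  qed measurable
  have "integrable M (\<lambda>\<omega>. X \<omega> * 1)" by (rule integrable_mult_L2[OF _ _ X2]) (auto simp: emeasure_space_1)
  then have iX: "integrable M X" by simp
  have i3: "integrable M (\<lambda>\<omega>. X \<omega> * (gauss_mean g (s j \<omega>) * gauss_mean h (s j \<omega>)))"
  proof (rule Bochner_Integration.integrable_bound)
    show "integrable M (\<lambda>\<omega>. (Dg * Dh) * X \<omega>)" using iX by auto
    show "AE \<omega> in M. norm (X \<omega> * (gauss_mean g (s j \<omega>) * gauss_mean h (s j \<omega>))) \<le> norm ((Dg * Dh) * X \<omega>)"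
    proof (rule AE_I2)
      fix \<omega>
      have "\<bar>gauss_mean g (s j \<omega>)\<bar> * \<bar>gauss_mean h (s j \<omega>)\<bar> * \<bar>X \<omega>\<bar> \<le> (Dg * Dh) * \<bar>X \<omega>\<bar>"
        by (intro mult_right_mono mult_mono Dh Dg s(2)) auto
      then show "norm (X \<omega> * (gauss_mean g (s j \<omega>) * gauss_mean h (s j \<omega>))) \<le> norm ((Dg * Dh) * X \<omega>)"
        using Dg(1) Dh(1) by (simp add: abs_mult mult_ac)
    qed
  qed measurable
  have eq: "X \<omega> * cterm g h n s j \<omega> = X \<omega> * (g (s j \<omega> *v nincr n j \<omega>) * h (s j \<omega> *v nincr n (Suc j) \<omega>))
     - X \<omega> * (gauss_mean g (s j \<omega>) * gauss_mean h (s j \<omega>))" for \<omega>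
    by (simp add: cterm_def right_diff_distrib)
  show "integrable M (\<lambda>\<omega>. X \<omega> * cterm g h n s j \<omega>)" unfolding eq by (intro Bochner_Integration.integrable_diff i1 i3)
  have "(\<integral>\<omega>. X \<omega> * (g (s j \<omega> *v nincr n j \<omega>) * h (s j \<omega> *v nincr n (Suc j) \<omega>)) \<partial>M)
      = (\<integral>\<omega>. (\<lambda>p. fst (fst p) * (g (fst (snd (fst p)) *v snd (snd (fst p))) * h (fst (snd (fst p)) *v snd p))) ((X \<omega>, s j \<omega>, nincr n j \<omega>), nincr n (Suc j) \<omega>) \<partial>M)"
    by simp
  also have "\<dots> = (\<integral>\<omega>. \<integral>z. (\<lambda>p. fst (fst p) * (g (fst (snd (fst p)) *v snd (snd (fst p))) * h (fst (snd (fst p)) *v snd p))) ((X \<omega>, s j \<omega>, nincr n j \<omega>), z) \<partial>std_normal_vec \<partial>M)"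
    by (rule freeze_nincr_integral[OF n, where N = "borel \<Otimes>\<^sub>M (borel \<Otimes>\<^sub>M borel)"]) (measurable, use i1 in simp)
  also have "\<dots> = (\<integral>\<omega>. X \<omega> * (g (s j \<omega> *v nincr n j \<omega>) * gauss_mean h (s j \<omega>)) \<partial>M)"
    by (simp add: gauss_mean_def)
  also have "\<dots> = (\<integral>\<omega>. (\<lambda>p. fst (fst p) * (g (snd (fst p) *v snd p) * gauss_mean h (snd (fst p)))) ((X \<omega>, s j \<omega>), nincr n j \<omega>) \<partial>M)"
    by simp
  also have "\<dots> = (\<integral>\<omega>. \<integral>z. (\<lambda>p. fst (fst p) * (g (snd (fst p) *v snd p) * gauss_mean h (snd (fst p)))) ((X \<omega>, s j \<omega>), z) \<partial>std_normal_vec \<partial>M)"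
    by (rule freeze_nincr_integral[OF n, where N = "borel \<Otimes>\<^sub>M borel"]) (measurable, use i2 in simp)
  also have "\<dots> = (\<integral>\<omega>. X \<omega> * (gauss_mean g (s j \<omega>) * gauss_mean h (s j \<omega>)) \<partial>M)"
    by (simp add: gauss_mean_def[of g])
  finally show "(\<integral>\<omega>. X \<omega> * cterm g h n s j \<omega> \<partial>M) = 0"
    unfolding eq by (simp add: Bochner_Integration.integral_diff[OF i1 i3])
qed

end

text \<open>The matrix of inner products has at most three nonzero entries in each row, each at most
  \<open>C1\<close>, so the second moment of a partial sum grows linearly in the number of terms.
  The constant is uniform in \<open>n\<close> and in the coefficients \<open>s\<close>, which is
  what the maximal inequality requires.\<close>

lemma cterm_moments:
  fixes g h :: "real ^ 'd \<Rightarrow> real"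
  assumes K: "0 \<le> K"
    and g: "continuous_on UNIV g" "0 \<le> Cg" "\<And>x. \<bar>g x\<bar> \<le> Cg * (1 + norm x) ^ mg"
    and h: "continuous_on UNIV h" "0 \<le> Ch" "\<And>x. \<bar>h x\<bar> \<le> Ch * (1 + norm x) ^ mh"
  shows "\<exists>C\<ge>0. \<forall>n\<ge>1. \<forall>s :: nat \<Rightarrow> 'w \<Rightarrow> real ^ 'e ^ 'd.
    (\<forall>j. s j \<in> borel_measurable (F (real j / real n))) \<longrightarrow> (\<forall>j \<omega>. norm (s j \<omega>) \<le> K) \<longrightarrow>
    (\<forall>j. (\<integral>\<^sup>+\<omega>. ennreal ((cterm g h n s j \<omega>)\<^sup>2) \<partial>M) \<le> ennreal C) \<and>
    (\<forall>m. (\<integral>\<^sup>+\<omega>. ennreal ((\<Sum>j<m. cterm g h n s j \<omega>)\<^sup>2) \<partial>M) \<le> ennreal (C * real m))"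
proof -
  obtain Bg where Bg: "0 \<le> Bg" "\<And>A :: real ^ 'e ^ 'd. norm A \<le> K \<Longrightarrow> (\<integral>\<^sup>+z. ennreal ((g (A *v z))\<^sup>2) \<partial>std_normal_vec) \<le> ennreal Bg"
    using growth_second_moment[OF g K] by blast
  obtain Bh where Bh: "0 \<le> Bh" "\<And>A :: real ^ 'e ^ 'd. norm A \<le> K \<Longrightarrow> (\<integral>\<^sup>+z. ennreal ((h (A *v z))\<^sup>2) \<partial>std_normal_vec) \<le> ennreal Bh"
    using growth_second_moment[OF h K] by blast
  obtain Dg where Dg: "0 \<le> Dg" "\<And>A :: real ^ 'e ^ 'd. norm A \<le> K \<Longrightarrow> \<bar>gauss_mean g A\<bar> \<le> Dg"
    using gauss_mean_bounded[OF g K] by blast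
  obtain Dh where Dh: "0 \<le> Dh" "\<And>A :: real ^ 'e ^ 'd. norm A \<le> K \<Longrightarrow> \<bar>gauss_mean h A\<bar> \<le> Dh"
    using gauss_mean_bounded[OF h K] by blast
  define C1 where "C1 = 2 * (Bg * Bh) + 2 * (Dg * Dh)\<^sup>2"
  have C1: "0 \<le> C1" using Bg Bh by (simp add: C1_def)
  have main: "(\<integral>\<^sup>+\<omega>. ennreal ((cterm g h n s j \<omega>)\<^sup>2) \<partial>M) \<le> ennreal (3 * C1) \<and>
      (\<integral>\<^sup>+\<omega>. ennreal ((\<Sum>j<m. cterm g h n s j \<omega>)\<^sup>2) \<partial>M) \<le> ennreal (3 * C1 * real m)"
    if n: "n \<ge> 1" and s: "\<And>j. s j \<in> borel_measurable (F (real j / real n))" "\<And>j \<omega>. norm (s j \<omega>) \<le> K"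
    for n m j and s :: "nat \<Rightarrow> 'w \<Rightarrow> real ^ 'e ^ 'd"
  proof -
    note ctx = K g h n s
    let ?U = "cterm g h n s"
    note [measurable] = cterm_meas_M[OF ctx] g_meas[OF ctx] h_meas[OF ctx] s_meas[OF ctx]
    have sq: "(\<integral>\<^sup>+\<omega>. ennreal ((?U j \<omega>)\<^sup>2) \<partial>M) \<le> ennreal C1" for j
    proof -
      have "(\<integral>\<^sup>+\<omega>. ennreal ((?U j \<omega>)\<^sup>2) \<partial>M)
          \<le> (\<integral>\<^sup>+\<omega>. ennreal 2 * ennreal ((g (s j \<omega> *v nincr n j \<omega>) * h (s j \<omega> *v nincr n (Suc j) \<omega>))\<^sup>2) + ennreal (2 * (Dg * Dh)\<^sup>2) \<partial>M)"
      proof (rule nn_integral_mono)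
        fix \<omega>
        let ?a = "g (s j \<omega> *v nincr n j \<omega>) * h (s j \<omega> *v nincr n (Suc j) \<omega>)" and ?b = "gauss_mean g (s j \<omega>) * gauss_mean h (s j \<omega>)"
        have "\<bar>?b\<bar> \<le> Dg * Dh" unfolding abs_mult by (intro mult_mono Dg Dh s(2)) auto
        then have "?b\<^sup>2 \<le> (Dg * Dh)\<^sup>2" by (metis abs_ge_zero power2_abs power_mono)
        then have "(?U j \<omega>)\<^sup>2 \<le> 2 * ?a\<^sup>2 + 2 * (Dg * Dh)\<^sup>2"
          using norm_diff_sq_le[of ?a ?b 0] by (simp add: cterm_def)
        then have "ennreal ((?U j \<omega>)\<^sup>2) \<le> ennreal (2 * ?a\<^sup>2 + 2 * (Dg * Dh)\<^sup>2)" by (rule ennreal_leI)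
        also have "\<dots> = ennreal 2 * ennreal (?a\<^sup>2) + ennreal (2 * (Dg * Dh)\<^sup>2)"
          by (simp add: ennreal_plus ennreal_mult)
        finally show "ennreal ((?U j \<omega>)\<^sup>2) \<le> ennreal 2 * ennreal (?a\<^sup>2) + ennreal (2 * (Dg * Dh)\<^sup>2)" .
      qed
      also have "\<dots> = ennreal 2 * (\<integral>\<^sup>+\<omega>. ennreal ((g (s j \<omega> *v nincr n j \<omega>) * h (s j \<omega> *v nincr n (Suc j) \<omega>))\<^sup>2) \<partial>M) + ennreal (2 * (Dg * Dh)\<^sup>2)"
        by (subst nn_integral_add, measurable) (subst nn_integral_cmult, auto simp: emeasure_space_1)
      also have "\<dots> \<le> ennreal 2 * ennreal (Bg * Bh) + ennreal (2 * (Dg * Dh)\<^sup>2)"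
        by (intro add_right_mono mult_left_mono product_second_moment(2)[OF ctx Bg Bh] zero_le)
      also have "\<dots> = ennreal C1" using Bg Bh by (simp add: C1_def ennreal_plus ennreal_mult)
      finally show ?thesis .
    qed
    have fin: "(\<integral>\<^sup>+\<omega>. ennreal ((?U j \<omega>)\<^sup>2) \<partial>M) < \<infinity>" for j
      by (rule order_le_less_trans[OF sq]) simp
    have int: "integrable M (\<lambda>\<omega>. ?U i \<omega> * ?U j \<omega>)" for i j
      by (rule integrable_mult_L2[OF _ _ fin fin]) auto
    have diag: "(\<integral>\<omega>. ?U j \<omega> * ?U j \<omega> \<partial>M) \<le> C1" for j
    proof -
      have "ennreal (\<integral>\<omega>. ?U j \<omega> * ?U j \<omega> \<partial>M) = (\<integral>\<^sup>+\<omega>. ennreal (?U j \<omega> * ?U j \<omega>) \<partial>M)"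
        by (rule nn_integral_eq_integral[symmetric, OF int]) simp
      with sq[of j] have "ennreal (\<integral>\<omega>. ?U j \<omega> * ?U j \<omega> \<partial>M) \<le> ennreal C1" by (simp add: power2_eq_square)
      then show ?thesis using C1 by (simp only: ennreal_le_iff)
    qed
    have near: "(\<integral>\<omega>. ?U i \<omega> * ?U j \<omega> \<partial>M) \<le> C1" for i j
    proof -
      have "(\<integral>\<omega>. ?U i \<omega> * ?U j \<omega> \<partial>M) \<le> (\<integral>\<omega>. (?U i \<omega> * ?U i \<omega> + ?U j \<omega> * ?U j \<omega>) / 2 \<partial>M)"
      proof (intro integral_mono int)
        show "integrable M (\<lambda>\<omega>. (?U i \<omega> * ?U i \<omega> + ?U j \<omega> * ?U j \<omega>) / 2)" using int by auto
        fix \<omega> show "?U i \<omega> * ?U j \<omega> \<le> (?U i \<omega> * ?U i \<omega> + ?U j \<omega> * ?U j \<omega>) / 2"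
          using sum_squares_bound[of "?U i \<omega>" "?U j \<omega>"] by (simp add: power2_eq_square)
      qed
      also have "\<dots> = ((\<integral>\<omega>. ?U i \<omega> * ?U i \<omega> \<partial>M) + (\<integral>\<omega>. ?U j \<omega> * ?U j \<omega> \<partial>M)) / 2"
        by (simp add: int)
      also have "\<dots> \<le> C1" using diag[of i] diag[of j] by simp
      finally show ?thesis .
    qed
    have far: "(\<integral>\<omega>. ?U i \<omega> * ?U j \<omega> \<partial>M) = 0" if "i + 2 \<le> j" for i j
      by (rule cterm_mean_zero(2)[OF ctx F_grid_mono[OF ctx cterm_meas[OF ctx]] fin]) (rule that)
    \<comment> \<open>For \<open>i = 0\<close> the truncated \<open>i - 1\<close> is
      \<open>i\<close> again; the set is used only through its cardinality, which is at most
      3.\<close>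
    have le: "(\<integral>\<omega>. ?U i \<omega> * ?U j \<omega> \<partial>M) \<le> (if j \<in> {i - 1, i, i + 1} then C1 else 0)" for i j
    proof (cases "j \<in> {i - 1, i, i + 1}")
      case False
      then have "i + 2 \<le> j \<or> j + 2 \<le> i" by auto
      then show ?thesis using far[of i j] far[of j i] False by (auto simp: mult.commute)
    qed (use near in auto)
    have "integrable M (\<lambda>\<omega>. (\<Sum>j<m. ?U j \<omega>)\<^sup>2)"
      unfolding power2_eq_square sum_product by (intro Bochner_Integration.integrable_sum int)
    then have "(\<integral>\<^sup>+\<omega>. ennreal ((\<Sum>j<m. ?U j \<omega>)\<^sup>2) \<partial>M) = ennreal (\<integral>\<omega>. (\<Sum>j<m. ?U j \<omega>)\<^sup>2 \<partial>M)"
      by (rule nn_integral_eq_integral) simp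
    also have "(\<integral>\<omega>. (\<Sum>j<m. ?U j \<omega>)\<^sup>2 \<partial>M) = (\<Sum>i<m. \<Sum>j<m. \<integral>\<omega>. ?U i \<omega> * ?U j \<omega> \<partial>M)"
      unfolding power2_eq_square sum_product
      by (simp add: Bochner_Integration.integral_sum Bochner_Integration.integrable_sum int)
    also have "\<dots> \<le> (\<Sum>i<m. 3 * C1)"
    proof (rule sum_mono)
      fix i
      have "(\<Sum>j<m. \<integral>\<omega>. ?U i \<omega> * ?U j \<omega> \<partial>M) \<le> (\<Sum>j<m. if j \<in> {i - 1, i, i + 1} then C1 else 0)"
        by (intro sum_mono le)
      also have "\<dots> = C1 * card ({..<m} \<inter> {i - 1, i, i + 1})" by (subst sum.inter_restrict[symmetric]) simp_all
      also have "\<dots> \<le> C1 * 3"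
      proof (intro mult_left_mono C1)
        have "card ({..<m} \<inter> {i - 1, i, i + 1}) \<le> card {i - 1, i, i + 1}" by (intro card_mono) auto
        also have "\<dots> \<le> 3" by (simp add: card_insert_if)
        finally show "real (card ({..<m} \<inter> {i - 1, i, i + 1})) \<le> 3" by simp
      qed
      finally show "(\<Sum>j<m. \<integral>\<omega>. ?U i \<omega> * ?U j \<omega> \<partial>M) \<le> 3 * C1" by simp
    qed
    also have "\<dots> = 3 * C1 * real m" by simp
    finally have "(\<integral>\<^sup>+\<omega>. ennreal ((\<Sum>j<m. ?U j \<omega>)\<^sup>2) \<partial>M) \<le> ennreal (3 * C1 * real m)"
      by (simp add: ennreal_leI)
    moreover have "(\<integral>\<^sup>+\<omega>. ennreal ((?U j \<omega>)\<^sup>2) \<partial>M) \<le> ennreal (3 * C1)"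
      by (rule order_trans[OF sq ennreal_leI]) (use C1 in simp)
    ultimately show ?thesis by blast
  qed
  show ?thesis
    by (rule exI[of _ "3 * C1"]) (use main C1 in auto)
qed

end

section \<open>The integrand sampled on the grid\<close>

locale ito_setting = brownian M F W
  for M :: "'w measure" and F :: "real \<Rightarrow> 'w measure" and W :: "real \<Rightarrow> 'w \<Rightarrow> real ^ 'e" +
  fixes \<sigma> :: "real \<Rightarrow> 'w \<Rightarrow> real ^ 'e ^ 'd" and I :: "real \<Rightarrow> 'w \<Rightarrow> real ^ 'd"
  assumes adapted: "adapted F \<sigma>"
    and cadlag: "\<And>\<omega>. \<omega> \<in> space M \<Longrightarrow> cadlag (\<lambda>t. \<sigma> t \<omega>)"
    and ito: "is_ito_integral M F W (\<lambda>u \<omega>. left_limit (\<lambda>s. \<sigma> s \<omega>) u) I"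
begin

abbreviation H :: "real \<Rightarrow> 'w \<Rightarrow> real ^ 'e ^ 'd" where
  "H u \<omega> \<equiv> left_limit (\<lambda>s. \<sigma> s \<omega>) u"

abbreviation I_incr :: "nat \<Rightarrow> nat \<Rightarrow> 'w \<Rightarrow> real ^ 'd" where
  "I_incr n j \<omega> \<equiv> sqrt (real n) *\<^sub>R (I (real (Suc j) / real n) \<omega> - I (real j / real n) \<omega>)"

lemma sigma_meas_F: "0 \<le> t \<Longrightarrow> \<sigma> t \<in> borel_measurable (F t)"
  using adapted unfolding adapted_def by blast

lemma sigma_meas: "0 \<le> t \<Longrightarrow> \<sigma> t \<in> borel_measurable M"
  using sigma_meas_F measurable_F_M by blast

lemma I_meas: "0 \<le> t \<Longrightarrow> I t \<in> borel_measurable M"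
  using ito unfolding is_ito_integral_def by blast

text \<open>The cell index takes countably many values, so measurability at each fixed time
  suffices. The map \<open>k\<close> covers lagged left ends as well as right ends.\<close>

lemma sigma_grid_joint [measurable]:
  "(\<lambda>p. \<sigma> (real (k (grid_floor n (snd p))) / real n) (fst p)) \<in> borel_measurable (M \<Otimes>\<^sub>M borel)"
proof (rule measurable_compose_countable[where f = "\<lambda>i p. \<sigma> (real (k i) / real n) (fst p)"])
  fix i :: nat
  have [measurable]: "\<sigma> (real (k i) / real n) \<in> borel_measurable M" by (rule sigma_meas) simp
  show "(\<lambda>p. \<sigma> (real (k i) / real n) (fst p)) \<in> borel_measurable (M \<Otimes>\<^sub>M (borel :: real measure))" by measurable
qed measurable

lemma H_joint [measurable]: "(\<lambda>p. H (max 0 (snd p)) (fst p)) \<in> borel_measurable (M \<Otimes>\<^sub>M borel)"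
proof (rule predictable_joint)
  show "sets (F t) \<subseteq> sets M" if "0 \<le> t" for t
    using filtered that unfolding filtered_prob_space_def subalgebra_def by blast
  show "predictable M F H" using ito unfolding is_ito_integral_def by blast
qed

text \<open>Adaptedness gives measurability at fixed times only; a cadlag process is the pointwise
  limit of its samples at the right ends of the cells.\<close>

lemma sigma_joint [measurable]: "(\<lambda>p. \<sigma> (max 0 (snd p)) (fst p)) \<in> borel_measurable (M \<Otimes>\<^sub>M borel)"
proof (rule borel_measurable_LIMSEQ_metric)
  have [measurable]: "\<sigma> 0 \<in> borel_measurable M" by (rule sigma_meas) simp
  show "(\<lambda>p. if 0 < snd p then \<sigma> (real (Suc (grid_floor n (snd p))) / real n) (fst p) else \<sigma> 0 (fst p))
      \<in> borel_measurable (M \<Otimes>\<^sub>M borel)" for n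
    using sigma_grid_joint[of Suc n] by measurable
  fix p assume "p \<in> space (M \<Otimes>\<^sub>M (borel :: real measure))"
  then have p: "fst p \<in> space M" by (auto simp: space_pair_measure)
  show "(\<lambda>n. if 0 < snd p then \<sigma> (real (Suc (grid_floor n (snd p))) / real n) (fst p) else \<sigma> 0 (fst p))
      \<longlonglongrightarrow> \<sigma> (max 0 (snd p)) (fst p)"
  proof (cases "0 < snd p")
    case True
    with grid_right_tendsto[OF cadlag[OF p] True] show ?thesis by simp
  qed (auto simp: max_def)
qed

lemma sigma_path_meas: "\<omega> \<in> space M \<Longrightarrow> (\<lambda>u. \<sigma> (max 0 u) \<omega>) \<in> borel_measurable borel"
  using measurable_compose[OF measurable_Pair1' sigma_joint] by simp

text \<open>At every \<open>u > 0\<close> the samples at left ends, lagged or not, converge to the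
  left limit, which is the integrand itself. Truncation makes the squares bounded.\<close>

lemma lag_tendsto:
  assumes K: "0 \<le> K" and R: "0 \<le> R"
  shows "(\<lambda>n. \<integral>\<^sup>+\<omega>. (\<integral>\<^sup>+u\<in>{0<..R}. nsq (trunc K (H u \<omega>) -
      trunc K (\<sigma> (real (grid_floor n u - l) / real n) \<omega>)) \<partial>lborel) \<partial>M) \<longlonglongrightarrow> 0"
proof -
  let ?f = "\<lambda>n \<omega> u. (norm (trunc K (H (max 0 u) \<omega>) - trunc K (\<sigma> (real (grid_floor n u - l) / real n) \<omega>)))\<^sup>2"
  have "(\<lambda>n. \<integral>\<^sup>+\<omega>. (\<integral>\<^sup>+u\<in>{0<..R}. ennreal (?f n \<omega> u) \<partial>lborel) \<partial>M) \<longlonglongrightarrow> 0"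
  proof (rule set_nn_integral_dominated_zero[OF prob_space_axioms R, where C = "(K + K)\<^sup>2"])
    note [measurable] = borel_measurable_trunc[OF K]
    have [measurable]: "(\<lambda>p. \<sigma> (real (grid_floor n (snd p) - l) / real n) (fst p)) \<in> borel_measurable (M \<Otimes>\<^sub>M borel)" for n
      using sigma_grid_joint[of "\<lambda>i. i - l" n] by simp
    show "(\<lambda>p. ?f n (fst p) (snd p)) \<in> borel_measurable (M \<Otimes>\<^sub>M lborel)" for n by measurable
    fix n \<omega> and u :: real
    have "norm (trunc K (H (max 0 u) \<omega>) - trunc K (\<sigma> (real (grid_floor n u - l) / real n) \<omega>)) \<le> K + K"
      by (intro order_trans[OF norm_triangle_ineq4] add_mono norm_trunc_le K)
    then have "?f n \<omega> u \<le> (K + K)\<^sup>2" by (intro power_mono) auto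
    then show "\<bar>?f n \<omega> u\<bar> \<le> (K + K)\<^sup>2" by simp
  next
    fix \<omega> and u :: real assume \<omega>: "\<omega> \<in> space M" and u: "0 < u"
    have c: "isCont (trunc K) (H u \<omega>)"
    proof -
      have "continuous_on UNIV (trunc K :: real ^ 'e ^ 'd \<Rightarrow> real ^ 'e ^ 'd)" by (rule continuous_on_trunc[OF K])
      then show ?thesis by (simp add: continuous_on_eq_continuous_at)
    qed
    have "(\<lambda>n. trunc K (\<sigma> (real (grid_floor n u - l) / real n) \<omega>)) \<longlonglongrightarrow> trunc K (H u \<omega>)"
      by (rule isCont_tendsto_compose[OF c grid_left_tendsto[OF cadlag[OF \<omega>] u]])
    then have "(\<lambda>n. (norm (trunc K (H u \<omega>) - trunc K (\<sigma> (real (grid_floor n u - l) / real n) \<omega>)))\<^sup>2)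
        \<longlonglongrightarrow> (norm (trunc K (H u \<omega>) - trunc K (H u \<omega>)))\<^sup>2"
      by (intro tendsto_intros)
    then show "(\<lambda>n. ?f n \<omega> u) \<longlonglongrightarrow> 0" using u by (simp add: max_def)
  qed
  moreover have "(\<integral>\<^sup>+\<omega>. (\<integral>\<^sup>+u\<in>{0<..R}. ennreal (?f n \<omega> u) \<partial>lborel) \<partial>M)
      = (\<integral>\<^sup>+\<omega>. (\<integral>\<^sup>+u\<in>{0<..R}. nsq (trunc K (H u \<omega>) -
      trunc K (\<sigma> (real (grid_floor n u - l) / real n) \<omega>)) \<partial>lborel) \<partial>M)" for n
    by (intro nn_integral_cong) (auto split: split_indicator simp: max_def)
  ultimately show ?thesis by simp
qed

text \<open>Right ends are sampled because they converge to \<open>\<sigma> u\<close> at every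
  \<open>u > 0\<close>, jump times included; left ends would lead to the left limit.\<close>

lemma riemann_tendsto:
  fixes \<psi> :: "real ^ 'e ^ 'd \<Rightarrow> real"
  assumes K: "0 \<le> K" and R: "0 \<le> R" and \<psi>: "continuous_on UNIV \<psi>"
  shows "(\<lambda>n. \<integral>\<^sup>+\<omega>. (\<integral>\<^sup>+u\<in>{0<..R}. ennreal \<bar>\<psi> (trunc K (\<sigma> (real (Suc (grid_floor n u)) / real n) \<omega>)) -
      \<psi> (trunc K (\<sigma> (max 0 u) \<omega>))\<bar> \<partial>lborel) \<partial>M) \<longlonglongrightarrow> 0"
proof -
  have "compact (\<psi> ` cball 0 K)"
    by (intro compact_continuous_image continuous_on_subset[OF \<psi>]) auto
  then obtain B where B: "\<And>A. norm A \<le> K \<Longrightarrow> \<bar>\<psi> A\<bar> \<le> B"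
    using compact_imp_bounded[of "\<psi> ` cball 0 K"] unfolding bounded_iff by fastforce
  note [measurable] = borel_measurable_trunc[OF K] borel_measurable_continuous_onI[OF \<psi>]
  show ?thesis
  proof (rule set_nn_integral_dominated_zero[OF prob_space_axioms R, where C = "2 * B"])
    show "(\<lambda>p. \<bar>\<psi> (trunc K (\<sigma> (real (Suc (grid_floor n (snd p))) / real n) (fst p))) -
      \<psi> (trunc K (\<sigma> (max 0 (snd p)) (fst p)))\<bar>) \<in> borel_measurable (M \<Otimes>\<^sub>M lborel)" for n
      using sigma_grid_joint[of Suc n] by measurable
    show "\<bar>\<bar>\<psi> (trunc K (\<sigma> (real (Suc (grid_floor n u)) / real n) \<omega>)) - \<psi> (trunc K (\<sigma> (max 0 u) \<omega>))\<bar>\<bar> \<le> 2 * B" for n \<omega> u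
      using B[OF norm_trunc_le[OF K, of "\<sigma> (real (Suc (grid_floor n u)) / real n) \<omega>"]]
        B[OF norm_trunc_le[OF K, of "\<sigma> (max 0 u) \<omega>"]] by linarith
    fix \<omega> and u :: real assume \<omega>: "\<omega> \<in> space M" and u: "0 < u"
    have "continuous_on UNIV (\<lambda>x. \<psi> (trunc K x))"
      by (rule continuous_on_compose2[OF \<psi> continuous_on_trunc[OF K]]) auto
    then have c: "isCont (\<lambda>x. \<psi> (trunc K x)) (\<sigma> u \<omega>)" by (simp add: continuous_on_eq_continuous_at)
    have "(\<lambda>n. \<psi> (trunc K (\<sigma> (real (Suc (grid_floor n u)) / real n) \<omega>))) \<longlonglongrightarrow> \<psi> (trunc K (\<sigma> u \<omega>))"
      by (rule isCont_tendsto_compose[OF c grid_right_tendsto[OF cadlag[OF \<omega>] u]])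
    then have "(\<lambda>n. \<bar>\<psi> (trunc K (\<sigma> (real (Suc (grid_floor n u)) / real n) \<omega>)) - \<psi> (trunc K (\<sigma> u \<omega>))\<bar>)
       \<longlonglongrightarrow> \<bar>\<psi> (trunc K (\<sigma> u \<omega>)) - \<psi> (trunc K (\<sigma> u \<omega>))\<bar>"
      by (intro tendsto_intros)
    then show "(\<lambda>n. \<bar>\<psi> (trunc K (\<sigma> (real (Suc (grid_floor n u)) / real n) \<omega>)) - \<psi> (trunc K (\<sigma> (max 0 u) \<omega>))\<bar>) \<longlonglongrightarrow> 0"
      using u by (simp add: max_def)
  qed
qed

text \<open>The paths are bounded on compact intervals, so the events that some rational time up to
  \<open>R + 1\<close> has a value above \<open>k\<close> decrease to the empty set. Rational times
  keep these events measurable; right-continuity and left limits carry the bound over to all of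
  \<open>[0, R]\<close> and to \<open>H\<close>.\<close>

lemma sigma_bounded_event:
  assumes R: "0 \<le> R" and \<delta>: "0 < \<delta>"
  obtains K B where "0 \<le> K" "B \<in> sets M" "measure M B \<le> \<delta>"
    "\<And>\<omega> u. \<omega> \<in> space M - B \<Longrightarrow> 0 \<le> u \<Longrightarrow> u \<le> R \<Longrightarrow> norm (\<sigma> u \<omega>) \<le> K"
    "\<And>\<omega> u. \<omega> \<in> space M - B \<Longrightarrow> 0 < u \<Longrightarrow> u \<le> R \<Longrightarrow> norm (H u \<omega>) \<le> K"
proof -
  \<comment> \<open>The additional unit provides rational times to the right of \<open>R\<close>,
    from which the value at \<open>R\<close> is approached.\<close>
  define Q where "Q = \<rat> \<inter> {0..R + 1}"
  have Q: "countable Q" "\<And>q. q \<in> Q \<Longrightarrow> 0 \<le> q" unfolding Q_def by (auto intro: countable_Int1 countable_rat)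
  define E where "E k = (\<Union>q\<in>Q. {\<omega>\<in>space M. real k < norm (\<sigma> q \<omega>)})" for k :: nat
  have E: "E k \<in> sets M" for k
    unfolding E_def
  proof (rule sets.countable_UN'[OF Q(1)], rule image_subsetI)
    fix q assume "q \<in> Q"
    then have [measurable]: "\<sigma> q \<in> borel_measurable M" by (intro sigma_meas Q)
    show "{\<omega>\<in>space M. real k < norm (\<sigma> q \<omega>)} \<in> sets M" by measurable
  qed
  have "(\<Inter>k. E k) = {}"
  proof (rule ccontr)
    assume "(\<Inter>k. E k) \<noteq> {}"
    then obtain \<omega> where \<omega>: "\<And>k. \<omega> \<in> E k" by blast
    then have "\<omega> \<in> space M" by (auto simp: E_def)
    from cadlag_bounded[OF cadlag[OF this], of "R + 1"] R
    obtain b where b: "\<And>u. 0 \<le> u \<Longrightarrow> u \<le> R + 1 \<Longrightarrow> norm (\<sigma> u \<omega>) \<le> b"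
      unfolding bounded_iff by fastforce
    obtain k :: nat where "b < real k" using reals_Archimedean2 by blast
    with \<omega>[of k] b show False unfolding E_def Q_def by force
  qed
  moreover have "decseq E" unfolding decseq_def E_def by force
  ultimately have "(\<lambda>k. measure M (E k)) \<longlonglongrightarrow> 0"
    using finite_Lim_measure_decseq[of E] E by auto
  then have "\<forall>\<^sub>F k in sequentially. measure M (E k) < \<delta>" using \<delta> by (rule order_tendstoD(2))
  then obtain k where k: "measure M (E k) < \<delta>" unfolding eventually_sequentially by blast
  have s: "norm (\<sigma> u \<omega>) \<le> real k" if \<omega>: "\<omega> \<in> space M - E k" and u: "0 \<le> u" "u \<le> R" for \<omega> u
  proof (rule ccontr)
    assume c: "\<not> norm (\<sigma> u \<omega>) \<le> real k"
    have "((\<lambda>t. \<sigma> t \<omega>) \<longlongrightarrow> \<sigma> u \<omega>) (at_right u)" using cadlag \<omega> u unfolding cadlag_def by blast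
    from tendsto_norm[OF this] have "\<forall>\<^sub>F t in at_right u. real k < norm (\<sigma> t \<omega>)"
      by (rule order_tendstoD(1)) (use c in simp)
    then obtain b where b: "u < b" "\<And>t. u < t \<Longrightarrow> t < b \<Longrightarrow> real k < norm (\<sigma> t \<omega>)"
      unfolding eventually_at_right_field by blast
    obtain q where q: "q \<in> \<rat>" "u < q" "q < min b (R + 1)"
      using Rats_dense_in_real[of u "min b (R + 1)"] b(1) u by auto
    then have "q \<in> Q" using u by (simp add: Q_def)
    with b(2)[of q] q \<omega> show False by (auto simp: E_def)
  qed
  have h: "norm (H u \<omega>) \<le> real k" if \<omega>: "\<omega> \<in> space M - E k" and u: "0 < u" "u \<le> R" for \<omega> u
  proof (rule tendsto_upperbound)
    show "((\<lambda>t. norm (\<sigma> t \<omega>)) \<longlongrightarrow> norm (H u \<omega>)) (at_left u)"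
      by (rule tendsto_norm[OF cadlag_left_limit]) (use cadlag \<omega> u in auto)
    show "\<forall>\<^sub>F t in at_left u. norm (\<sigma> t \<omega>) \<le> real k"
      unfolding eventually_at_left_field by (rule exI[of _ 0]) (use s[OF \<omega>] u in auto)
  qed simp
  show ?thesis by (rule that[of "real k" "E k"]) (use E k s h in auto)
qed

text \<open>For each \<open>n\<close> a separate truncated simple process is chosen, and
  \<open>X n j\<close> is the normalised increment of its integral. The sub-Gaussian bound is
  uniform in \<open>n\<close> and \<open>j\<close>. The lag \<open>l\<close> is 0 when the
  coefficient is frozen at the start of the cell itself and 1 when it is frozen one cell
  earlier.\<close>

lemma increments_approximation:
  assumes K: "0 \<le> K"
    and B: "\<And>\<omega> u. \<omega> \<in> space M - B \<Longrightarrow> 0 < u \<Longrightarrow> u \<le> real (T + 1) \<Longrightarrow> norm (H u \<omega>) \<le> K"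
  obtains X :: "nat \<Rightarrow> nat \<Rightarrow> 'w \<Rightarrow> real ^ 'd" where
    "\<And>n j. X n j \<in> borel_measurable M"
    "\<And>n j l. (\<integral>\<^sup>+\<omega>. ennreal (exp (l \<bullet> X n j \<omega>)) \<partial>M) \<le> ennreal (exp ((norm l)\<^sup>2 * (K\<^sup>2 / 2)))"
    "\<And>l. (\<lambda>n. \<integral>\<^sup>+\<omega>. (\<Sum>j<n * (T + 1). nsq (X n j \<omega> /\<^sub>R sqrt (real n) - trunc K (\<sigma> (real (j - l) / real n) \<omega>) *v
        W_incr n j \<omega>)) \<partial>M) \<longlonglongrightarrow> 0"
    "\<And>n. n \<ge> 1 \<Longrightarrow> \<exists>A\<in>sets M. measure M A \<le> 1 / real n \<and> (\<forall>\<omega>\<in>space M - A - B. \<forall>j<n * (T + 1).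
        norm (X n j \<omega> - I_incr n j \<omega>) \<le> 1 / real n)"
proof -
  define R where "R = real (T + 1)"
  have R: "0 \<le> R" by (simp add: R_def)
  define D where "D n = (\<lambda>j. real j / real n) ` {..n * (T + 1)}" for n :: nat
  have D: "finite (D n)" "D n \<subseteq> {0..R}" if "n \<ge> 1" for n
  proof -
    show "D n \<subseteq> {0..R}"
    proof
      fix x assume "x \<in> D n"
      then obtain j where j: "x = real j / real n" "j \<le> n * (T + 1)" by (auto simp: D_def)
      then have "real j \<le> real (n * (T + 1))" by (simp only: of_nat_le_iff)
      then have "real j \<le> real n * R" by (simp only: R_def of_nat_mult)
      then have "x \<le> R" using that j(1) by (simp add: divide_le_eq mult.commute)
      with j show "x \<in> {0..R}" by simp
    qed
  qed (simp add: D_def)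
  \<comment> \<open>An increment involves two grid values with error \<open>1 / (2 * n^2)\<close>
    each, and normalisation multiplies by \<open>sqrt n \<le> n\<close>; in total this is at most
    \<open>1 / n\<close>.\<close>
  have "\<forall>n\<in>{1..}. \<exists>N \<tau> \<xi> A. simple_integrand M F N \<tau> \<xi> \<and> (\<forall>i \<omega>. norm (\<xi> i \<omega> :: real ^ 'e ^ 'd) \<le> K) \<and>
    A \<in> sets M \<and> measure M A \<le> 1 / (2 * (real n)\<^sup>2) \<and>
    (\<forall>\<omega>\<in>space M - A - B. \<forall>s\<in>D n. norm (simple_integral W N \<tau> \<xi> s \<omega> - I s \<omega>) \<le> 1 / (2 * (real n)\<^sup>2)) \<and>
    (\<integral>\<^sup>+\<omega>. (\<integral>\<^sup>+u\<in>{0<..R}. nsq (simple_process N \<tau> \<xi> u \<omega> - trunc K (H u \<omega>)) \<partial>lborel) \<partial>M) \<le> ennreal (1 / (2 * (real n)\<^sup>2))"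
    (is "\<forall>n\<in>_. \<exists>N \<tau> \<xi> A. ?P n N \<tau> \<xi> A")
  proof
    fix n :: nat assume n: "n \<in> {1..}"
    then have e: "0 < 1 / (2 * (real n)\<^sup>2)" and n1: "n \<ge> 1" by auto
    show "\<exists>N \<tau> \<xi> A. ?P n N \<tau> \<xi> A"
    proof (rule truncated_approximation[OF ito K R _ D[OF n1] e])
      show "norm (H u \<omega>) \<le> K" if "\<omega> \<in> space M - B" "0 < u" "u \<le> R" for \<omega> u
        using B that by (simp add: R_def)
      fix N \<tau> \<xi> A
      assume "simple_integrand M F N \<tau> \<xi>" "\<And>i \<omega>. norm (\<xi> i \<omega> :: real ^ 'e ^ 'd) \<le> K" "A \<in> sets M" "measure M A \<le> 1 / (2 * (real n)\<^sup>2)"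
        "\<And>\<omega> s. \<omega> \<in> space M - A - B \<Longrightarrow> s \<in> D n \<Longrightarrow> norm (simple_integral W N \<tau> \<xi> s \<omega> - I s \<omega>) \<le> 1 / (2 * (real n)\<^sup>2)"
        "(\<integral>\<^sup>+\<omega>. (\<integral>\<^sup>+u\<in>{0<..R}. nsq (simple_process N \<tau> \<xi> u \<omega> - trunc K (H u \<omega>)) \<partial>lborel) \<partial>M) \<le> ennreal (1 / (2 * (real n)\<^sup>2))"
      then show ?thesis by (intro exI[of _ N] exI[of _ \<tau>] exI[of _ \<xi>] exI[of _ A] conjI allI ballI)
    qed
  qed
  from bchoice[OF this] obtain N where "\<forall>n\<in>{1..}. \<exists>\<tau> \<xi> A. ?P n (N n) \<tau> \<xi> A" ..
  from bchoice[OF this] obtain \<tau> where "\<forall>n\<in>{1..}. \<exists>\<xi> A. ?P n (N n) (\<tau> n) \<xi> A" ..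
  from bchoice[OF this] obtain \<xi> where "\<forall>n\<in>{1..}. \<exists>A. ?P n (N n) (\<tau> n) (\<xi> n) A" ..
  from bchoice[OF this] obtain A where P: "\<forall>n\<in>{1..}. ?P n (N n) (\<tau> n) (\<xi> n) (A n)" ..
  have P: "?P n (N n) (\<tau> n) (\<xi> n) (A n)" if "n \<ge> 1" for n using bspec[OF P, of n] that by simp
  have si: "simple_integrand M F (N n) (\<tau> n) (\<xi> n)" and xi: "norm (\<xi> n i \<omega>) \<le> K"
    and A: "A n \<in> sets M" "measure M (A n) \<le> 1 / (2 * (real n)\<^sup>2)"
    and cl: "\<omega> \<in> space M - A n - B \<Longrightarrow> s \<in> D n \<Longrightarrow> norm (simple_integral W (N n) (\<tau> n) (\<xi> n) s \<omega> - I s \<omega>) \<le> 1 / (2 * (real n)\<^sup>2)"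
    and mean: "(\<integral>\<^sup>+\<omega>. (\<integral>\<^sup>+u\<in>{0<..R}. nsq (simple_process (N n) (\<tau> n) (\<xi> n) u \<omega> - trunc K (H u \<omega>)) \<partial>lborel) \<partial>M) \<le> ennreal (1 / (2 * (real n)\<^sup>2))"
    if "n \<ge> 1" for n i \<omega> s
    using P[OF that] by blast+
  define J where "J n s \<omega> = simple_integral W (N n) (\<tau> n) (\<xi> n) s \<omega>" for n s \<omega>
  \<comment> \<open>The value 0 for \<open>n = 0\<close> lets measurability and the exponential
    bound hold for all \<open>n\<close>.\<close>
  define X where "X n j \<omega> = (if n \<ge> 1 then sqrt (real n) *\<^sub>R (J n (real (Suc j) / real n) \<omega> - J n (real j / real n) \<omega>) else 0)" for n j \<omega>
  have Jm: "J n s \<in> borel_measurable M" if "n \<ge> 1" "0 \<le> s" for n s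
    unfolding J_def[abs_def] by (rule simple_integral_measurable[OF si[OF that(1)] that(2)])
  have Xm: "X n j \<in> borel_measurable M" for n j
  proof (cases "n \<ge> 1")
    case True
    note Jm[OF True, measurable]
    show ?thesis using True unfolding X_def[abs_def] by simp
  qed (simp add: X_def[abs_def])
  have Xexp: "(\<integral>\<^sup>+\<omega>. ennreal (exp (l \<bullet> X n j \<omega>)) \<partial>M) \<le> ennreal (exp ((norm l)\<^sup>2 * (K\<^sup>2 / 2)))" for n j l
  proof (cases "n \<ge> 1")
    case True
    have le: "real j / real n \<le> real (Suc j) / real n" by (intro divide_right_mono) auto
    have "(\<integral>\<^sup>+\<omega>. ennreal (exp (l \<bullet> X n j \<omega>)) \<partial>M)
        = (\<integral>\<^sup>+\<omega>. ennreal (exp ((sqrt (real n) *\<^sub>R l) \<bullet> (J n (real (Suc j) / real n) \<omega> - J n (real j / real n) \<omega>))) \<partial>M)"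
      using True by (simp add: X_def)
    also have "\<dots> \<le> ennreal (exp ((norm (sqrt (real n) *\<^sub>R l))\<^sup>2 * (K\<^sup>2 * (real (Suc j) / real n - real j / real n) / 2)))"
      unfolding J_def by (rule simple_integral_exp_moment[OF si[OF True] _ le xi[OF True] K]) simp
    also have "(norm (sqrt (real n) *\<^sub>R l))\<^sup>2 * (K\<^sup>2 * (real (Suc j) / real n - real j / real n) / 2) = (norm l)\<^sup>2 * (K\<^sup>2 / 2)"
      using True by (simp add: power_mult_distrib add_divide_distrib)
    finally show ?thesis .
  next
    case False
    have "0 \<le> (norm l)\<^sup>2 * (K\<^sup>2 / 2)" by simp
    then have "ennreal 1 \<le> ennreal (exp ((norm l)\<^sup>2 * (K\<^sup>2 / 2)))" by (intro ennreal_leI) simp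
    then show ?thesis using False by (simp add: X_def emeasure_space_1)
  qed
  have lim: "(\<lambda>n. \<integral>\<^sup>+\<omega>. (\<Sum>j<n * (T + 1). nsq (X n j \<omega> /\<^sub>R sqrt (real n) - trunc K (\<sigma> (real (j - l) / real n) \<omega>) *v
        W_incr n j \<omega>)) \<partial>M) \<longlonglongrightarrow> 0" (is "?S \<longlonglongrightarrow> 0") for l
  \<comment> \<open>The upper bound is the error of the simple process, at most
    \<open>1 / (2 * n^2)\<close>, plus the error of replacing the integrand by its grid
    samples.\<close>
  proof (rule tendsto_sandwich[where f = "\<lambda>_. 0"])
    let ?L = "\<lambda>n. \<integral>\<^sup>+\<omega>. (\<integral>\<^sup>+u\<in>{0<..R}. nsq (trunc K (H u \<omega>) -
      trunc K (\<sigma> (real (grid_floor n u - l) / real n) \<omega>)) \<partial>lborel) \<partial>M"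
    have "(\<lambda>n. 1 / (2 * (real n)\<^sup>2)) \<longlonglongrightarrow> 0"
      by (intro tendsto_divide_0[OF tendsto_const] filterlim_at_top_imp_at_infinity
          filterlim_tendsto_pos_mult_at_top[OF tendsto_const] filterlim_pow_at_top filterlim_real_sequentially) auto
    then have "(\<lambda>n. ennreal (1 / (2 * (real n)\<^sup>2))) \<longlonglongrightarrow> 0" using tendsto_ennrealI by fastforce
    then have "(\<lambda>n. ennreal (2 * m2 TYPE('e)) * (ennreal (1 / (2 * (real n)\<^sup>2)) + ?L n)) \<longlonglongrightarrow> ennreal (2 * m2 TYPE('e)) * (0 + 0)"
      by (intro ennreal_tendsto_cmult tendsto_add lag_tendsto K R) auto
    then show "(\<lambda>n. ennreal (2 * m2 TYPE('e)) * (ennreal (1 / (2 * (real n)\<^sup>2)) + ?L n)) \<longlonglongrightarrow> 0" by simp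
    show "\<forall>\<^sub>F n in sequentially. ?S n \<le> ennreal (2 * m2 TYPE('e)) * (ennreal (1 / (2 * (real n)\<^sup>2)) + ?L n)"
      using eventually_ge_at_top[of 1]
    proof eventually_elim
      case (elim n)
      let ?\<zeta> = "\<lambda>j \<omega>. trunc K (\<sigma> (real (j - l) / real n) \<omega>)"
      note [measurable] = borel_measurable_trunc[OF K]
      have z: "?\<zeta> j \<in> borel_measurable (F (real j / real n))" for j
      proof -
        have "\<sigma> (real (j - l) / real n) \<in> borel_measurable (F (real j / real n))"
          by (rule measurable_F_mono[OF _ _ sigma_meas_F]) (auto intro: divide_right_mono)
        then show ?thesis by measurable
      qed
      have zM: "?\<zeta> j \<in> borel_measurable M" for j by (rule measurable_F_M[OF _ z]) simp
      have WM: "W (real j / real n) \<in> borel_measurable M" for j by (rule measurable_W_M) simp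
      have nm: "real (n * (T + 1)) / real n = R" using elim by (simp only: R_def of_nat_mult) simp
      have sc: "X n j \<omega> /\<^sub>R sqrt (real n) = J n (real (Suc j) / real n) \<omega> - J n (real j / real n) \<omega>" for j \<omega>
        using elim by (simp add: X_def)
      \<comment> \<open>On \<open>(0, R]\<close> the maximum with 0 changes nothing; outside it
        makes the integrand jointly measurable on the whole line.\<close>
      have e1: "(\<integral>\<^sup>+\<omega>. (\<integral>\<^sup>+u\<in>{0<..R}. nsq (simple_process (N n) (\<tau> n) (\<xi> n) u \<omega> - trunc K (H (max 0 u) \<omega>)) \<partial>lborel) \<partial>M)
          = (\<integral>\<^sup>+\<omega>. (\<integral>\<^sup>+u\<in>{0<..R}. nsq (simple_process (N n) (\<tau> n) (\<xi> n) u \<omega> - trunc K (H u \<omega>)) \<partial>lborel) \<partial>M)"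
        by (intro nn_integral_cong) (auto split: split_indicator simp: max_def)
      have e2: "(\<integral>\<^sup>+\<omega>. (\<integral>\<^sup>+u\<in>{0<..R}. nsq (trunc K (H (max 0 u) \<omega>) - ?\<zeta> (grid_floor n u) \<omega>) \<partial>lborel) \<partial>M) = ?L n"
        by (intro nn_integral_cong) (auto split: split_indicator simp: max_def)
      have "?S n = (\<Sum>j<n * (T + 1). \<integral>\<^sup>+\<omega>. nsq (X n j \<omega> /\<^sub>R sqrt (real n) - ?\<zeta> j \<omega> *v
        W_incr n j \<omega>) \<partial>M)"
      proof (rule nn_integral_sum)
        fix j
        note [measurable] = Xm[of n j] zM[of j] WM[of j] WM[of "Suc j"]
        show "(\<lambda>\<omega>. nsq (X n j \<omega> /\<^sub>R sqrt (real n) - ?\<zeta> j \<omega> *v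
          W_incr n j \<omega>)) \<in> borel_measurable M" by measurable
      qed
      also have "\<dots> \<le> ennreal (2 * m2 TYPE('e)) * ((\<integral>\<^sup>+\<omega>. (\<integral>\<^sup>+u\<in>{0<..real (n * (T + 1)) / real n}.
            nsq (simple_process (N n) (\<tau> n) (\<xi> n) u \<omega> - trunc K (H (max 0 u) \<omega>)) \<partial>lborel) \<partial>M)
          + (\<integral>\<^sup>+\<omega>. (\<integral>\<^sup>+u\<in>{0<..real (n * (T + 1)) / real n}. nsq (trunc K (H (max 0 u) \<omega>) - ?\<zeta> (grid_floor n u) \<omega>) \<partial>lborel) \<partial>M))"
        unfolding sc J_def by (rule grid_second_moment[OF si[OF elim] elim z]) measurable
      also have "\<dots> = ennreal (2 * m2 TYPE('e)) * ((\<integral>\<^sup>+\<omega>. (\<integral>\<^sup>+u\<in>{0<..R}.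
            nsq (simple_process (N n) (\<tau> n) (\<xi> n) u \<omega> - trunc K (H u \<omega>)) \<partial>lborel) \<partial>M) + ?L n)"
        unfolding nm e1 e2 ..
      also have "\<dots> \<le> ennreal (2 * m2 TYPE('e)) * (ennreal (1 / (2 * (real n)\<^sup>2)) + ?L n)"
        by (intro mult_left_mono add_right_mono mean elim zero_le)
      finally show ?case .
    qed
  qed auto
  have close: "\<exists>A\<in>sets M. measure M A \<le> 1 / real n \<and> (\<forall>\<omega>\<in>space M - A - B. \<forall>j<n * (T + 1).
        norm (X n j \<omega> - I_incr n j \<omega>) \<le> 1 / real n)" if n: "n \<ge> 1" for n
  proof (intro bexI[of _ "A n"] conjI ballI allI impI A n)
    have n1: "1 \<le> real n" using n by simp
    have "real n \<le> (real n)\<^sup>2" using n1 by (rule self_le_power) simp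
    then have "real n \<le> 2 * (real n)\<^sup>2" using n1 by linarith
    then have "1 / (2 * (real n)\<^sup>2) \<le> 1 / real n" using n1 by (intro divide_left_mono) auto
    with A(2)[OF n] show "measure M (A n) \<le> 1 / real n" by linarith
    fix \<omega> j assume \<omega>: "\<omega> \<in> space M - A n - B" and j: "j < n * (T + 1)"
    have d: "real j / real n \<in> D n" "real (Suc j) / real n \<in> D n"
      using j unfolding D_def by (auto intro!: imageI simp del: of_nat_Suc)
    let ?a = "J n (real (Suc j) / real n) \<omega> - I (real (Suc j) / real n) \<omega>"
      and ?b = "J n (real j / real n) \<omega> - I (real j / real n) \<omega>"
    have "norm ?a \<le> 1 / (2 * (real n)\<^sup>2)" "norm ?b \<le> 1 / (2 * (real n)\<^sup>2)"
      unfolding J_def using cl[OF n \<omega>] d by auto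
    then have "norm (?a - ?b) \<le> 1 / (2 * (real n)\<^sup>2) + 1 / (2 * (real n)\<^sup>2)"
      using norm_triangle_ineq4[of ?a ?b] by linarith
    also have "\<dots> = 1 / (real n)\<^sup>2" by (simp add: field_simps)
    finally have ab: "norm (?a - ?b) \<le> 1 / (real n)\<^sup>2" .
    have "X n j \<omega> - I_incr n j \<omega> = sqrt (real n) *\<^sub>R (?a - ?b)"
      using n by (simp add: X_def algebra_simps)
    then have "norm (X n j \<omega> - I_incr n j \<omega>) = sqrt (real n) * norm (?a - ?b)"
      by simp
    also have "\<dots> \<le> real n * (1 / (real n)\<^sup>2)"
    proof (intro mult_mono ab)
      show "sqrt (real n) \<le> real n" using n1 by (intro real_le_lsqrt self_le_power) auto
    qed auto
    also have "\<dots> = 1 / real n" using n1 by (simp add: power2_eq_square)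
    finally show "norm (X n j \<omega> - I_incr n j \<omega>) \<le> 1 / real n" .
  qed
  show ?thesis by (rule that[OF Xm Xexp lim close])
qed

end

section \<open>Riemann sums and the drift\<close>

text \<open>The sum samples at left ends, the assumption at right ends; shifting the index exchanges
  two values and costs \<open>2 * B / n\<close>. The incomplete cell before \<open>s\<close> costs
  another \<open>B / n\<close>, and the full cells cost \<open>q\<close>. The bound is the same for
  all \<open>s\<close> up to \<open>T\<close>, which gives uniformity in time.\<close>

lemma riemann_sum_bound:
  fixes \<phi> :: "real \<Rightarrow> real"
  assumes [measurable]: "\<phi> \<in> borel_measurable borel" and bnd: "\<And>u. \<bar>\<phi> u\<bar> \<le> B"
    and n: "n \<ge> 1" and s: "0 \<le> s" "s \<le> T" and q: "0 \<le> q"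
    and le: "(\<integral>\<^sup>+u\<in>{0<..T}. ennreal \<bar>\<phi> (real (Suc (grid_floor n u)) / real n) - \<phi> u\<bar> \<partial>lborel) \<le> ennreal q"
  shows "\<bar>(1 / real n) * (\<Sum>j<nat \<lfloor>real n * s\<rfloor>. \<phi> (real j / real n)) - (LINT u:{0..s}|lborel. \<phi> u)\<bar> \<le> 3 * B / real n + q"
proof -
  define m where "m = nat \<lfloor>real n * s\<rfloor>"
  have n0: "0 < real n" using n by simp
  have B: "0 \<le> B" using bnd[of 0] by linarith
  have m: "real m \<le> real n * s" "real n * s < real m + 1"
    using s n0 by (auto simp: m_def)
  then have ms: "real m / real n \<le> s" "s - real m / real n \<le> 1 / real n"
  proof -
    show "real m / real n \<le> s" using m(1) n0 by (simp add: divide_le_eq mult.commute)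
    have "s \<le> (real m + 1) / real n" using m(2) n0 by (simp add: le_divide_eq mult.commute)
    then show "s - real m / real n \<le> 1 / real n" by (simp add: add_divide_distrib)
  qed
  let ?t = "\<lambda>j. real j / real n"
  have tle: "?t j \<le> ?t (Suc j)" for j by (intro divide_right_mono) auto
  define F1 where "F1 u = (\<Sum>j<m. indicator {?t j<..?t (Suc j)} u * \<phi> (?t (Suc j)))" for u :: real
  define F2 where "F2 u = indicator {0..s} u * \<phi> u" for u :: real
  have ti: "integrable lborel (\<lambda>u. indicator {?t j<..?t (Suc j)} u * \<phi> (?t (Suc j)))" for j
    using tle[of j] by (intro integrable_mult_left integrable_real_indicator) (auto simp: emeasure_lborel_Ioc)
  have int1: "integrable lborel F1" unfolding F1_def[abs_def] by (intro Bochner_Integration.integrable_sum ti)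
  have I1: "(\<integral>u. F1 u \<partial>lborel) = (1 / real n) * (\<Sum>j<m. \<phi> (?t (Suc j)))"
  proof -
    have "(\<integral>u. F1 u \<partial>lborel) = (\<Sum>j<m. \<integral>u. indicator {?t j<..?t (Suc j)} u * \<phi> (?t (Suc j)) \<partial>lborel)"
      unfolding F1_def by (rule Bochner_Integration.integral_sum[OF ti])
    also have "\<dots> = (\<Sum>j<m. (1 / real n) * \<phi> (?t (Suc j)))"
    proof (intro sum.cong refl)
      fix j
      have "measure lborel {?t j<..?t (Suc j)} = 1 / real n"
        using tle[of j] by (simp add: add_divide_distrib)
      then show "(\<integral>u. indicator {?t j<..?t (Suc j)} u * \<phi> (?t (Suc j)) \<partial>lborel) = (1 / real n) * \<phi> (?t (Suc j))"
        by simp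
    qed
    finally show ?thesis by (simp add: sum_distrib_left)
  qed
  have int2: "integrable lborel F2"
  proof (rule Bochner_Integration.integrable_bound[where f = "\<lambda>u. B * indicator {0..s} u"])
    show "integrable lborel (\<lambda>u. B * indicator {0..s} u)"
      using s by (intro integrable_mult_right integrable_real_indicator) (auto simp: emeasure_lborel_Icc)
    show "F2 \<in> borel_measurable lborel" unfolding F2_def[abs_def] by measurable
    show "AE u in lborel. norm (F2 u) \<le> norm (B * indicator {0..s} u)"
      using bnd B by (intro AE_I2) (auto simp: F2_def split: split_indicator)
  qed
  have F1: "F1 u = indicator {0<..?t m} u * \<phi> (?t (Suc (grid_floor n u)))" for u
  proof (cases "u \<in> {0<..?t m}")
    case True
    let ?i = "grid_floor n u"
    have u: "0 < u" using True by simp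
    note gb = grid_floor_bounds[OF n u]
    have "?t ?i < ?t m" using gb(1) True by auto
    then have im: "?i < m" using n0 by (simp add: divide_less_cancel)
    have "F1 u = (\<Sum>j<m. if j = ?i then \<phi> (?t (Suc ?i)) else 0)"
      unfolding F1_def
    proof (intro sum.cong refl)
      fix j
      show "indicator {?t j<..?t (Suc j)} u * \<phi> (?t (Suc j)) = (if j = ?i then \<phi> (?t (Suc ?i)) else 0)"
      proof (cases "u \<in> {?t j<..?t (Suc j)}")
        case True
        with grid_floor_eq[OF n True] show ?thesis by (simp only: indicator_simps mult_1_left if_True refl)
      next
        case False
        with gb(3) have "j \<noteq> ?i" by blast
        with False show ?thesis by (simp only: indicator_simps not_False_eq_True mult_zero_left if_False)
      qed
    qed
    also have "\<dots> = \<phi> (?t (Suc ?i))" using im by simp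
    finally show ?thesis using True by simp
  next
    case False
    have "u \<notin> {?t j<..?t (Suc j)}" if "j < m" for j
    proof
      assume u: "u \<in> {?t j<..?t (Suc j)}"
      have "0 \<le> ?t j" "?t (Suc j) \<le> ?t m" using that by (auto intro: divide_right_mono)
      with u have "u \<in> {0<..?t m}" unfolding greaterThanAtMost_iff by linarith
      with False show False by simp
    qed
    then show ?thesis using False by (simp add: F1_def)
  qed
  \<comment> \<open>Beyond \<open>m/n\<close> only the integral contributes, and at
    \<open>u = 0\<close> the closed interval exceeds the left-open cells; that single point is a
    null set.\<close>
  have pt: "ennreal (norm (F1 u - F2 u)) \<le> ennreal \<bar>\<phi> (?t (Suc (grid_floor n u))) - \<phi> u\<bar> * indicator {0<..T} u
      + (ennreal B * indicator {?t m<..s} u + ennreal B * indicator {0} u)" for u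
  proof -
    consider "u \<in> {0<..?t m}" | "u \<in> {?t m<..s}" | "u = 0" | "u \<notin> {0<..?t m}" "u \<notin> {0..s}" by fastforce
    then show ?thesis
    proof cases
      case 1
      then have "u \<in> {0..s}" "u \<in> {0<..T}" using ms s by auto
      with 1 show ?thesis by (simp add: F1 F2_def add_increasing2)
    next
      case 2
      have "0 \<le> ?t m" by simp
      with 2 have u0: "0 < u" unfolding greaterThanAtMost_iff by linarith
      with 2 have u: "0 < u" "u \<in> {0..s}" "u \<notin> {0<..?t m}" by auto
      then have "norm (F1 u - F2 u) = \<bar>\<phi> u\<bar>" by (simp add: F1 F2_def)
      then have "ennreal (norm (F1 u - F2 u)) \<le> ennreal B" using bnd[of u] by (simp add: ennreal_leI)
      with 2 u show ?thesis by (simp add: add_increasing)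
    next
      case 3
      then have "norm (F1 u - F2 u) = \<bar>\<phi> u\<bar>" using s by (simp add: F1 F2_def)
      then have "ennreal (norm (F1 u - F2 u)) \<le> ennreal B" using bnd[of u] by (simp add: ennreal_leI)
      with 3 show ?thesis by (simp add: add_increasing)
    next
      case 4
      then show ?thesis by (simp add: F1 F2_def)
    qed
  qed
  have "ennreal (norm (\<integral>u. F1 u - F2 u \<partial>lborel)) \<le> (\<integral>\<^sup>+u. ennreal (norm (F1 u - F2 u)) \<partial>lborel)"
    by (rule integral_norm_bound_ennreal) (intro Bochner_Integration.integrable_diff int1 int2)
  also have "\<dots> \<le> (\<integral>\<^sup>+u. ennreal \<bar>\<phi> (?t (Suc (grid_floor n u))) - \<phi> u\<bar> * indicator {0<..T} u
      + (ennreal B * indicator {?t m<..s} u + ennreal B * indicator {0} u) \<partial>lborel)"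
    by (intro nn_integral_mono pt)
  also have "\<dots> = (\<integral>\<^sup>+u\<in>{0<..T}. ennreal \<bar>\<phi> (?t (Suc (grid_floor n u))) - \<phi> u\<bar> \<partial>lborel)
      + (ennreal B * ennreal (s - ?t m) + ennreal B * 0)"
  proof -
    have [measurable]: "(\<lambda>u. \<phi> (?t (Suc (grid_floor n u)))) \<in> borel_measurable borel"
      by (rule measurable_compose[OF measurable_grid_floor]) simp
    show ?thesis
      using ms(1) by (subst nn_integral_add, measurable, subst nn_integral_add, measurable)
        (simp add: nn_integral_cmult_indicator emeasure_lborel_Ioc)
  qed
  also have "\<dots> \<le> ennreal q + ennreal B * ennreal (1 / real n)"
    using le ms(2) by (simp add: add_mono mult_left_mono ennreal_leI)
  also have "\<dots> = ennreal (q + B / real n)" using q B by (simp add: ennreal_mult[symmetric] del: ennreal_plus flip: ennreal_plus)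
  finally have "ennreal (norm (\<integral>u. F1 u - F2 u \<partial>lborel)) \<le> ennreal (q + B / real n)" .
  then have d: "\<bar>(\<integral>u. F1 u \<partial>lborel) - (\<integral>u. F2 u \<partial>lborel)\<bar> \<le> q + B / real n"
    unfolding Bochner_Integration.integral_diff[OF int1 int2] real_norm_def
    by (rule ennreal_le_iff[THEN iffD1, rotated]) (use q B in simp)
  have "(\<Sum>j<m. \<phi> (?t (Suc j))) - (\<Sum>j<m. \<phi> (?t j)) = \<phi> (?t m) - \<phi> (?t 0)"
    unfolding sum_subtractf[symmetric] by (rule sum_lessThan_telescope[of "\<lambda>j. \<phi> (?t j)"])
  then have "\<bar>(\<Sum>j<m. \<phi> (?t j)) - (\<Sum>j<m. \<phi> (?t (Suc j)))\<bar> \<le> 2 * B"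
    using bnd[of "?t m"] bnd[of "?t 0"] by linarith
  then have "(1 / real n) * \<bar>(\<Sum>j<m. \<phi> (?t j)) - (\<Sum>j<m. \<phi> (?t (Suc j)))\<bar> \<le> (1 / real n) * (2 * B)"
    by (intro mult_left_mono) auto
  then have "\<bar>(1 / real n) * (\<Sum>j<m. \<phi> (?t j)) - (1 / real n) * (\<Sum>j<m. \<phi> (?t (Suc j)))\<bar> \<le> 2 * B / real n"
    using n0 by (simp flip: diff_divide_distrib)
  moreover have "(LINT u:{0..s}|lborel. \<phi> u) = (\<integral>u. F2 u \<partial>lborel)"
    by (simp add: set_lebesgue_integral_def F2_def)
  moreover have "2 * B / real n + (q + B / real n) = 3 * B / real n + q" by (simp add: add_divide_distrib[symmetric])
  ultimately show ?thesis using d unfolding m_def[symmetric] I1 by linarith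
qed

lemma (in brownian) nincr_exp_moment:
  fixes s :: "'w \<Rightarrow> real ^ 'e ^ 'd"
  assumes n: "n \<ge> 1" and s: "s \<in> borel_measurable (F (real j / real n))" "\<And>\<omega>. norm (s \<omega>) \<le> K"
  shows "(\<integral>\<^sup>+\<omega>. ennreal (exp (l \<bullet> (s \<omega> *v nincr n j \<omega>))) \<partial>M) \<le> ennreal (exp ((norm l)\<^sup>2 * (K\<^sup>2 / 2)))"
proof -
  have "(\<integral>\<^sup>+\<omega>. (\<lambda>p. ennreal (exp (l \<bullet> (fst p *v snd p)))) (s \<omega>, nincr n j \<omega>) \<partial>M)
      = (\<integral>\<^sup>+\<omega>. \<integral>\<^sup>+z. (\<lambda>p. ennreal (exp (l \<bullet> (fst p *v snd p)))) (s \<omega>, z) \<partial>std_normal_vec \<partial>M)"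
    by (rule freeze_nincr_nn[OF n s(1)]) measurable
  also have "\<dots> \<le> (\<integral>\<^sup>+\<omega>. ennreal (exp ((norm l)\<^sup>2 * (K\<^sup>2 / 2))) \<partial>M)"
    using std_normal_vec_affine_exp[OF _ s(2), of 1 l 0] by (intro nn_integral_mono) simp
  finally show ?thesis by (simp add: emeasure_space_1)
qed

section \<open>Negligibility of the drift\<close>

locale ito_process = ito_setting M F W \<sigma> I
  for M :: "'w measure" and F :: "real \<Rightarrow> 'w measure" and W :: "real \<Rightarrow> 'w \<Rightarrow> real ^ 'e"
    and \<sigma> :: "real \<Rightarrow> 'w \<Rightarrow> real ^ 'e ^ 'd" and I :: "real \<Rightarrow> 'w \<Rightarrow> real ^ 'd" +
  fixes Y :: "real \<Rightarrow> 'w \<Rightarrow> real ^ 'd"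
  assumes Y_meas: "\<And>t. 0 \<le> t \<Longrightarrow> Y t \<in> borel_measurable M"
    and drift: "AE \<omega> in M. \<forall>R\<ge>0. \<exists>C. \<forall>s t. 0 \<le> s \<longrightarrow> s \<le> t \<longrightarrow> t \<le> R \<longrightarrow>
      norm ((Y t \<omega> - I t \<omega>) - (Y s \<omega> - I s \<omega>)) \<le> C * (t - s)"
begin

text \<open>Counted from 0: \<open>Z n j\<close> is the normalised increment with number
  \<open>Suc j\<close>.\<close>

definition Z :: "nat \<Rightarrow> nat \<Rightarrow> 'w \<Rightarrow> real ^ 'd" where
  "Z n j \<omega> = sqrt (real n) *\<^sub>R (Y (real (Suc j) / real n) \<omega> - Y (real j / real n) \<omega>)"

lemma Z_meas [measurable]: "Z n j \<in> borel_measurable M"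
proof -
  have [measurable]: "Y (real (Suc j) / real n) \<in> borel_measurable M" "Y (real j / real n) \<in> borel_measurable M"
    by (intro Y_meas; simp)+
  show ?thesis unfolding Z_def[abs_def] by measurable
qed

text \<open>By the Lipschitz bound an increment of \<open>Y - I\<close> over a cell is at most
  \<open>C / n\<close>, hence at most \<open>C / sqrt n\<close> after normalisation. The constant
  depends on the path, so the conclusion is an event of high probability.\<close>

lemma drift_small:
  assumes e: "0 < \<epsilon>"
  shows "whp M (\<lambda>n \<omega>. \<forall>j<n * (T + 1).
    norm (Z n j \<omega> - I_incr n j \<omega>) \<le> \<epsilon>)"
proof -
  define b where "b n j \<omega> = norm (Z n j \<omega> - I_incr n j \<omega>)" for n j \<omega>
  have [measurable]: "b n j \<in> borel_measurable M" for n j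
  proof -
    have [measurable]: "I (real (Suc j) / real n) \<in> borel_measurable M" "I (real j / real n) \<in> borel_measurable M"
      by (intro I_meas; simp)+
    show ?thesis unfolding b_def[abs_def] by measurable
  qed
  \<comment> \<open>A measurable majorant of the fourth power of the maximum. Fourth powers are
    summed because \<open>n * (T + 1)\<close> terms of size at most \<open>C^4 / n^2\<close> tend to
    0, while the bound for squares would add up to a constant.\<close>
  define Q where "Q n \<omega> = (\<Sum>j<n * (T + 1). (b n j \<omega>) ^ 4)" for n \<omega>
  have "whp M (\<lambda>n \<omega>. Q n \<omega> \<le> \<epsilon> ^ 4)"
  proof (rule whp_LIMSEQ)
    show "Q n \<in> borel_measurable M" for n unfolding Q_def[abs_def] by measurable
    show "AE \<omega> in M. (\<lambda>n. Q n \<omega>) \<longlonglongrightarrow> 0"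
      using drift
    proof eventually_elim
      case (elim \<omega>)
      have "0 \<le> real (T + 1)" by simp
      with elim obtain C where C: "\<And>s t. 0 \<le> s \<Longrightarrow> s \<le> t \<Longrightarrow> t \<le> real (T + 1) \<Longrightarrow>
          norm ((Y t \<omega> - I t \<omega>) - (Y s \<omega> - I s \<omega>)) \<le> C * (t - s)" by blast
      have bj: "b n j \<omega> \<le> C / sqrt (real n)" if n: "n \<ge> 1" and j: "j < n * (T + 1)" for n j
      proof -
        have "real (Suc j) \<le> real (n * (T + 1))" using j by (simp only: of_nat_le_iff)
        then have 1: "real (Suc j) / real n \<le> real (T + 1)" using n by (simp only: of_nat_mult) (simp add: divide_le_eq mult.commute)
        have 2: "real j / real n \<le> real (Suc j) / real n" by (intro divide_right_mono) auto
        have "b n j \<omega> = sqrt (real n) * norm ((Y (real (Suc j) / real n) \<omega> - I (real (Suc j) / real n) \<omega>) - (Y (real j / real n) \<omega> - I (real j / real n) \<omega>))"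
        proof -
          have "Z n j \<omega> - I_incr n j \<omega>
            = sqrt (real n) *\<^sub>R ((Y (real (Suc j) / real n) \<omega> - I (real (Suc j) / real n) \<omega>) - (Y (real j / real n) \<omega> - I (real j / real n) \<omega>))"
            by (simp add: Z_def algebra_simps)
          then show ?thesis by (simp only: b_def norm_scaleR) simp
        qed
        also have "\<dots> \<le> sqrt (real n) * (C * (real (Suc j) / real n - real j / real n))"
          by (intro mult_left_mono C 1 2) auto
        also have "real (Suc j) / real n - real j / real n = 1 / real n" by (simp add: add_divide_distrib)
        also have "sqrt (real n) * (C * (1 / real n)) = C / sqrt (real n)"
          using n by (simp add: field_simps)
        finally show ?thesis .
      qed
      show ?case
      proof (rule tendsto_sandwich[where f = "\<lambda>_. 0"])
        show "\<forall>\<^sub>F n in sequentially. 0 \<le> Q n \<omega>" by (simp add: Q_def sum_nonneg)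
        show "\<forall>\<^sub>F n in sequentially. Q n \<omega> \<le> (real (T + 1) * C ^ 4) / real n"
          using eventually_ge_at_top[of 1]
        proof eventually_elim
          case (elim n)
          have "Q n \<omega> \<le> (\<Sum>j<n * (T + 1). (C / sqrt (real n)) ^ 4)"
            unfolding Q_def by (intro sum_mono power_mono bj elim) (auto simp: b_def)
          also have "\<dots> = real (n * (T + 1)) * (C ^ 4 / (real n)\<^sup>2)"
          proof -
            have "(sqrt (real n)) ^ 4 = ((sqrt (real n))\<^sup>2)\<^sup>2" by (simp only: power_mult[symmetric]) simp
            then show ?thesis by (simp add: power_divide)
          qed
          also have "\<dots> = (real (T + 1) * C ^ 4) / real n"
            using elim by (simp only: of_nat_mult power2_eq_square) simp
          finally show ?case .
        qed
        show "(\<lambda>n. (real (T + 1) * C ^ 4) / real n) \<longlonglongrightarrow> 0"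
          by (intro tendsto_divide_0[OF tendsto_const] filterlim_at_top_imp_at_infinity filterlim_real_sequentially)
      qed simp
    qed
    show "0 < \<epsilon> ^ 4" using e by simp
  qed
  then show ?thesis
  proof (rule whp_mono[where m = 0], intro allI impI)
    fix n \<omega> j assume Q: "Q n \<omega> \<le> \<epsilon> ^ 4" and j: "j < n * (T + 1)"
    have "(b n j \<omega>) ^ 4 \<le> Q n \<omega>" unfolding Q_def by (rule member_le_sum) (use j in auto)
    with Q have "(b n j \<omega>) ^ 4 \<le> \<epsilon> ^ 4" by linarith
    then have "b n j \<omega> \<le> \<epsilon>" using power_le_imp_le_base[of "b n j \<omega>" 3 \<epsilon>] e by (simp add: eval_nat_numeral)
    then show "norm (Z n j \<omega> - I_incr n j \<omega>) \<le> \<epsilon>"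
      by (simp add: b_def)
  qed
qed

end

section \<open>Convergence for scalar functions\<close>

context ito_process
begin

context
  fixes g h :: "real ^ 'd \<Rightarrow> real" and Cg Ch :: real and mg mh :: nat
  assumes g: "continuous_on UNIV g" "0 \<le> Cg" "\<And>x. \<bar>g x\<bar> \<le> Cg * (1 + norm x) ^ mg"
    and h: "continuous_on UNIV h" "0 \<le> Ch" "\<And>x. \<bar>h x\<bar> \<le> Ch * (1 + norm x) ^ mh"
begin

lemma gh_measurable [measurable]: "g \<in> borel_measurable borel" "h \<in> borel_measurable borel"
  by (rule growth_measurable[OF g], rule growth_measurable[OF h])

text \<open>The increment bound, applied to the product of \<open>g\<close> and \<open>h\<close> on
  pairs, splits each difference into \<epsilon> times weights and a constant times squared
  distances. The weights are bounded in mean, the squared distances tend to 0, and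
  \<open>whp_combine\<close> balances the two.\<close>

lemma increments_replacement:
  assumes K: "0 \<le> K"
    and B: "\<And>\<omega> u. \<omega> \<in> space M - B \<Longrightarrow> 0 < u \<Longrightarrow> u \<le> real (T + 1) \<Longrightarrow> norm (H u \<omega>) \<le> K"
    and e: "0 < \<eta>"
  shows "whp M (\<lambda>n \<omega>. \<omega> \<notin> B \<longrightarrow> (1 / real n) * (\<Sum>j<n * T. \<bar>g (Z n j \<omega>) * h (Z n (Suc j) \<omega>)
      - g (trunc K (\<sigma> (real j / real n) \<omega>) *v nincr n j \<omega>) * h (trunc K (\<sigma> (real j / real n) \<omega>) *v nincr n (Suc j) \<omega>)\<bar>) \<le> \<eta>)"
proof -
  obtain X where Xm: "\<And>n j. X n j \<in> borel_measurable M"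
    and Xexp: "\<And>n j l. (\<integral>\<^sup>+\<omega>. ennreal (exp (l \<bullet> X n j \<omega>)) \<partial>M) \<le> ennreal (exp ((norm l)\<^sup>2 * (K\<^sup>2 / 2)))"
    and Xlim: "\<And>l. (\<lambda>n. \<integral>\<^sup>+\<omega>. (\<Sum>j<n * (T + 1). nsq (X n j \<omega> /\<^sub>R sqrt (real n) - trunc K (\<sigma> (real (j - l) / real n) \<omega>) *v
        W_incr n j \<omega>)) \<partial>M) \<longlonglongrightarrow> 0"
    and Xclose: "\<And>n. n \<ge> 1 \<Longrightarrow> \<exists>A\<in>sets M. measure M A \<le> 1 / real n \<and> (\<forall>\<omega>\<in>space M - A - B. \<forall>j<n * (T + 1).
        norm (X n j \<omega> - I_incr n j \<omega>) \<le> 1 / real n)"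
    using increments_approximation[OF K B] by blast
  note Xm [measurable] and borel_measurable_trunc[OF K, measurable]
  define s where "s n j \<omega> = trunc K (\<sigma> (real j / real n) \<omega>)" for n j \<omega>
  have sF: "s n j \<in> borel_measurable (F (real j / real n))" for n j
  proof -
    have [measurable]: "\<sigma> (real j / real n) \<in> borel_measurable (F (real j / real n))" by (rule sigma_meas_F) simp
    show ?thesis unfolding s_def[abs_def] by measurable
  qed
  have [measurable]: "s n j \<in> borel_measurable M" for n j by (rule measurable_F_M[OF _ sF]) simp
  have sK: "norm (s n j \<omega>) \<le> K" for n j \<omega> unfolding s_def by (rule norm_trunc_le[OF K])
  define \<alpha> where "\<alpha> n j \<omega> = s n j \<omega> *v nincr n j \<omega>" for n j \<omega>
  \<comment> \<open>The increment of the next cell with the coefficient of cell \<open>j\<close>, as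
    in \<open>cterm\<close>; this is the source of the lag 1 below.\<close>
  define \<beta> where "\<beta> n j \<omega> = s n j \<omega> *v nincr n (Suc j) \<omega>" for n j \<omega>
  have [measurable]: "\<alpha> n j \<in> borel_measurable M" "\<beta> n j \<in> borel_measurable M" for n j
    unfolding \<alpha>_def[abs_def] \<beta>_def[abs_def] by measurable
  define d where "d = real DIM(real ^ 'd)"
  define E where "E = 2 * d * exp (d\<^sup>2 * (K\<^sup>2 / 2))"
  have E0: "0 \<le> E" by (simp add: E_def d_def)
  have EX: "(\<integral>\<^sup>+\<omega>. ennreal (expo (X n j \<omega>)) \<partial>M) \<le> ennreal E" for n j
    using nn_integral_expo_bound[of "X n j" M "K\<^sup>2 / 2"] Xm Xexp unfolding E_def d_def by simp
  have E\<alpha>: "(\<integral>\<^sup>+\<omega>. ennreal (expo (\<alpha> n j \<omega>)) \<partial>M) \<le> ennreal E" if "n \<ge> 1" for n j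
    using nn_integral_expo_bound[of "\<alpha> n j" M "K\<^sup>2 / 2"] nincr_exp_moment[OF that sF sK]
    unfolding E_def d_def \<alpha>_def[symmetric] by simp
  have E\<beta>: "(\<integral>\<^sup>+\<omega>. ennreal (expo (\<beta> n j \<omega>)) \<partial>M) \<le> ennreal E" if n: "n \<ge> 1" for n j
  proof -
    have "s n j \<in> borel_measurable (F (real (Suc j) / real n))"
      by (rule measurable_F_mono[OF _ _ sF]) (auto intro: divide_right_mono)
    from nincr_exp_moment[OF n this sK]
    show ?thesis using nn_integral_expo_bound[of "\<beta> n j" M "K\<^sup>2 / 2"]
      unfolding E_def d_def \<beta>_def[symmetric] by simp
  qed
  \<comment> \<open>The factor \<open>exp d\<close> pays for replacing \<open>Z\<close> by
    \<open>X\<close> in the weights, the two being at distance at most 1. One half of the constant 2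
    is the 1 of the increment bound, the other absorbs the squared distance between \<open>Z\<close>
    and \<open>X\<close>.\<close>
  define G where "G n \<omega> = (1 / real n) * (\<Sum>j<n * T. 2 + exp d * (expo (X n j \<omega>) + expo (X n (Suc j) \<omega>)) + expo (\<alpha> n j \<omega>) + expo (\<beta> n j \<omega>))" for n \<omega>
  define v where "v l n j \<omega> = (norm (X n j \<omega> /\<^sub>R sqrt (real n) - trunc K (\<sigma> (real (j - l) / real n) \<omega>) *v
        W_incr n j \<omega>))\<^sup>2" for l n j \<omega>
  \<comment> \<open>Lag 0 serves \<alpha>; lag 1 serves \<beta>, since the cell \<open>Suc j\<close>
    with lag 1 is sampled at time \<open>j/n\<close>.\<close>
  define S where "S n \<omega> = (\<Sum>j<n * (T + 1). v 0 n j \<omega>) + (\<Sum>j<n * (T + 1). v 1 n j \<omega>)" for n \<omega>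
  \<comment> \<open>Set to 0 on \<open>B\<close>, so that what is claimed off \<open>B\<close>
    becomes one inequality for all paths.\<close>
  define D where "D n \<omega> = (if \<omega> \<in> B then 0 else (1 / real n) * (\<Sum>j<n * T. \<bar>g (Z n j \<omega>) * h (Z n (Suc j) \<omega>)
      - g (\<alpha> n j \<omega>) * h (\<beta> n j \<omega>)\<bar>))" for n \<omega>
  have G0: "0 \<le> G n \<omega>" for n \<omega>
    unfolding G_def by (intro mult_nonneg_nonneg sum_nonneg add_nonneg_nonneg expo_nonneg) auto
  have v0: "0 \<le> v l n j \<omega>" for l n j \<omega> by (simp add: v_def)
  have S0: "0 \<le> S n \<omega>" for n \<omega> unfolding S_def by (intro add_nonneg_nonneg sum_nonneg v0)
  have vm [measurable]: "v l n j \<in> borel_measurable M" for l n j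
  proof -
    have [measurable]: "\<sigma> (real (j - l) / real n) \<in> borel_measurable M"
      "W (real (Suc j) / real n) \<in> borel_measurable M" "W (real j / real n) \<in> borel_measurable M"
      by (intro sigma_meas measurable_W_M; simp)+
    show ?thesis unfolding v_def[abs_def] by measurable
  qed
  have Gm: "G n \<in> borel_measurable M" for n unfolding G_def[abs_def] by measurable
  have GE: "(\<integral>\<^sup>+\<omega>. ennreal (G n \<omega>) \<partial>M) \<le> ennreal (T * (2 + exp d * (2 * E) + 2 * E))" for n
  proof (cases "n \<ge> 1")
    case True
    let ?a = "\<lambda>j \<omega>. 2 + exp d * (expo (X n j \<omega>) + expo (X n (Suc j) \<omega>)) + expo (\<alpha> n j \<omega>) + expo (\<beta> n j \<omega>)"
    let ?b = "\<lambda>j \<omega>. ennreal 2 + ennreal (exp d) * (ennreal (expo (X n j \<omega>)) + ennreal (expo (X n (Suc j) \<omega>))) + ennreal (expo (\<alpha> n j \<omega>)) + ennreal (expo (\<beta> n j \<omega>))"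
    have a0: "0 \<le> ?a j \<omega>" for j \<omega>
      by (intro add_nonneg_nonneg mult_nonneg_nonneg expo_nonneg) auto
    have ab: "ennreal (?a j \<omega>) = ?b j \<omega>" for j \<omega>
      by (simp add: expo_nonneg ennreal_mult add_nonneg_nonneg mult_nonneg_nonneg del: ennreal_plus flip: ennreal_plus)
        (simp add: expo_nonneg ennreal_mult add_nonneg_nonneg ennreal_plus)
    have "(\<integral>\<^sup>+\<omega>. ennreal (G n \<omega>) \<partial>M) = (\<integral>\<^sup>+\<omega>. ennreal (1 / real n) * (\<Sum>j<n * T. ?b j \<omega>) \<partial>M)"
    proof (intro nn_integral_cong)
      fix \<omega>
      have "ennreal (G n \<omega>) = ennreal (1 / real n) * ennreal (\<Sum>j<n * T. ?a j \<omega>)"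
        unfolding G_def by (rule ennreal_mult) (simp, rule sum_nonneg, rule a0)
      also have "ennreal (\<Sum>j<n * T. ?a j \<omega>) = (\<Sum>j<n * T. ennreal (?a j \<omega>))"
        by (rule sum_ennreal[symmetric]) (rule a0)
      finally show "ennreal (G n \<omega>) = ennreal (1 / real n) * (\<Sum>j<n * T. ?b j \<omega>)" unfolding ab .
    qed
    also have "\<dots> = ennreal (1 / real n) * (\<Sum>j<n * T. \<integral>\<^sup>+\<omega>. ?b j \<omega> \<partial>M)"
      by (subst nn_integral_cmult, measurable, subst nn_integral_sum, measurable)
    also have "\<dots> \<le> ennreal (1 / real n) * (\<Sum>j<n * T. ennreal (2 + exp d * (2 * E) + 2 * E))"
    proof (intro mult_left_mono sum_mono)
      fix j
      have "(\<integral>\<^sup>+\<omega>. ?b j \<omega> \<partial>M) = ennreal 2 + ennreal (exp d) * ((\<integral>\<^sup>+\<omega>. ennreal (expo (X n j \<omega>)) \<partial>M) + (\<integral>\<^sup>+\<omega>. ennreal (expo (X n (Suc j) \<omega>)) \<partial>M))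
          + (\<integral>\<^sup>+\<omega>. ennreal (expo (\<alpha> n j \<omega>)) \<partial>M) + (\<integral>\<^sup>+\<omega>. ennreal (expo (\<beta> n j \<omega>)) \<partial>M)"
        by (simp add: nn_integral_add nn_integral_cmult emeasure_space_1)
      also have "\<dots> \<le> ennreal 2 + ennreal (exp d) * (ennreal E + ennreal E) + ennreal E + ennreal E"
        by (intro add_mono mult_left_mono EX E\<alpha>[OF True] E\<beta>[OF True] order_refl) simp
      also have "\<dots> = ennreal (2 + exp d * (E + E) + E + E)"
        using E0 by (simp only: ennreal_plus ennreal_mult add_nonneg_nonneg mult_nonneg_nonneg exp_ge_zero zero_le_numeral)
      also have "2 + exp d * (E + E) + E + E = 2 + exp d * (2 * E) + 2 * E" by simp
      finally show "(\<integral>\<^sup>+\<omega>. ?b j \<omega> \<partial>M) \<le> ennreal (2 + exp d * (2 * E) + 2 * E)" .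
    qed simp
    also have "\<dots> = ennreal ((1 / real n) * (real (n * T) * (2 + exp d * (2 * E) + 2 * E)))"
    proof -
      have c0: "0 \<le> 2 + exp d * (2 * E) + 2 * E" using E0 by simp
      then have "(\<Sum>j<n * T. ennreal (2 + exp d * (2 * E) + 2 * E)) = ennreal (\<Sum>j<n * T. 2 + exp d * (2 * E) + 2 * E)"
        by (rule sum_ennreal)
      also have "(\<Sum>j<n * T. 2 + exp d * (2 * E) + 2 * E) = real (n * T) * (2 + exp d * (2 * E) + 2 * E)"
        by (simp only: sum_constant card_lessThan)
      finally show ?thesis using c0 by (simp only: ennreal_mult mult_nonneg_nonneg of_nat_0_le_iff zero_le_divide_1_iff)
    qed
    also have "(1 / real n) * (real (n * T) * (2 + exp d * (2 * E) + 2 * E)) = T * (2 + exp d * (2 * E) + 2 * E)"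
      using True by simp
    finally show ?thesis .
  next
    case False
    then have "n = 0" by simp
    then show ?thesis by (simp add: G_def)
  qed
  have Slim: "whp M (\<lambda>n \<omega>. S n \<omega> \<le> \<epsilon>)" if \<epsilon>: "0 < \<epsilon>" for \<epsilon>
  proof -
    have "whp M (\<lambda>n \<omega>. (\<Sum>j<n * (T + 1). ennreal (v l n j \<omega>)) \<le> ennreal (\<epsilon> / 2))" for l
    proof (rule whp_Markov)
      show "(\<lambda>n. \<integral>\<^sup>+\<omega>. (\<Sum>j<n * (T + 1). ennreal (v l n j \<omega>)) \<partial>M) \<longlonglongrightarrow> 0"
        using Xlim[of l] unfolding v_def .
      show "0 < \<epsilon> / 2" using \<epsilon> by simp
    qed measurable
    from whp_conj[OF this[of 0] this[of 1]] show ?thesis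
    proof (rule whp_mono[where m = 0])
      fix n \<omega>
      assume le: "(\<Sum>j<n * (T + 1). ennreal (v 0 n j \<omega>)) \<le> ennreal (\<epsilon> / 2) \<and> (\<Sum>j<n * (T + 1). ennreal (v 1 n j \<omega>)) \<le> ennreal (\<epsilon> / 2)"
      have "(\<Sum>j<n * (T + 1). v l n j \<omega>) \<le> \<epsilon> / 2" if "(\<Sum>j<n * (T + 1). ennreal (v l n j \<omega>)) \<le> ennreal (\<epsilon> / 2)" for l
        using that \<epsilon> unfolding sum_ennreal[OF v0] by (simp only: ennreal_le_iff half_gt_zero_iff less_imp_le)
      from this[of 0] this[of 1] le show "S n \<omega> \<le> \<epsilon>" unfolding S_def by linarith
    qed
  qed
  have main: "\<exists>C. whp M (\<lambda>n \<omega>. D n \<omega> \<le> \<epsilon> * G n \<omega> + C * S n \<omega>)" if \<epsilon>: "0 < \<epsilon>" for \<epsilon>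
  proof -
    let ?f = "\<lambda>p :: (real ^ 'd) \<times> (real ^ 'd). g (fst p) * h (snd p)" and ?G = "\<lambda>p :: (real ^ 'd) \<times> (real ^ 'd). expo (fst p) + expo (snd p)"
    have "continuous_on UNIV ?f"
      by (intro continuous_on_mult continuous_on_compose2[OF g(1)] continuous_on_compose2[OF h(1)] continuous_intros) auto
    moreover have "0 \<le> ?G p" for p by (intro add_nonneg_nonneg expo_nonneg)
    moreover have "\<exists>R. \<forall>x. R \<le> norm x \<longrightarrow> \<bar>?f x\<bar> \<le> \<epsilon> * ?G x"
      by (rule product_growth[OF g(3) h(3) g(2) h(2) \<epsilon>])
    ultimately obtain C where C: "0 \<le> C" "\<And>x y. \<bar>?f x - ?f y\<bar> \<le> \<epsilon> * (1 + ?G x + ?G y) + C * (norm (x - y))\<^sup>2"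
      using dominated_increment_bound[of ?f ?G \<epsilon>] \<epsilon> by blast
    \<comment> \<open>At most 1 for the comparison of the weights, and with
      \<open>4 * C * \<rho>^2 \<le> \<epsilon>\<close> for the squared distance between
      \<open>Z\<close> and \<open>X\<close>, to which each component of the pair contributes
      \<open>2 * \<rho>^2\<close>.\<close>
    define \<rho> where "\<rho> = min 1 (sqrt (\<epsilon> / (4 * C + 4)))"
    have \<rho>: "0 < \<rho>" "\<rho> \<le> 1" using \<epsilon> C by (auto simp: \<rho>_def)
    have "\<rho>\<^sup>2 \<le> (sqrt (\<epsilon> / (4 * C + 4)))\<^sup>2" using \<rho> by (intro power_mono) (auto simp: \<rho>_def)
    also have "\<dots> = \<epsilon> / (4 * C + 4)" using \<epsilon> C by simp
    finally have "(4 * C + 4) * \<rho>\<^sup>2 \<le> \<epsilon>" using C by (simp add: field_simps)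
    then have \<rho>C: "4 * C * \<rho>\<^sup>2 \<le> \<epsilon>" using zero_le_power2[of \<rho>] unfolding distrib_right by linarith
    \<comment> \<open>For such \<open>n\<close> the bound \<open>1 / n\<close> is at most
      \<open>\<rho> / 2\<close>; the drift takes the other half of the distance between
      \<open>Z\<close> and \<open>X\<close>.\<close>
    obtain n1 :: nat where n1: "2 / \<rho> < real n1" using reals_Archimedean2 by blast
    have "whp M (\<lambda>n \<omega>. \<omega> \<notin> B \<longrightarrow> (\<forall>j<n * (T + 1).
        norm (X n j \<omega> - I_incr n j \<omega>) \<le> 1 / real n))"
      unfolding whp_def
    proof (intro allI impI)
      fix \<delta> :: real assume \<delta>: "0 < \<delta>"
      obtain n2 :: nat where n2: "1 / \<delta> < real n2" using reals_Archimedean2 by blast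
      show "\<forall>\<^sub>F n in sequentially. \<exists>A\<in>sets M. measure M A \<le> \<delta> \<and> (\<forall>\<omega>\<in>space M - A. \<omega> \<notin> B \<longrightarrow> (\<forall>j<n * (T + 1).
        norm (X n j \<omega> - I_incr n j \<omega>) \<le> 1 / real n))"
        using eventually_ge_at_top[of "max 1 n2"]
      proof eventually_elim
        case (elim n)
        then have n: "n \<ge> 1" "n2 \<le> n" by auto
        then have "1 / \<delta> < real n" using n2 by linarith
        then have "1 / real n \<le> \<delta>" using \<delta> n by (simp add: field_simps)
        moreover obtain A where A: "A \<in> sets M" "measure M A \<le> 1 / real n" "\<forall>\<omega>\<in>space M - A - B. \<forall>j<n * (T + 1).
            norm (X n j \<omega> - I_incr n j \<omega>) \<le> 1 / real n"
          using Xclose[OF n(1)] by blast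
        ultimately show ?case by (intro bexI[of _ A] conjI ballI impI) (linarith, blast+)
      qed
    qed
    from whp_conj[OF this drift_small[of "\<rho> / 2" T]] \<rho>
    have "whp M (\<lambda>n \<omega>. (\<omega> \<notin> B \<longrightarrow> (\<forall>j<n * (T + 1).
        norm (X n j \<omega> - I_incr n j \<omega>) \<le> 1 / real n)) \<and>
        (\<forall>j<n * (T + 1). norm (Z n j \<omega> - I_incr n j \<omega>) \<le> \<rho> / 2))"
      by simp
    then have "whp M (\<lambda>n \<omega>. D n \<omega> \<le> \<epsilon> * G n \<omega> + (2 * C) * S n \<omega>)"
    proof (rule whp_mono[where m = "max 1 n1"])
      fix n \<omega>
      assume n: "max 1 n1 \<le> n" and "\<omega> \<in> space M" and ev: "(\<omega> \<notin> B \<longrightarrow> (\<forall>j<n * (T + 1).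
        norm (X n j \<omega> - I_incr n j \<omega>) \<le> 1 / real n)) \<and>
        (\<forall>j<n * (T + 1). norm (Z n j \<omega> - I_incr n j \<omega>) \<le> \<rho> / 2)"
      then have n': "n \<ge> 1" "n1 \<le> n" by auto
      have rn: "0 < real n" using n' by simp
      have "2 / \<rho> < real n" using n1 n' by linarith
      then have n\<rho>: "1 / real n \<le> \<rho> / 2" using \<rho> rn by (simp add: field_simps)
      show "D n \<omega> \<le> \<epsilon> * G n \<omega> + (2 * C) * S n \<omega>"
      proof (cases "\<omega> \<in> B")
        case True
        then show ?thesis using \<epsilon> C G0[of n \<omega>] S0[of n \<omega>] by (simp add: D_def)
      next
        case False
        have ZX: "norm (Z n j \<omega> - X n j \<omega>) \<le> \<rho>" if j: "j < n * (T + 1)" for j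
        proof -
          let ?i = "I_incr n j \<omega>"
          have a: "norm (Z n j \<omega> - ?i) \<le> \<rho> / 2" "norm (X n j \<omega> - ?i) \<le> 1 / real n" using ev False j by blast+
          have "Z n j \<omega> - X n j \<omega> = (Z n j \<omega> - ?i) - (X n j \<omega> - ?i)" by simp
          then have "norm (Z n j \<omega> - X n j \<omega>) \<le> norm (Z n j \<omega> - ?i) + norm (X n j \<omega> - ?i)"
            by (metis norm_triangle_ineq4)
          then show ?thesis using a n\<rho> by linarith
        qed
        \<comment> \<open>The second factor of the last term belongs to the cell after time
          \<open>T\<close>; this is why the approximation was prepared up to
          \<open>T + 1\<close>.\<close>
        have nT: "Suc (n * T) \<le> n * (T + 1)" using n' by simp
        \<comment> \<open>\<open>v\<close> measures increments before normalisation; the factor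
          \<open>n\<close> cancels against the averaging factor \<open>1 / n\<close>.\<close>
        have vX: "(norm (X n j \<omega> - \<alpha> n j \<omega>))\<^sup>2 = real n * v 0 n j \<omega>" "(norm (X n (Suc j) \<omega> - \<beta> n j \<omega>))\<^sup>2 = real n * v 1 n (Suc j) \<omega>" for j
        proof -
          have gen: "(norm (x - A *v (sqrt (real n) *\<^sub>R w)))\<^sup>2 = real n * (norm (x /\<^sub>R sqrt (real n) - A *v w))\<^sup>2" for x w and A :: "real ^ 'e ^ 'd"
          proof -
            have "x - A *v (sqrt (real n) *\<^sub>R w) = sqrt (real n) *\<^sub>R (x /\<^sub>R sqrt (real n) - A *v w)"
              using rn by (simp add: matrix_vector_mult_scaleR scaleR_diff_right)
            then show ?thesis by (simp add: power_mult_distrib)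
          qed
          show "(norm (X n j \<omega> - \<alpha> n j \<omega>))\<^sup>2 = real n * v 0 n j \<omega>"
            unfolding \<alpha>_def v_def s_def nincr_def by (simp only: gen diff_zero)
          show "(norm (X n (Suc j) \<omega> - \<beta> n j \<omega>))\<^sup>2 = real n * v 1 n (Suc j) \<omega>"
            unfolding \<beta>_def v_def s_def nincr_def by (simp only: gen diff_Suc_1)
        qed
        have term1: "\<bar>g (Z n j \<omega>) * h (Z n (Suc j) \<omega>) - g (\<alpha> n j \<omega>) * h (\<beta> n j \<omega>)\<bar>
          \<le> \<epsilon> * (2 + exp d * (expo (X n j \<omega>) + expo (X n (Suc j) \<omega>)) + expo (\<alpha> n j \<omega>) + expo (\<beta> n j \<omega>))
            + (2 * C) * (real n * v 0 n j \<omega> + real n * v 1 n (Suc j) \<omega>)" if j: "j < n * T" for j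
        proof -
          have jj: "j < n * (T + 1)" "Suc j < n * (T + 1)" using j nT by auto
          let ?x = "(Z n j \<omega>, Z n (Suc j) \<omega>)" and ?y = "(\<alpha> n j \<omega>, \<beta> n j \<omega>)"
          have "\<bar>g (Z n j \<omega>) * h (Z n (Suc j) \<omega>) - g (\<alpha> n j \<omega>) * h (\<beta> n j \<omega>)\<bar> \<le> \<epsilon> * (1 + ?G ?x + ?G ?y) + C * (norm (?x - ?y))\<^sup>2"
            using C(2)[of ?x ?y] by simp
          also have "(norm (?x - ?y))\<^sup>2 = (norm (Z n j \<omega> - \<alpha> n j \<omega>))\<^sup>2 + (norm (Z n (Suc j) \<omega> - \<beta> n j \<omega>))\<^sup>2"
            by (simp add: norm_Pair)
          also have "\<dots> \<le> 4 * \<rho>\<^sup>2 + 2 * (real n * v 0 n j \<omega> + real n * v 1 n (Suc j) \<omega>)"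
          proof -
            have "(norm (Z n j \<omega> - X n j \<omega>))\<^sup>2 \<le> \<rho>\<^sup>2" "(norm (Z n (Suc j) \<omega> - X n (Suc j) \<omega>))\<^sup>2 \<le> \<rho>\<^sup>2"
              using ZX[OF jj(1)] ZX[OF jj(2)] by (auto intro: power_mono)
            moreover have "a + b \<le> 4 * r + 2 * (x + y)" if "a \<le> 2 * p + 2 * x" "b \<le> 2 * q + 2 * y" "p \<le> r" "q \<le> r" for a b p q r x y :: real
              using that by argo
            moreover note norm_diff_sq_le[of "Z n j \<omega>" "\<alpha> n j \<omega>" "X n j \<omega>", unfolded vX]
              norm_diff_sq_le[of "Z n (Suc j) \<omega>" "\<beta> n j \<omega>" "X n (Suc j) \<omega>", unfolded vX]
            ultimately show ?thesis by blast
          qed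
          finally have 1: "\<bar>g (Z n j \<omega>) * h (Z n (Suc j) \<omega>) - g (\<alpha> n j \<omega>) * h (\<beta> n j \<omega>)\<bar>
            \<le> \<epsilon> * (1 + ?G ?x + ?G ?y) + C * (4 * \<rho>\<^sup>2 + 2 * (real n * v 0 n j \<omega> + real n * v 1 n (Suc j) \<omega>))"
            using C(1) by (simp add: mult_left_mono)
          have "?G ?x \<le> exp d * (expo (X n j \<omega>) + expo (X n (Suc j) \<omega>))"
            using expo_close[of "Z n j \<omega>" "X n j \<omega>"] expo_close[of "Z n (Suc j) \<omega>" "X n (Suc j) \<omega>"] ZX[OF jj(1)] ZX[OF jj(2)] \<rho>
            unfolding d_def by (simp add: distrib_left add_mono)
          then have "\<epsilon> * (1 + ?G ?x + ?G ?y) \<le> \<epsilon> * (1 + exp d * (expo (X n j \<omega>) + expo (X n (Suc j) \<omega>)) + ?G ?y)"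
            using \<epsilon> by (intro mult_left_mono) auto
          with 1 \<rho>C show ?thesis by (simp add: distrib_left)
        qed
        have gen: "(\<Sum>j<n * T. \<epsilon> * x j + (2 * C) * (real n * y j + real n * z j))
          = \<epsilon> * (\<Sum>j<n * T. x j) + real n * ((2 * C) * ((\<Sum>j<n * T. y j) + (\<Sum>j<n * T. z j)))" for x y z :: "nat \<Rightarrow> real"
          by (simp add: sum.distrib sum_distrib_left distrib_left mult_ac)
        have "(\<Sum>j<n * T. \<bar>g (Z n j \<omega>) * h (Z n (Suc j) \<omega>) - g (\<alpha> n j \<omega>) * h (\<beta> n j \<omega>)\<bar>)
          \<le> (\<Sum>j<n * T. \<epsilon> * (2 + exp d * (expo (X n j \<omega>) + expo (X n (Suc j) \<omega>)) + expo (\<alpha> n j \<omega>) + expo (\<beta> n j \<omega>))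
            + (2 * C) * (real n * v 0 n j \<omega> + real n * v 1 n (Suc j) \<omega>))"
          by (intro sum_mono term1) simp
        also have "\<dots> = \<epsilon> * (\<Sum>j<n * T. 2 + exp d * (expo (X n j \<omega>) + expo (X n (Suc j) \<omega>)) + expo (\<alpha> n j \<omega>) + expo (\<beta> n j \<omega>))
            + real n * ((2 * C) * ((\<Sum>j<n * T. v 0 n j \<omega>) + (\<Sum>j<n * T. v 1 n (Suc j) \<omega>)))"
          by (rule gen)
        finally have "(1 / real n) * (\<Sum>j<n * T. \<bar>g (Z n j \<omega>) * h (Z n (Suc j) \<omega>) - g (\<alpha> n j \<omega>) * h (\<beta> n j \<omega>)\<bar>)
          \<le> (1 / real n) * (\<epsilon> * (\<Sum>j<n * T. 2 + exp d * (expo (X n j \<omega>) + expo (X n (Suc j) \<omega>)) + expo (\<alpha> n j \<omega>) + expo (\<beta> n j \<omega>))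
            + real n * ((2 * C) * ((\<Sum>j<n * T. v 0 n j \<omega>) + (\<Sum>j<n * T. v 1 n (Suc j) \<omega>))))"
          by (intro mult_left_mono) auto
        also have "\<dots> = \<epsilon> * G n \<omega> + (2 * C) * ((\<Sum>j<n * T. v 0 n j \<omega>) + (\<Sum>j<n * T. v 1 n (Suc j) \<omega>))"
          using rn by (simp add: G_def distrib_left)
        also have "\<dots> \<le> \<epsilon> * G n \<omega> + (2 * C) * S n \<omega>"
        proof -
          have "(\<Sum>j<n * T. v 0 n j \<omega>) \<le> (\<Sum>j<n * (T + 1). v 0 n j \<omega>)"
            by (rule sum_mono2) (use nT v0 in auto)
          moreover have "(\<Sum>j<n * T. v 1 n (Suc j) \<omega>) \<le> (\<Sum>j<Suc (n * T). v 1 n j \<omega>)"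
            unfolding sum.lessThan_Suc_shift using v0[of 1 n 0 \<omega>] by simp
          moreover have "(\<Sum>j<Suc (n * T). v 1 n j \<omega>) \<le> (\<Sum>j<n * (T + 1). v 1 n j \<omega>)"
            by (rule sum_mono2) (use nT v0 in auto)
          ultimately show ?thesis using C(1) unfolding S_def by (intro add_left_mono mult_left_mono) auto
        qed
        finally show ?thesis using False by (simp add: D_def)
      qed
    qed
    then show ?thesis by blast
  qed
  have "whp M (\<lambda>n \<omega>. D n \<omega> \<le> \<eta>)"
    by (rule whp_combine[OF main Gm GE Slim S0 e])
  then show ?thesis
    unfolding D_def \<alpha>_def \<beta>_def s_def by (rule whp_mono[where m = 0]) (auto split: if_splits)
qed

text \<open>Four errors of size \<open>\<epsilon> / 4\<close>: the replacement of the increments,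
  the centred sums, the oscillation of the path within cells, and \<open>3 * b / n\<close> from the
  ends. Only the centred sums require a maximal inequality; the first error is a sum of absolute
  values and so increases with time, and the last two are bounded uniformly in time.\<close>

lemma scalar_convergence:
  assumes e: "0 < \<epsilon>"
  shows "whp M (\<lambda>n \<omega>. \<forall>s\<in>{0..real T}. \<bar>(1 / real n) * (\<Sum>j<nat \<lfloor>real n * s\<rfloor>. g (Z n j \<omega>) * h (Z n (Suc j) \<omega>))
     - (LINT u:{0..s}|lborel. gauss_mean g (\<sigma> u \<omega>) * gauss_mean h (\<sigma> u \<omega>))\<bar> \<le> \<epsilon>)"
proof (rule whp_local)
  fix \<delta> :: real assume \<delta>: "0 < \<delta>"
  have R: "0 \<le> real (T + 1)" by simp
  obtain K B where K: "0 \<le> K" and B: "B \<in> sets M" "measure M B \<le> \<delta>"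
    "\<And>\<omega> u. \<omega> \<in> space M - B \<Longrightarrow> 0 \<le> u \<Longrightarrow> u \<le> real (T + 1) \<Longrightarrow> norm (\<sigma> u \<omega>) \<le> K"
    "\<And>\<omega> u. \<omega> \<in> space M - B \<Longrightarrow> 0 < u \<Longrightarrow> u \<le> real (T + 1) \<Longrightarrow> norm (H u \<omega>) \<le> K"
    using sigma_bounded_event[OF R \<delta>] by metis
  define s where "s n j \<omega> = trunc K (\<sigma> (real j / real n) \<omega>)" for n j \<omega>
  note borel_measurable_trunc[OF K, measurable]
  have sF: "s n j \<in> borel_measurable (F (real j / real n))" for n j
  proof -
    have [measurable]: "\<sigma> (real j / real n) \<in> borel_measurable (F (real j / real n))" by (rule sigma_meas_F) simp
    show ?thesis unfolding s_def[abs_def] by measurable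
  qed
  have [measurable]: "s n j \<in> borel_measurable M" for n j by (rule measurable_F_M[OF _ sF]) simp
  have sK: "norm (s n j \<omega>) \<le> K" for n j \<omega> unfolding s_def by (rule norm_trunc_le[OF K])
  define \<psi> where "\<psi> A = gauss_mean g A * gauss_mean h A" for A :: "real ^ 'e ^ 'd"
  have \<psi>c: "continuous_on UNIV \<psi>" unfolding \<psi>_def[abs_def]
    by (intro continuous_on_mult continuous_on_gauss_mean[OF g] continuous_on_gauss_mean[OF h])
  have \<psi>m [measurable]: "\<psi> \<in> borel_measurable borel" by (rule borel_measurable_continuous_onI[OF \<psi>c])
  have gm: "gauss_mean g \<in> borel_measurable (borel :: (real ^ 'e ^ 'd) measure)" "gauss_mean h \<in> borel_measurable (borel :: (real ^ 'e ^ 'd) measure)"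
    by (intro borel_measurable_continuous_onI continuous_on_gauss_mean[OF g] continuous_on_gauss_mean[OF h])+
  note gm[measurable]
  have "compact (\<psi> ` cball 0 K)"
    by (intro compact_continuous_image continuous_on_subset[OF \<psi>c]) auto
  then obtain b where b: "\<And>A. norm A \<le> K \<Longrightarrow> \<bar>\<psi> A\<bar> \<le> b"
    using compact_imp_bounded[of "\<psi> ` cball 0 K"] unfolding bounded_iff by fastforce
  have e3: "0 < \<epsilon> / 4" using e by simp
  have A: "whp M (\<lambda>n \<omega>. \<omega> \<notin> B \<longrightarrow> (1 / real n) * (\<Sum>j<n * T. \<bar>g (Z n j \<omega>) * h (Z n (Suc j) \<omega>)
      - g (s n j \<omega> *v nincr n j \<omega>) * h (s n j \<omega> *v nincr n (Suc j) \<omega>)\<bar>) \<le> \<epsilon> / 4)"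
    unfolding s_def by (rule increments_replacement[OF K B(4) e3])
  obtain C where C: "C \<ge> 0" "\<And>n s. n \<ge> 1 \<Longrightarrow> (\<And>j. s j \<in> borel_measurable (F (real j / real n))) \<Longrightarrow> (\<And>j \<omega>. norm (s j \<omega> :: real ^ 'e ^ 'd) \<le> K) \<Longrightarrow>
    (\<forall>j. (\<integral>\<^sup>+\<omega>. ennreal ((cterm g h n s j \<omega>)\<^sup>2) \<partial>M) \<le> ennreal C) \<and>
    (\<forall>m. (\<integral>\<^sup>+\<omega>. ennreal ((\<Sum>j<m. cterm g h n s j \<omega>)\<^sup>2) \<partial>M) \<le> ennreal (C * real m))"
    using cterm_moments[OF K g h] by blast
  have U: "whp M (\<lambda>n \<omega>. \<forall>m\<le>n * T. \<bar>\<Sum>j<m. cterm g h n (s n) j \<omega>\<bar> \<le> \<epsilon> / 4 * real n)"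
  proof (rule whp_max_partial_sums[OF _ C(1) _ _ e3])
    show "cterm g h n (s n) j \<in> borel_measurable M" for n j unfolding cterm_def[abs_def] by measurable
    show "(\<integral>\<^sup>+\<omega>. ennreal ((cterm g h n (s n) j \<omega>)\<^sup>2) \<partial>M) \<le> ennreal C" if "n \<ge> 1" for n j
      using C(2)[OF that sF sK] by blast
    show "(\<integral>\<^sup>+\<omega>. ennreal ((\<Sum>j<m. cterm g h n (s n) j \<omega>)\<^sup>2) \<partial>M) \<le> ennreal (C * real m)" if "n \<ge> 1" for n m
      using C(2)[OF that sF sK] by blast
  qed
  define q where "q n \<omega> = (\<integral>\<^sup>+u\<in>{0<..real T}. ennreal \<bar>\<psi> (trunc K (\<sigma> (real (Suc (grid_floor n u)) / real n) \<omega>)) -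
      \<psi> (trunc K (\<sigma> (max 0 u) \<omega>))\<bar> \<partial>lborel)" for n \<omega>
  have Q: "whp M (\<lambda>n \<omega>. q n \<omega> \<le> ennreal (\<epsilon> / 4))"
  proof (rule whp_Markov[OF _ _ e3])
    show "(\<lambda>n. \<integral>\<^sup>+\<omega>. q n \<omega> \<partial>M) \<longlonglongrightarrow> 0" unfolding q_def by (rule riemann_tendsto[OF K _ \<psi>c]) simp
    have [measurable]: "(\<lambda>p. \<sigma> (real (Suc (grid_floor n (snd p))) / real n) (fst p)) \<in> borel_measurable (M \<Otimes>\<^sub>M borel)" for n
      using sigma_grid_joint[of Suc n] by simp
    show "q n \<in> borel_measurable M" for n
      unfolding q_def[abs_def] by (rule lborel.borel_measurable_nn_integral) (unfold split_beta, measurable)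
  qed
  obtain n1 :: nat where n1: "3 * b / (\<epsilon> / 4) < real n1" using reals_Archimedean2 by blast
  show "\<exists>B\<in>sets M. measure M B \<le> \<delta> \<and> whp M (\<lambda>n \<omega>. \<omega> \<notin> B \<longrightarrow> (\<forall>s\<in>{0..real T}.
      \<bar>(1 / real n) * (\<Sum>j<nat \<lfloor>real n * s\<rfloor>. g (Z n j \<omega>) * h (Z n (Suc j) \<omega>))
     - (LINT u:{0..s}|lborel. gauss_mean g (\<sigma> u \<omega>) * gauss_mean h (\<sigma> u \<omega>))\<bar> \<le> \<epsilon>))"
  proof (intro bexI[of _ B] conjI B whp_mono[OF whp_conj[OF A whp_conj[OF U Q]], where m = "max 1 n1"] impI ballI)
    fix n \<omega> and t :: real
    assume n: "max 1 n1 \<le> n" and \<omega>: "\<omega> \<in> space M"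
      and ev: "(\<omega> \<notin> B \<longrightarrow> (1 / real n) * (\<Sum>j<n * T. \<bar>g (Z n j \<omega>) * h (Z n (Suc j) \<omega>)
        - g (s n j \<omega> *v nincr n j \<omega>) * h (s n j \<omega> *v nincr n (Suc j) \<omega>)\<bar>) \<le> \<epsilon> / 4) \<and>
        (\<forall>m\<le>n * T. \<bar>\<Sum>j<m. cterm g h n (s n) j \<omega>\<bar> \<le> \<epsilon> / 4 * real n) \<and> q n \<omega> \<le> ennreal (\<epsilon> / 4)"
      and nB: "\<omega> \<notin> B" and t: "t \<in> {0..real T}"
    have n': "n \<ge> 1" "n1 \<le> n" using n by auto
    have rn: "0 < real n" using n' by simp
    have t': "0 \<le> t" "t \<le> real T" using t by auto
    define m where "m = nat \<lfloor>real n * t\<rfloor>"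
    have "real n * t \<le> real n * real T" using t' by (intro mult_left_mono) auto
    moreover have "real m \<le> real n * t" using t' rn by (simp add: m_def)
    ultimately have "real m \<le> real (n * T)" unfolding of_nat_mult by linarith
    then have m: "m \<le> n * T" by (simp only: of_nat_le_iff)
    let ?x = "\<lambda>j. g (Z n j \<omega>) * h (Z n (Suc j) \<omega>)"
      and ?y = "\<lambda>j. g (s n j \<omega> *v nincr n j \<omega>) * h (s n j \<omega> *v nincr n (Suc j) \<omega>)"
    have 1: "\<bar>(1 / real n) * (\<Sum>j<m. ?x j) - (1 / real n) * (\<Sum>j<m. ?y j)\<bar> \<le> \<epsilon> / 4"
    proof -
      have "\<bar>(1 / real n) * (\<Sum>j<m. ?x j) - (1 / real n) * (\<Sum>j<m. ?y j)\<bar> = (1 / real n) * \<bar>\<Sum>j<m. ?x j - ?y j\<bar>"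
        using rn by (simp add: sum_subtractf flip: diff_divide_distrib)
      also have "\<dots> \<le> (1 / real n) * (\<Sum>j<m. \<bar>?x j - ?y j\<bar>)" by (intro mult_left_mono sum_abs) simp
      also have "\<dots> \<le> (1 / real n) * (\<Sum>j<n * T. \<bar>?x j - ?y j\<bar>)"
        by (intro mult_left_mono sum_mono2) (use m in auto)
      also have "\<dots> \<le> \<epsilon> / 4" using ev nB by blast
      finally show ?thesis .
    qed
    have 2: "\<bar>(1 / real n) * (\<Sum>j<m. ?y j) - (1 / real n) * (\<Sum>j<m. \<psi> (s n j \<omega>))\<bar> \<le> \<epsilon> / 4"
    proof -
      have "(1 / real n) * (\<Sum>j<m. ?y j) - (1 / real n) * (\<Sum>j<m. \<psi> (s n j \<omega>)) = (1 / real n) * (\<Sum>j<m. cterm g h n (s n) j \<omega>)"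
        by (simp add: cterm_def \<psi>_def sum_subtractf diff_divide_distrib)
      then have "\<bar>(1 / real n) * (\<Sum>j<m. ?y j) - (1 / real n) * (\<Sum>j<m. \<psi> (s n j \<omega>))\<bar> = (1 / real n) * \<bar>\<Sum>j<m. cterm g h n (s n) j \<omega>\<bar>"
        by (simp add: abs_mult)
      also have "\<dots> \<le> (1 / real n) * (\<epsilon> / 4 * real n)" using ev m by (intro mult_left_mono) auto
      finally show ?thesis using rn by simp
    qed
    \<comment> \<open>Truncated, this function is bounded on the whole line, as the Riemann bound
      requires; off \<open>B\<close> truncation changes nothing on \<open>[0, t]\<close>, so the
      integral is the desired one.\<close>
    define \<phi> where "\<phi> u = \<psi> (trunc K (\<sigma> (max 0 u) \<omega>))" for u
    have 3: "\<bar>(1 / real n) * (\<Sum>j<m. \<phi> (real j / real n)) - (LINT u:{0..t}|lborel. \<phi> u)\<bar> \<le> 3 * b / real n + \<epsilon> / 4"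
      unfolding m_def
    proof (rule riemann_sum_bound[OF _ _ n'(1) t'])
      note sigma_path_meas[OF \<omega>, measurable]
      show "\<phi> \<in> borel_measurable borel" unfolding \<phi>_def[abs_def] by measurable
      show "\<bar>\<phi> u\<bar> \<le> b" for u unfolding \<phi>_def by (intro b norm_trunc_le K)
      show "0 \<le> \<epsilon> / 4" using e by simp
      have "q n \<omega> \<le> ennreal (\<epsilon> / 4)" using ev by blast
      then show "(\<integral>\<^sup>+u\<in>{0<..real T}. ennreal \<bar>\<phi> (real (Suc (grid_floor n u)) / real n) - \<phi> u\<bar> \<partial>lborel) \<le> ennreal (\<epsilon> / 4)"
        unfolding q_def \<phi>_def by (simp add: max_def)
    qed
    have "3 * b / (\<epsilon> / 4) \<le> real n" using n1 n' by linarith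
    then have "3 * b / real n \<le> \<epsilon> / 4" using rn e by (simp add: field_simps)
    moreover have "\<phi> (real j / real n) = \<psi> (s n j \<omega>)" for j by (simp add: \<phi>_def s_def max_def)
    moreover have "(LINT u:{0..t}|lborel. \<phi> u) = (LINT u:{0..t}|lborel. gauss_mean g (\<sigma> u \<omega>) * gauss_mean h (\<sigma> u \<omega>))"
    proof (rule set_lebesgue_integral_cong)
      show "\<forall>u. u \<in> {0..t} \<longrightarrow> \<phi> u = gauss_mean g (\<sigma> u \<omega>) * gauss_mean h (\<sigma> u \<omega>)"
      proof (intro allI impI)
        fix u assume u: "u \<in> {0..t}"
        then have "norm (\<sigma> u \<omega>) \<le> K" using B(3)[of \<omega> u] \<omega> nB t' by auto
        then show "\<phi> u = gauss_mean g (\<sigma> u \<omega>) * gauss_mean h (\<sigma> u \<omega>)"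
          using u by (simp add: \<phi>_def \<psi>_def trunc_id[OF K] max_def)
      qed
    qed simp
    ultimately have "\<bar>(1 / real n) * (\<Sum>j<m. \<psi> (s n j \<omega>)) - (LINT u:{0..t}|lborel. gauss_mean g (\<sigma> u \<omega>) * gauss_mean h (\<sigma> u \<omega>))\<bar> \<le> \<epsilon> / 4 + \<epsilon> / 4"
      using 3 by simp
    with 1 2 show "\<bar>(1 / real n) * (\<Sum>j<nat \<lfloor>real n * t\<rfloor>. g (Z n j \<omega>) * h (Z n (Suc j) \<omega>))
       - (LINT u:{0..t}|lborel. gauss_mean g (\<sigma> u \<omega>) * gauss_mean h (\<sigma> u \<omega>))\<bar> \<le> \<epsilon>"
      unfolding m_def[symmetric] by linarith
  qed
qed

end

end

section \<open>Matrix-valued functions\<close>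

text \<open>A value above the countable supremum would persist on an interval to the right, which
  contains rational times. Right of \<open>t\<close> there is nothing left to sample, so
  \<open>t\<close> itself is added.\<close>

lemma SUP_right_continuous:
  fixes f :: "real \<Rightarrow> ennreal"
  assumes t: "0 \<le> t" and rc: "\<And>s. 0 \<le> s \<Longrightarrow> s < t \<Longrightarrow> (f \<longlongrightarrow> f s) (at_right s)"
  shows "(SUP s\<in>{0..t}. f s) = (SUP s\<in>insert t (\<rat> \<inter> {0..t}). f s)"
proof (rule antisym)
  show "(SUP s\<in>insert t (\<rat> \<inter> {0..t}). f s) \<le> (SUP s\<in>{0..t}. f s)"
    by (rule SUP_subset_mono) (use t in auto)
  show "(SUP s\<in>{0..t}. f s) \<le> (SUP s\<in>insert t (\<rat> \<inter> {0..t}). f s)" (is "_ \<le> ?S")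
  proof (rule SUP_least)
    fix s assume s: "s \<in> {0..t}"
    show "f s \<le> ?S"
    proof (cases "s = t")
      case True
      then show ?thesis by (intro SUP_upper) auto
    next
      case False
      with s have st: "0 \<le> s" "s < t" by auto
      show ?thesis
      proof (rule ccontr)
        assume "\<not> f s \<le> ?S"
        then have "\<forall>\<^sub>F r in at_right s. ?S < f r" using rc[OF st] by (intro order_tendstoD(1)) (auto simp: not_le)
        then obtain b where b: "s < b" "\<And>r. s < r \<Longrightarrow> r < b \<Longrightarrow> ?S < f r"
          unfolding eventually_at_right_field by blast
        obtain r where r: "r \<in> \<rat>" "s < r" "r < min b t"
          using Rats_dense_in_real[of s "min b t"] b(1) st by auto
        then have "f r \<le> ?S" using st by (intro SUP_upper) auto
        moreover have "?S < f r" using b(2) r by auto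
        ultimately show False by simp
      qed
    qed
  qed
qed

lemma floor_right_continuous:
  fixes c s :: real
  assumes n: "0 \<le> c"
  shows "\<forall>\<^sub>F r in at_right s. nat \<lfloor>c * r\<rfloor> = nat \<lfloor>c * s\<rfloor>"
proof (cases "c = 0")
  case False
  then have c: "0 < c" using n by simp
  have b: "s < (of_int \<lfloor>c * s\<rfloor> + 1) / c" using c by (simp add: less_divide_eq mult.commute)
  show ?thesis
    unfolding eventually_at_right_field
  proof (intro exI conjI allI impI)
    show "s < (of_int \<lfloor>c * s\<rfloor> + 1) / c" by (rule b)
    fix r assume r: "s < r" "r < (of_int \<lfloor>c * s\<rfloor> + 1) / c"
    have "c * s \<le> c * r" using r c by simp
    moreover have "c * r < of_int \<lfloor>c * s\<rfloor> + 1" using r c by (simp add: less_divide_eq mult.commute)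
    ultimately have "\<lfloor>c * r\<rfloor> = \<lfloor>c * s\<rfloor>" by linarith
    then show "nat \<lfloor>c * r\<rfloor> = nat \<lfloor>c * s\<rfloor>" by simp
  qed
qed simp

text \<open>Serves twice: for the integral of the drift, and for the continuity in time of the limit
  process.\<close>

lemma set_integral_Lipschitz:
  fixes f :: "real \<Rightarrow> 'a::euclidean_space"
  assumes [measurable]: "(\<lambda>u. f (max 0 u)) \<in> borel_measurable borel"
    and b: "\<And>u. 0 \<le> u \<Longrightarrow> u \<le> R \<Longrightarrow> norm (f u) \<le> B" and st: "0 \<le> s" "s \<le> t" "t \<le> R"
  shows "norm ((LINT u:{0..t}|lborel. f u) - (LINT u:{0..s}|lborel. f u)) \<le> B * (t - s)"
proof -
  have B: "0 \<le> B" using order_trans[OF norm_ge_zero b[of 0]] st by simp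
  have eq: "indicator {0..r} u *\<^sub>R f u = indicator {0..r} u *\<^sub>R f (max 0 u)" for r u
    by (auto split: split_indicator simp: max_def)
  have int: "integrable lborel (\<lambda>u. indicator {0..r} u *\<^sub>R f u)" if "r \<le> R" for r
    unfolding eq
  proof (rule Bochner_Integration.integrable_bound[where f = "\<lambda>u. B * indicator {0..R} u"])
    show "integrable lborel (\<lambda>u. B * indicator {0..R} u)"
      using st by (intro integrable_mult_right integrable_real_indicator) (auto simp: emeasure_lborel_Icc)
    show "AE u in lborel. norm (indicator {0..r} u *\<^sub>R f (max 0 u)) \<le> norm (B * indicator {0..R} u)"
      using b that B by (intro AE_I2) (auto split: split_indicator simp: max_def)
  qed measurable
  have "norm ((LINT u:{0..t}|lborel. f u) - (LINT u:{0..s}|lborel. f u))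
      = norm (\<integral>u. indicator {0..t} u *\<^sub>R f u - indicator {0..s} u *\<^sub>R f u \<partial>lborel)"
    using int[of t] int[of s] st unfolding set_lebesgue_integral_def
    by (subst Bochner_Integration.integral_diff) auto
  also have "\<dots> \<le> (\<integral>u. norm (indicator {0..t} u *\<^sub>R f u - indicator {0..s} u *\<^sub>R f u) \<partial>lborel)"
    by (rule integral_norm_bound)
  also have "\<dots> \<le> (\<integral>u. B * indicator {s<..t} u \<partial>lborel)"
  proof (rule integral_mono)
    show "integrable lborel (\<lambda>u. norm (indicator {0..t} u *\<^sub>R f u - indicator {0..s} u *\<^sub>R f u))"
      using int[of t] int[of s] st by auto
    show "integrable lborel (\<lambda>u. B * indicator {s<..t} u)"
      using st by (intro integrable_mult_right integrable_real_indicator) (auto simp: emeasure_lborel_Ioc)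
    show "norm (indicator {0..t} u *\<^sub>R f u - indicator {0..s} u *\<^sub>R f u) \<le> B * indicator {s<..t} u" for u
      using b[of u] st by (auto split: split_indicator)
  qed
  also have "\<dots> = B * (t - s)" using st by simp
  finally show ?thesis .
qed

section \<open>Reduction to matrix entries\<close>

lemma norm_vec_le_sum: "norm (x :: ('a::real_normed_vector) ^ 'n) \<le> (\<Sum>i\<in>UNIV. norm (x $ i))"
  unfolding norm_vec_def by (rule L2_set_le_sum) simp

lemma norm_matrix_le_sum: "norm (A :: real ^ 'c ^ 'r) \<le> (\<Sum>i\<in>UNIV. \<Sum>j\<in>UNIV. \<bar>A $ i $ j\<bar>)"
  by (rule order_trans[OF norm_vec_le_sum]) (intro sum_mono norm_le_l1_cart)

context ito_process
begin

text \<open>The path on a compact time interval has compact closure, and a continuous map is bounded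
  there.\<close>

lemma continuous_path_image:
  fixes \<Phi> :: "real ^ 'e ^ 'd \<Rightarrow> 'z::euclidean_space"
  assumes \<Phi>: "continuous_on UNIV \<Phi>" and \<omega>: "\<omega> \<in> space M" and T: "0 \<le> T"
  obtains B where "(\<lambda>u. \<Phi> (\<sigma> (max 0 u) \<omega>)) \<in> borel_measurable borel"
    "\<And>u. 0 \<le> u \<Longrightarrow> u \<le> T \<Longrightarrow> norm (\<Phi> (\<sigma> u \<omega>)) \<le> B"
    "integrable lborel (\<lambda>u. indicator {0..T} u *\<^sub>R \<Phi> (\<sigma> u \<omega>))"
proof -
  have m [measurable]: "(\<lambda>u. \<Phi> (\<sigma> (max 0 u) \<omega>)) \<in> borel_measurable borel"
    by (rule measurable_compose[OF sigma_path_meas[OF \<omega>] borel_measurable_continuous_onI[OF \<Phi>]])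
  let ?S = "(\<lambda>t. \<sigma> t \<omega>) ` {0..T}"
  have "bounded ?S" by (rule cadlag_bounded[OF cadlag[OF \<omega>] T])
  then have "compact (closure ?S)" by simp
  then have "bounded (\<Phi> ` closure ?S)"
    by (intro compact_imp_bounded compact_continuous_image continuous_on_subset[OF \<Phi>]) auto
  then obtain B where B: "\<And>A. A \<in> closure ?S \<Longrightarrow> norm (\<Phi> A) \<le> B" unfolding bounded_iff by blast
  have b: "norm (\<Phi> (\<sigma> u \<omega>)) \<le> B" if "0 \<le> u" "u \<le> T" for u
    by (rule B[OF subsetD[OF closure_subset]]) (use that in auto)
  have "integrable lborel (\<lambda>u. indicator {0..T} u *\<^sub>R \<Phi> (\<sigma> (max 0 u) \<omega>))"
  proof (rule integrableI_bounded_set_indicator[where B = B])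
    show "AE u in lborel. u \<in> {0..T} \<longrightarrow> norm (\<Phi> (\<sigma> (max 0 u) \<omega>)) \<le> B" using b by simp
  qed (use T in \<open>auto simp: emeasure_lborel_Icc\<close>)
  also have "(\<lambda>u. indicator {0..T} u *\<^sub>R \<Phi> (\<sigma> (max 0 u) \<omega>)) = (\<lambda>u. indicator {0..T} u *\<^sub>R \<Phi> (\<sigma> u \<omega>))"
    by (auto split: split_indicator)
  finally show ?thesis using that[OF m b] by blast
qed

context
  fixes g :: "real ^ 'd \<Rightarrow> real ^ 'b ^ 'a" and h :: "real ^ 'd \<Rightarrow> real ^ 'c ^ 'b"
  assumes g: "\<And>i j. continuous_on UNIV (\<lambda>x. g x $ i $ j)" "\<And>i j. poly_growth (\<lambda>x. g x $ i $ j)"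
    and h: "\<And>i j. continuous_on UNIV (\<lambda>x. h x $ i $ j)" "\<And>i j. poly_growth (\<lambda>x. h x $ i $ j)"
begin

lemma realised_Z: "realised g h Y n t \<omega> = (1 / real n) *\<^sub>R (\<Sum>j<nat \<lfloor>real n * t\<rfloor>. g (Z n j \<omega>) ** h (Z n (Suc j) \<omega>))"
proof -
  have Z: "Z n j \<omega> = sqrt (real n) *\<^sub>R incr n (Suc j) Y \<omega>" for j
    by (simp add: Z_def incr_def)
  show ?thesis
    unfolding realised_def Z by (simp add: One_nat_def sum.atLeast1_atMost_eq)
qed

lemma rho_meas: "(\<lambda>x. g x $ i $ j) \<in> borel_measurable borel" "(\<lambda>x. h x $ k $ l) \<in> borel_measurable borel"
  by (intro borel_measurable_continuous_onI g h)+

lemma continuous_rho_prod: "continuous_on UNIV (\<lambda>A :: real ^ 'e ^ 'd. rho A g ** rho A h)"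
proof -
  have "continuous_on UNIV (\<lambda>A :: real ^ 'e ^ 'd. rho A g $ i $ j)" for i j
  proof -
    obtain C m where C: "0 < C" "\<And>x. \<bar>g x $ i $ j\<bar> \<le> C * (1 + norm x) ^ m" using poly_growth_nat[OF g(2)[of i j]] by blast
    show ?thesis unfolding rho_gauss_mean[OF rho_meas(1)]
      by (rule continuous_on_gauss_mean[OF g(1) less_imp_le[OF C(1)] C(2)])
  qed
  moreover have "continuous_on UNIV (\<lambda>A :: real ^ 'e ^ 'd. rho A h $ i $ j)" for i j
  proof -
    obtain C m where C: "0 < C" "\<And>x. \<bar>h x $ i $ j\<bar> \<le> C * (1 + norm x) ^ m" using poly_growth_nat[OF h(2)[of i j]] by blast
    show ?thesis unfolding rho_gauss_mean[OF rho_meas(2)]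
      by (rule continuous_on_gauss_mean[OF h(1) less_imp_le[OF C(1)] C(2)])
  qed
  ultimately show ?thesis
    unfolding matrix_matrix_mult_def by (intro continuous_on_vec_lambda continuous_on_sum continuous_on_mult) blast+
qed

lemma realised_measurable: "realised g h Y n t \<in> borel_measurable M"
proof -
  have e: "realised g h Y n t = (\<lambda>\<omega>. (1 / real n) *\<^sub>R (\<Sum>j<nat \<lfloor>real n * t\<rfloor>. g (Z n j \<omega>) ** h (Z n (Suc j) \<omega>)))"
    by (rule ext) (rule realised_Z)
  have gc: "continuous_on UNIV g" and hc: "continuous_on UNIV h"
  proof -
    have "continuous_on UNIV (\<lambda>x. \<chi> i j. g x $ i $ j)" "continuous_on UNIV (\<lambda>x. \<chi> i j. h x $ i $ j)"
      by (intro continuous_on_vec_lambda g h)+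
    then show "continuous_on UNIV g" "continuous_on UNIV h" by simp_all
  qed
  have [measurable]: "g \<in> borel_measurable borel" "h \<in> borel_measurable borel"
    by (intro borel_measurable_continuous_onI gc hc)+
  have "(\<lambda>\<omega>. g (Z n j \<omega>) ** h (Z n k \<omega>)) \<in> borel_measurable M" for j k
  proof (rule borel_measurable_continuous_Pair[where H = "(**)"])
    show "continuous_on UNIV (\<lambda>p :: (real ^ 'b ^ 'a) \<times> (real ^ 'c ^ 'b). fst p ** snd p)"
      unfolding matrix_matrix_mult_def by (intro continuous_intros)
  qed measurable
  then show ?thesis unfolding e by (intro borel_measurable_scaleR borel_measurable_const borel_measurable_sum)
qed

lemma realised_limit_measurable: "realised_limit g h \<sigma> t \<in> borel_measurable M"
proof -
  have "(\<lambda>p. rho (\<sigma> (max 0 (snd p)) (fst p)) g ** rho (\<sigma> (max 0 (snd p)) (fst p)) h) \<in> borel_measurable (M \<Otimes>\<^sub>M borel)"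
    by (rule measurable_compose[OF sigma_joint borel_measurable_continuous_onI[OF continuous_rho_prod]])
  then have [measurable]: "(\<lambda>p. rho (\<sigma> (max 0 (snd p)) (fst p)) g ** rho (\<sigma> (max 0 (snd p)) (fst p)) h) \<in> borel_measurable (M \<Otimes>\<^sub>M lborel)"
    by simp
  have "(\<lambda>\<omega>. LINT u:{0..t}|lborel. rho (\<sigma> (max 0 u) \<omega>) g ** rho (\<sigma> (max 0 u) \<omega>) h) \<in> borel_measurable M"
    unfolding set_lebesgue_integral_def
    by (rule lborel.borel_measurable_lebesgue_integral) (unfold split_beta, measurable)
  moreover have "realised_limit g h \<sigma> t \<omega> = (LINT u:{0..t}|lborel. rho (\<sigma> (max 0 u) \<omega>) g ** rho (\<sigma> (max 0 u) \<omega>) h)" for \<omega>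
    unfolding realised_limit_def by (rule set_lebesgue_integral_cong) (auto simp: max_def)
  ultimately show ?thesis by (simp cong: measurable_cong)
qed

text \<open>Both processes are right-continuous in \<open>s\<close>, one as a step function and the
  other as a locally Lipschitz path, so the supremum reduces to countably many measurable
  terms.\<close>

lemma sup_measurable:
  assumes t: "0 \<le> t"
  shows "(\<lambda>\<omega>. SUP s\<in>{0..t}. ennreal (norm (realised g h Y n s \<omega> - realised_limit g h \<sigma> s \<omega>))) \<in> borel_measurable M"
proof -
  note [measurable] = realised_measurable realised_limit_measurable
  have "(\<lambda>\<omega>. SUP s\<in>insert t (\<rat> \<inter> {0..t}). ennreal (norm (realised g h Y n s \<omega> - realised_limit g h \<sigma> s \<omega>))) \<in> borel_measurable M"
    by (rule borel_measurable_SUP) (auto intro!: countable_Int1 countable_rat)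
  moreover have "(SUP s\<in>insert t (\<rat> \<inter> {0..t}). ennreal (norm (realised g h Y n s \<omega> - realised_limit g h \<sigma> s \<omega>)))
      = (SUP s\<in>{0..t}. ennreal (norm (realised g h Y n s \<omega> - realised_limit g h \<sigma> s \<omega>)))" if \<omega>: "\<omega> \<in> space M" for \<omega>
  proof (rule SUP_right_continuous[OF t, symmetric])
    fix s assume s: "0 \<le> s" "s < t"
    obtain B where m: "(\<lambda>u. rho (\<sigma> (max 0 u) \<omega>) g ** rho (\<sigma> (max 0 u) \<omega>) h) \<in> borel_measurable borel"
      and B: "\<And>u. 0 \<le> u \<Longrightarrow> u \<le> t \<Longrightarrow> norm (rho (\<sigma> u \<omega>) g ** rho (\<sigma> u \<omega>) h) \<le> B"
      using continuous_path_image[OF continuous_rho_prod \<omega> t] by blast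
    have "((\<lambda>r. realised_limit g h \<sigma> r \<omega> - realised_limit g h \<sigma> s \<omega>) \<longlongrightarrow> 0) (at_right s)"
    proof (rule Lim_null_comparison)
      show "\<forall>\<^sub>F r in at_right s. norm (realised_limit g h \<sigma> r \<omega> - realised_limit g h \<sigma> s \<omega>) \<le> B * (r - s)"
        unfolding eventually_at_right_field realised_limit_def
        by (intro exI[of _ t] conjI allI impI s set_integral_Lipschitz[OF m B]) (use s in auto)
      have "((\<lambda>r. B * (r - s)) \<longlongrightarrow> B * (s - s)) (at_right s)" by (intro tendsto_intros)
      then show "((\<lambda>r. B * (r - s)) \<longlongrightarrow> 0) (at_right s)" by simp
    qed
    then have L: "((\<lambda>r. realised_limit g h \<sigma> r \<omega>) \<longlongrightarrow> realised_limit g h \<sigma> s \<omega>) (at_right s)"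
      by (simp add: LIM_zero_iff)
    have "((\<lambda>r. realised g h Y n r \<omega>) \<longlongrightarrow> realised g h Y n s \<omega>) (at_right s)"
    proof (rule tendsto_eventually)
      show "\<forall>\<^sub>F r in at_right s. realised g h Y n r \<omega> = realised g h Y n s \<omega>"
        using floor_right_continuous[of "real n" s] by (auto simp: realised_def elim: eventually_mono)
    qed
    with L show "((\<lambda>r. ennreal (norm (realised g h Y n r \<omega> - realised_limit g h \<sigma> r \<omega>)))
        \<longlongrightarrow> ennreal (norm (realised g h Y n s \<omega> - realised_limit g h \<sigma> s \<omega>))) (at_right s)"
      by (intro tendsto_ennrealI tendsto_norm tendsto_diff)
  qed
  ultimately show ?thesis by (simp cong: measurable_cong)
qed

text \<open>Taking an entry is a bounded linear map and commutes with the integral; the sum over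
  \<open>k\<close> can be pulled out because each summand is integrable on its own.\<close>

lemma realised_limit_entry:
  assumes \<omega>: "\<omega> \<in> space M" and t: "0 \<le> t"
  shows "realised_limit g h \<sigma> t \<omega> $ i $ l = (\<Sum>k\<in>UNIV. LINT u:{0..t}|lborel.
    gauss_mean (\<lambda>x. g x $ i $ k) (\<sigma> u \<omega>) * gauss_mean (\<lambda>x. h x $ k $ l) (\<sigma> u \<omega>))"
proof -
  let ?f = "\<lambda>u. rho (\<sigma> u \<omega>) g ** rho (\<sigma> u \<omega>) h"
  have int: "integrable lborel (\<lambda>u. indicator {0..t} u *\<^sub>R ?f u)"
    using continuous_path_image[OF continuous_rho_prod \<omega> t] by blast
  define p where "p k A = gauss_mean (\<lambda>x. g x $ i $ k) A * gauss_mean (\<lambda>x. h x $ k $ l) A" for k and A :: "real ^ 'e ^ 'd"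
  have pint: "integrable lborel (\<lambda>u. indicator {0..t} u *\<^sub>R p k (\<sigma> u \<omega>))" for k
  proof -
    obtain C1 k1 where C1: "0 < C1" "\<And>x. \<bar>g x $ i $ k\<bar> \<le> C1 * (1 + norm x) ^ k1" using poly_growth_nat[OF g(2)[of i k]] by blast
    obtain C2 k2 where C2: "0 < C2" "\<And>x. \<bar>h x $ k $ l\<bar> \<le> C2 * (1 + norm x) ^ k2" using poly_growth_nat[OF h(2)[of k l]] by blast
    have "continuous_on UNIV (p k)" unfolding p_def[abs_def]
      by (intro continuous_on_mult continuous_on_gauss_mean[OF g(1) less_imp_le[OF C1(1)] C1(2)]
          continuous_on_gauss_mean[OF h(1) less_imp_le[OF C2(1)] C2(2)])
    from continuous_path_image[OF this \<omega> t] show ?thesis by blast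
  qed
  have bl: "bounded_linear (\<lambda>A :: real ^ 'c ^ 'a. A $ i $ l)"
    using bounded_linear_compose[OF bounded_linear_vec_nth[of l] bounded_linear_vec_nth[of i]] by simp
  have "realised_limit g h \<sigma> t \<omega> $ i $ l = (\<integral>u. (indicator {0..t} u *\<^sub>R ?f u) $ i $ l \<partial>lborel)"
    unfolding realised_limit_def set_lebesgue_integral_def
    by (rule integral_bounded_linear[OF bl int, symmetric])
  also have "\<dots> = (\<integral>u. (\<Sum>k\<in>UNIV. indicator {0..t} u *\<^sub>R p k (\<sigma> u \<omega>)) \<partial>lborel)"
    by (simp add: matrix_matrix_mult_def rho_gauss_mean[OF rho_meas(1)] rho_gauss_mean[OF rho_meas(2)] p_def sum_distrib_left)
  also have "\<dots> = (\<Sum>k\<in>UNIV. \<integral>u. indicator {0..t} u *\<^sub>R p k (\<sigma> u \<omega>) \<partial>lborel)"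
    by (rule Bochner_Integration.integral_sum) (rule pint)
  finally show ?thesis unfolding set_lebesgue_integral_def p_def .
qed

text \<open>Each entry of the matrix product is a finite sum of products of scalar functions, to
  which the scalar result applies; finitely many exceptional sets are united.\<close>

lemma realised_convergence: "ucp_tendsto M (\<lambda>n. realised g h Y n) (\<lambda>t. realised_limit g h \<sigma> t)"
  unfolding ucp_tendsto_def
proof (intro allI impI tends_to_zero_in_probI)
  fix t :: real assume t: "0 \<le> t"
  show "(\<lambda>\<omega>. SUP s\<in>{0..t}. ennreal (norm (realised g h Y n s \<omega> - realised_limit g h \<sigma> s \<omega>))) \<in> borel_measurable M" for n
    by (rule sup_measurable[OF t])
  fix \<epsilon> :: real assume e: "0 < \<epsilon>"
  define T where "T = nat \<lceil>t\<rceil>"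
  have T: "t \<le> real T" by (simp add: T_def real_nat_ceiling_ge)
  \<comment> \<open>The number of scalar terms in the bound of the norm: entries of the result times
    summands of the matrix product.\<close>
  define N where "N = real (CARD('a) * (CARD('c) * CARD('b)))"
  have N: "0 < N" by (simp add: N_def)
  define V where "V k i l n s \<omega> = (1 / real n) * (\<Sum>j<nat \<lfloor>real n * s\<rfloor>. g (Z n j \<omega>) $ i $ k * h (Z n (Suc j) \<omega>) $ k $ l)" for k :: 'b and i :: 'a and l :: 'c and n s \<omega>
  define L where "L k i l s \<omega> = (LINT u:{0..s}|lborel. gauss_mean (\<lambda>x. g x $ i $ k) (\<sigma> u \<omega>) * gauss_mean (\<lambda>x. h x $ k $ l) (\<sigma> u \<omega>))" for k :: 'b and i :: 'a and l :: 'c and s \<omega>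
  have "whp M (\<lambda>n \<omega>. \<forall>s\<in>{0..real T}. \<bar>V k i l n s \<omega> - L k i l s \<omega>\<bar> \<le> \<epsilon> / N)" for k i l
  proof -
    obtain C1 m1 where C1: "0 < C1" "\<And>x. \<bar>g x $ i $ k\<bar> \<le> C1 * (1 + norm x) ^ m1" using poly_growth_nat[OF g(2)[of i k]] by blast
    obtain C2 k2 where C2: "0 < C2" "\<And>x. \<bar>h x $ k $ l\<bar> \<le> C2 * (1 + norm x) ^ k2" using poly_growth_nat[OF h(2)[of k l]] by blast
    show ?thesis unfolding V_def L_def
      by (rule scalar_convergence[OF g(1) less_imp_le[OF C1(1)] C1(2) h(1) less_imp_le[OF C2(1)] C2(2)]) (use e N in simp)
  qed
  then have "whp M (\<lambda>n \<omega>. \<forall>p\<in>(UNIV :: ('b \<times> 'a \<times> 'c) set). \<forall>s\<in>{0..real T}.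
      \<bar>V (fst p) (fst (snd p)) (snd (snd p)) n s \<omega> - L (fst p) (fst (snd p)) (snd (snd p)) s \<omega>\<bar> \<le> \<epsilon> / N)"
    by (intro whp_ball_finite[OF finite]) blast
  then show "whp M (\<lambda>n \<omega>. (SUP s\<in>{0..t}. ennreal (norm (realised g h Y n s \<omega> - realised_limit g h \<sigma> s \<omega>))) \<le> ennreal \<epsilon>)"
  proof (rule whp_mono[where m = 0])
    fix n \<omega> assume \<omega>: "\<omega> \<in> space M" and *: "\<forall>p\<in>(UNIV :: ('b \<times> 'a \<times> 'c) set). \<forall>s\<in>{0..real T}.
      \<bar>V (fst p) (fst (snd p)) (snd (snd p)) n s \<omega> - L (fst p) (fst (snd p)) (snd (snd p)) s \<omega>\<bar> \<le> \<epsilon> / N"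
    have VL: "\<bar>V k i l n s \<omega> - L k i l s \<omega>\<bar> \<le> \<epsilon> / N" if "s \<in> {0..real T}" for k i l s
      using bspec[OF bspec[OF * UNIV_I[of "(k, i, l)"]] that] by simp
    show "(SUP s\<in>{0..t}. ennreal (norm (realised g h Y n s \<omega> - realised_limit g h \<sigma> s \<omega>))) \<le> ennreal \<epsilon>"
    proof (rule SUP_least, rule ennreal_leI)
      fix s assume s: "s \<in> {0..t}"
      then have sT: "s \<in> {0..real T}" "0 \<le> s" using T by auto
      have V: "realised g h Y n s \<omega> $ i $ l = (\<Sum>k\<in>UNIV. V k i l n s \<omega>)" for i l
        unfolding realised_Z V_def
        by (simp add: matrix_matrix_mult_def sum_distrib_left) (rule sum.swap)
      have L: "realised_limit g h \<sigma> s \<omega> $ i $ l = (\<Sum>k\<in>UNIV. L k i l s \<omega>)" for i l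
        unfolding L_def by (rule realised_limit_entry[OF \<omega> sT(2)])
      have "norm (realised g h Y n s \<omega> - realised_limit g h \<sigma> s \<omega>)
          \<le> (\<Sum>i\<in>UNIV. \<Sum>l\<in>UNIV. \<bar>(realised g h Y n s \<omega> - realised_limit g h \<sigma> s \<omega>) $ i $ l\<bar>)"
        by (rule norm_matrix_le_sum)
      also have "\<dots> \<le> (\<Sum>i\<in>(UNIV :: 'a set). \<Sum>l\<in>(UNIV :: 'c set). \<Sum>k\<in>(UNIV :: 'b set). \<epsilon> / N)"
      proof (intro sum_mono)
        fix i :: 'a and l :: 'c
        have "\<bar>(realised g h Y n s \<omega> - realised_limit g h \<sigma> s \<omega>) $ i $ l\<bar> = \<bar>\<Sum>k\<in>UNIV. V k i l n s \<omega> - L k i l s \<omega>\<bar>"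
          by (simp add: V L sum_subtractf)
        also have "\<dots> \<le> (\<Sum>k\<in>UNIV. \<bar>V k i l n s \<omega> - L k i l s \<omega>\<bar>)" by (rule sum_abs)
        also have "\<dots> \<le> (\<Sum>k\<in>(UNIV :: 'b set). \<epsilon> / N)" by (intro sum_mono VL sT)
        finally show "\<bar>(realised g h Y n s \<omega> - realised_limit g h \<sigma> s \<omega>) $ i $ l\<bar> \<le> (\<Sum>k\<in>(UNIV :: 'b set). \<epsilon> / N)" .
      qed
      also have "\<dots> = N * (\<epsilon> / N)" by (simp add: N_def)
      also have "\<dots> = \<epsilon>" using N by simp
      finally show "norm (realised g h Y n s \<omega> - realised_limit g h \<sigma> s \<omega>) \<le> \<epsilon>" .
    qed
  qed
qed

end

end

theorem theorem1:
  fixes M :: "'w measure" and F :: "real \<Rightarrow> 'w measure"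
    and W :: "real \<Rightarrow> 'w \<Rightarrow> real ^ 'e"
    and a :: "real \<Rightarrow> 'w \<Rightarrow> real ^ 'd"
    and \<sigma> :: "real \<Rightarrow> 'w \<Rightarrow> real ^ 'e ^ 'd"
    and I Y :: "real \<Rightarrow> 'w \<Rightarrow> real ^ 'd"
    and g :: "real ^ 'd \<Rightarrow> real ^ 'd2 ^ 'd1"
    and h :: "real ^ 'd \<Rightarrow> real ^ 'd3 ^ 'd2"
  assumes "filtered_prob_space M F"
    and "brownian_motion M F W"
    and "predictable M F a"
    and "\<forall>\<omega>\<in>space M. locally_bounded_path (\<lambda>t. a t \<omega>)"
    and "adapted F \<sigma>"
    and "\<forall>\<omega>\<in>space M. cadlag (\<lambda>t. \<sigma> t \<omega>)"
    and "is_ito_integral M F W (\<lambda>u \<omega>. left_limit (\<lambda>s. \<sigma> s \<omega>) u) I"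
    and "\<forall>t\<ge>0. Y t \<in> borel_measurable M"
    and "AE \<omega> in M. \<forall>t\<ge>0. Y t \<omega> = Y 0 \<omega> + (LINT u:{0..t}|lborel. a u \<omega>) + I t \<omega>"
    and "\<forall>i j. continuous_on UNIV (\<lambda>x. g x $ i $ j) \<and> poly_growth (\<lambda>x. g x $ i $ j)"
    and "\<forall>i j. continuous_on UNIV (\<lambda>x. h x $ i $ j) \<and> poly_growth (\<lambda>x. h x $ i $ j)"
  shows "ucp_tendsto M (\<lambda>n. realised g h Y n) (\<lambda>t. realised_limit g h \<sigma> t)"
proof -
  interpret P: prob_space M using assms(1) unfolding filtered_prob_space_def by blast
  have sub: "sets (F t) \<subseteq> sets M" if "0 \<le> t" for t
    using assms(1) that unfolding filtered_prob_space_def subalgebra_def by blast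
  interpret ito_process M F W \<sigma> I Y
  proof unfold_locales
    show "AE \<omega> in M. \<forall>R\<ge>0. \<exists>C. \<forall>s t. 0 \<le> s \<longrightarrow> s \<le> t \<longrightarrow> t \<le> R \<longrightarrow>
      norm ((Y t \<omega> - I t \<omega>) - (Y s \<omega> - I s \<omega>)) \<le> C * (t - s)"
      using assms(9) AE_space
    proof eventually_elim
      case (elim \<omega>)
      have m: "(\<lambda>u. a (max 0 u) \<omega>) \<in> borel_measurable borel"
        using measurable_compose[OF measurable_Pair1' predictable_joint[OF sub assms(3)], of \<omega>] elim(2) by simp
      show ?case
      proof (intro allI impI)
        fix R :: real assume R: "0 \<le> R"
        \<comment> \<open>A bound for the path of \<open>a\<close> on \<open>[0, R]\<close> is a
          Lipschitz constant for its integral, and hence for the path of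
          \<open>Y - I\<close>.\<close>
        obtain C where b: "\<And>u. 0 \<le> u \<Longrightarrow> u \<le> R \<Longrightarrow> norm (a u \<omega>) \<le> C"
          using assms(4) elim(2) R unfolding locally_bounded_path_def bounded_iff by fastforce
        have C: "norm ((LINT u:{0..t}|lborel. a u \<omega>) - (LINT u:{0..s}|lborel. a u \<omega>)) \<le> C * (t - s)"
          if "0 \<le> s" "s \<le> t" "t \<le> R" for s t
          by (rule set_integral_Lipschitz[where f = "\<lambda>u. a u \<omega>", OF m b that])
        show "\<exists>C. \<forall>s t. 0 \<le> s \<longrightarrow> s \<le> t \<longrightarrow> t \<le> R \<longrightarrow> norm ((Y t \<omega> - I t \<omega>) - (Y s \<omega> - I s \<omega>)) \<le> C * (t - s)"
        proof (intro exI[of _ C] allI impI)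
          fix s t :: real assume st: "0 \<le> s" "s \<le> t" "t \<le> R"
          then have "(Y t \<omega> - I t \<omega>) - (Y s \<omega> - I s \<omega>) = (LINT u:{0..t}|lborel. a u \<omega>) - (LINT u:{0..s}|lborel. a u \<omega>)"
            using elim(1)[rule_format, of t] elim(1)[rule_format, of s] by (simp add: algebra_simps)
          with C[OF st] show "norm ((Y t \<omega> - I t \<omega>) - (Y s \<omega> - I s \<omega>)) \<le> C * (t - s)" by simp
        qed
      qed
    qed
  qed (use assms in blast)+
  show ?thesis by (rule realised_convergence) (use assms(10,11) in blast)+
qed

end
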